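(* Let $G$ be a locally compact abelian (Hausdorff) topological group. Then $G^+$ is sequentially Ascoli if and only if $G$ is compact.
   Context: $G^+$ denotes the group $G$ endowed with the Bohr topology, i.e. the topology induced on $G$ from its Bohr compactification $bG$ (equivalently, the weakest topology on $G$ making all continuous characters $G\to\mathbb{T}$ continuous). A Tychonoff space $X$ is sequentially Ascoli if every convergent sequence $S$ in $C_k(X)$ (the space of continuous real-valued functions on $X$ with the compact-open topology) is equicontinuous, i.e. for every $x\in X$ and $\varepsilon>0$ there is a neighborhood $O$ of $x$ with $|f(t)-f(x)|<\varepsilon$ for all $t\in O$ and $f\in S$. *)

theory Defs
  imports "HOL-Analysis.Analysis"
begin

definition continuous_character :: "('a::topological_ab_group_add \<Rightarrow> complex) \<Rightarrow> bool" where
  "continuous_character \<phi> \<longleftrightarrow>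
     continuous_on UNIV \<phi> \<and> range \<phi> \<subseteq> sphere 0 1 \<and> (\<forall>x y. \<phi> (x + y) = \<phi> x * \<phi> y)"

definition bohr_topology :: "'a::topological_ab_group_add topology" where
  "bohr_topology = topology_generated_by {\<phi> -` U | \<phi> U. continuous_character \<phi> \<and> open U}"

lemma continuous_character_one: "continuous_character (\<lambda>_. 1)"
  by (simp add: continuous_character_def)

lemma openin_bohr_topology_vimage:
  "continuous_character \<phi> \<Longrightarrow> open U \<Longrightarrow> openin bohr_topology (\<phi> -` U)"
  unfolding bohr_topology_def by (rule topology_generated_by_Basis) blast

lemma topspace_bohr_topology [simp]: "topspace bohr_topology = UNIV"
  using openin_subset[OF openin_bohr_topology_vimage[OF continuous_character_one open_UNIV]]
  by (simp add: top.extremum_unique)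

lemma continuous_map_bohr_topology:
  "continuous_character \<phi> \<Longrightarrow> continuous_map bohr_topology euclidean \<phi>"
  using openin_bohr_topology_vimage[of \<phi>] by (simp add: continuous_map_def vimage_def)

lemma bohr_topology_weakest:
  assumes "topspace X = UNIV"
    and "\<And>\<phi>. continuous_character \<phi> \<Longrightarrow> continuous_map X euclidean \<phi>"
    and "openin bohr_topology W"
  shows "openin X W"
proof (rule generate_topology_on_coarsest[OF istopology_openin])
  show "generate_topology_on {\<phi> -` U | \<phi> U. continuous_character \<phi> \<and> open U} W"
    using assms(3) unfolding bohr_topology_def by (rule openin_topology_generated_by)
next
  fix S assume "S \<in> {\<phi> -` U | \<phi> U. continuous_character (\<phi> :: 'a \<Rightarrow> complex) \<and> open U}"
  then obtain \<phi> U where "S = \<phi> -` U" "continuous_character \<phi>" "open U"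
    by (elim CollectE exE conjE)
  then show "openin X S"
    using assms(1) openin_continuous_map_preimage[OF assms(2), of \<phi> U]
    by (simp add: vimage_def)
qed

(* As in the library's function spaces, functions are taken extensional, so that they are
   determined by their values on topspace X; this is vacuous when topspace X = UNIV. *)
definition cont_functions :: "'a topology \<Rightarrow> ('a \<Rightarrow> real) set" where
  "cont_functions X = {f. continuous_map X euclideanreal f \<and> f \<in> extensional (topspace X)}"

definition compact_open_topology :: "'a topology \<Rightarrow> ('a \<Rightarrow> real) topology" where
  "compact_open_topology X =
     topology_generated_by {{f \<in> cont_functions X. f ` K \<subseteq> U} | K U. compactin X K \<and> open U}"

lemma topspace_compact_open_topology [simp]:
  "topspace (compact_open_topology X) = cont_functions X"
proof
  show "topspace (compact_open_topology X) \<subseteq> cont_functions X"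
    unfolding compact_open_topology_def topology_generated_by_topspace
    by (rule Union_least) (elim CollectE exE conjE, simp)
next
  have "openin (compact_open_topology X) {f \<in> cont_functions X. f ` {} \<subseteq> UNIV}"
    unfolding compact_open_topology_def
    by (rule topology_generated_by_Basis, rule CollectI, intro exI conjI)
       (rule refl, rule compactin_empty, rule open_UNIV)
  from openin_subset[OF this] show "cont_functions X \<subseteq> topspace (compact_open_topology X)"
    by simp
qed

definition equicontinuous_family :: "'a topology \<Rightarrow> ('a \<Rightarrow> real) set \<Rightarrow> bool" where
  "equicontinuous_family X S \<longleftrightarrow>
     (\<forall>x \<in> topspace X. \<forall>\<epsilon>>0. \<exists>N. openin X N \<and> x \<in> N \<and> (\<forall>t\<in>N. \<forall>f\<in>S. \<bar>f t - f x\<bar> < \<epsilon>))"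

definition Tychonoff_space :: "'a topology \<Rightarrow> bool" where
  "Tychonoff_space X \<longleftrightarrow> completely_regular_space X \<and> Hausdorff_space X"

(* limitin only constrains a tail of the sequence, so membership of all its terms in the
   function space is required separately. *)
definition sequentially_Ascoli :: "'a topology \<Rightarrow> bool" where
  "sequentially_Ascoli X \<longleftrightarrow>
     Tychonoff_space X \<and>
     (\<forall>(s :: nat \<Rightarrow> 'a \<Rightarrow> real) f.
        range s \<subseteq> topspace (compact_open_topology X) \<and>
        limitin (compact_open_topology X) s f sequentially
        \<longrightarrow> equicontinuous_family X (range s))"

end

theory Submission
  imports Defs "HOL-Library.Function_Algebras"
begin

text \<open>
  If \<open>G\<close> is compact, its continuous characters separate points, so \<open>G\<close> with the Bohr topology is \<open>G\<close> itself,
  and a compact-open convergent sequence on a compact space is equicontinuous. Separation is proved by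
  hand: the invariant mean of a continuous function is the common limit of its averages over
  translates; for a hermitian kernel \<open>k\<close> the normalised convolution powers of \<open>k * k\<close> converge uniformly
  to an idempotent; every idempotent has \<open>L\<^sup>2\<close>-norm at least 1, so minimal idempotents exist, and these
  are multiples of characters.

  If \<open>G\<close> is not compact, there are distinct characters \<open>\<psi> n\<close> with \<open>(\<Sum>n. \<bar>\<psi> n x - 1\<bar>) < \<infinity>\<close> for every \<open>x\<close>,
  and this sum is small for \<open>x\<close> near 0. Either a compact neighbourhood generates a non-compact open
  subgroup; then word length has positive growth rate at some element, a Hahn-Banach argument gives a
  non-zero continuous real homomorphism \<open>L\<close>, and \<open>\<psi> n = exp (2 \<pi> i L / 2\<^sup>n)\<close> works. Or there is a strictly
  increasing sequence of open subgroups, and \<open>\<psi> n\<close> is chosen trivial on the \<open>n\<close>-th but not on the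
  next one. All products of subfamilies of the \<open>\<psi> n\<close> are again continuous characters, and a gliding hump
  argument shows that \<open>\<psi> n\<close> tends to 1 uniformly on Bohr-compact sets; this replaces Glicksberg's theorem.
  But by total boundedness of the Bohr topology an equicontinuous set of characters is finite.
\<close>

section \<open>Extending homomorphisms of abelian groups\<close>

text \<open>In the non-compact case the conditions on \<psi> n must hold at every point, while the
  constructions only see a subgroup. Extending each character by itself would give no control of the
  sum of |\<psi> n x - 1| outside it. Hence one homomorphism is extended whose values are whole
  sequences: absolutely summable real sequences modulo integer-valued ones. That target is
  divisible, and summability then holds everywhere; continuity costs nothing, since it is decided
  near 0.

  Summability is also what turns every subfamily into a character by infinite multiplication, and
  Bohr-compactness is played off against these additional characters. Bohr-compact sets need not be
  sequentially compact, so each passage to a subsequence involves only countably many characters,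
  whose joint values lie in a metrizable space.

  In the compact case the mean plays the part of Haar measure. The gap between 0 and 1 in the norms
  of idempotents takes the place of the finite-dimensional eigenspaces of a compact
  operator.\<close>

primrec nmul :: "nat \<Rightarrow> 'a::comm_monoid_add \<Rightarrow> 'a" where
  "nmul 0 x = 0"
| "nmul (Suc n) x = x + nmul n x"

lemma nmul_zero_right [simp]: "nmul n 0 = 0"
  by (induction n) auto

lemma nmul_add_left: "nmul (m + n) x = nmul m x + nmul n x"
  by (induction m) (auto simp: add_ac)

lemma nmul_add_right: "nmul n (x + y) = nmul n x + nmul n y"
  by (induction n) (auto simp: add_ac)

lemma nmul_mult: "nmul (m * n) x = nmul m (nmul n x)"
  by (induction m) (auto simp: nmul_add_left)

lemma nmul_minus: "nmul n (- x) = - nmul n (x::'a::ab_group_add)"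
  by (induction n) auto

lemma nmul_diff: "nmul n (x - y) = nmul n x - nmul n (y::'a::ab_group_add)"
  using nmul_add_right[of n x "- y"] by (simp add: nmul_minus)

lemma nmul_real: "nmul n (t::real) = real n * t"
  by (induction n) (auto simp: algebra_simps)

lemma nmul_fun: "nmul n s i = nmul n (s i)"
  by (induction n) auto

lemma nmul_Pair: "nmul n (x, y) = (nmul n x, nmul n y)"
  by (induction n) (auto simp: zero_prod_def)

definition add_subgroup :: "'a::ab_group_add set \<Rightarrow> bool" where
  "add_subgroup S \<longleftrightarrow> 0 \<in> S \<and> (\<forall>x\<in>S. \<forall>y\<in>S. x - y \<in> S)"

lemma add_subgroup_zero: "add_subgroup S \<Longrightarrow> 0 \<in> S"
  and add_subgroup_diff: "add_subgroup S \<Longrightarrow> x \<in> S \<Longrightarrow> y \<in> S \<Longrightarrow> x - y \<in> S"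
  by (auto simp: add_subgroup_def)

lemma add_subgroup_uminus: "add_subgroup S \<Longrightarrow> x \<in> S \<Longrightarrow> - x \<in> S"
  using add_subgroup_diff[of S 0 x] add_subgroup_zero by auto

lemma add_subgroup_add: "add_subgroup S \<Longrightarrow> x \<in> S \<Longrightarrow> y \<in> S \<Longrightarrow> x + y \<in> S"
  using add_subgroup_diff[of S x "- y"] add_subgroup_uminus[of S y] by simp

lemma add_subgroup_nmul: "add_subgroup S \<Longrightarrow> x \<in> S \<Longrightarrow> nmul n x \<in> S"
  by (induction n) (auto intro: add_subgroup_zero add_subgroup_add)

text \<open>Multiples are taken over natural numbers, so an integer multiple of \<open>z\<close> is
  written as a difference of two; closure under subtraction is then immediate.\<close>

definition adjoin :: "'a::ab_group_add \<Rightarrow> 'a set \<Rightarrow> 'a set" where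
  "adjoin z M = {m + nmul i z - nmul j z | m i j. m \<in> M}"

lemma adjoinI: "m \<in> M \<Longrightarrow> m + nmul i z - nmul j z \<in> adjoin z M"
  unfolding adjoin_def by blast

lemma add_subgroup_adjoin:
  assumes "add_subgroup M"
  shows "add_subgroup (adjoin z M)"
  unfolding add_subgroup_def
proof (intro conjI ballI)
  show "0 \<in> adjoin z M"
    using adjoinI[of 0 M 0 z 0] assms by (simp add: add_subgroup_zero)
next
  fix x y assume "x \<in> adjoin z M" "y \<in> adjoin z M"
  then obtain m i j m' i' j' where *: "m \<in> M" "x = m + nmul i z - nmul j z"
    "m' \<in> M" "y = m' + nmul i' z - nmul j' z" unfolding adjoin_def by blast
  have "x - y = (m - m') + nmul (i + j') z - nmul (j + i') z"
    by (simp add: * nmul_add_left algebra_simps)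
  then show "x - y \<in> adjoin z M"
    using adjoinI[OF add_subgroup_diff[OF assms *(1,3)]] by simp
qed

lemma subset_adjoin: "M \<subseteq> adjoin z M"
proof
  fix m assume "m \<in> M" then show "m \<in> adjoin z M" using adjoinI[of m M 0 z 0] by simp
qed

lemma mem_adjoin: "add_subgroup M \<Longrightarrow> z \<in> adjoin z M"
  using adjoinI[of 0 M 1 z 0] by (simp add: add_subgroup_zero)

lemma adjoin_cases:
  assumes "w \<in> adjoin z M"
  obtains m n where "m \<in> M" "w = m + nmul n z" | m n where "m \<in> M" "w = m - nmul n z"
proof -
  obtain m i j where *: "m \<in> M" "w = m + nmul i z - nmul j z"
    using assms unfolding adjoin_def by blast
  show thesis
  proof (cases "j \<le> i")
    case True
    then have "w = m + nmul (i - j) z"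
      using * nmul_add_left[of "i - j" j z] by (simp add: algebra_simps)
    then show thesis using * that(1) by blast
  next
    case False
    then have "w = m - nmul (j - i) z"
      using * nmul_add_left[of "j - i" i z] by (simp add: algebra_simps)
    then show thesis using * that(2) by blast
  qed
qed

text \<open>The Zorn step common to both extension theorems. \<open>Q\<close> is tested element by
  element, so it passes to unions of chains. The last conclusion is maximality in usable form: a
  point lies in \<open>M\<close> as soon as adjoining it does not violate \<open>Q\<close>.\<close>

lemma maximal_add_subgroup:
  assumes "add_subgroup R" "\<And>z. z \<in> R \<Longrightarrow> Q z"
  obtains M where "add_subgroup M" "R \<subseteq> M" "\<And>z. z \<in> M \<Longrightarrow> Q z"
    "\<And>z. (\<And>w. w \<in> adjoin z M \<Longrightarrow> Q w) \<Longrightarrow> z \<in> M"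
proof -
  let ?A = "{M. add_subgroup M \<and> R \<subseteq> M \<and> (\<forall>z\<in>M. Q z)}"
  have "\<exists>M\<in>?A. \<forall>X\<in>?A. M \<subseteq> X \<longrightarrow> X = M"
  proof (rule subset_Zorn_nonempty)
    show "?A \<noteq> {}" using assms by blast
  next
    fix C assume C: "C \<noteq> {}" "subset.chain ?A C"
    then have sub: "X \<in> C \<Longrightarrow> X \<in> ?A" for X by (auto simp: subset.chain_def)
    have sub_add: "add_subgroup X" and sub_R: "R \<subseteq> X" and sub_Q: "\<forall>z\<in>X. Q z" if "X \<in> C" for X
      using sub[OF that] by auto
    obtain X0 where X0: "X0 \<in> C" using C(1) by auto
    have "add_subgroup (\<Union>C)"
      unfolding add_subgroup_def
    proof (intro conjI ballI)
      show "0 \<in> \<Union>C" using X0 add_subgroup_zero[OF sub_add[OF X0]] by (rule UnionI)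
    next
      fix x y assume "x \<in> \<Union>C" "y \<in> \<Union>C"
      then obtain X Y where XY: "X \<in> C" "Y \<in> C" "x \<in> X" "y \<in> Y" by (elim UnionE)
      have "\<forall>X\<in>C. \<forall>Y\<in>C. X \<subseteq> Y \<or> Y \<subseteq> X" using C(2) by (simp add: subset_chain_def)
      from this[THEN bspec, OF XY(1), THEN bspec, OF XY(2)]
      obtain Z where "Z \<in> C" "x \<in> Z" "y \<in> Z" using XY by (metis subsetD)
      then show "x - y \<in> \<Union>C" using add_subgroup_diff[OF sub_add, of Z x y] by (intro UnionI)
    qed
    moreover have "R \<subseteq> \<Union>C" using sub_R[OF X0] X0 by (meson Union_upper subset_trans)
    moreover have "\<forall>z\<in>\<Union>C. Q z"
      by (intro ballI, elim UnionE) (rule bspec[OF sub_Q])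
    ultimately show "\<Union>C \<in> ?A" by (intro CollectI conjI)
  qed
  then obtain M where M: "M \<in> ?A" and max: "\<And>X. X \<in> ?A \<Longrightarrow> M \<subseteq> X \<Longrightarrow> X = M"
    by (elim bexE) (erule that, rule mp, erule bspec)
  have sub: "add_subgroup M" "R \<subseteq> M" and QM: "\<forall>z\<in>M. Q z" using M by auto
  show thesis
  proof (rule that[OF sub])
    show "Q z" if "z \<in> M" for z using QM that by (rule bspec)
  next
    fix z assume Qz: "\<And>w. w \<in> adjoin z M \<Longrightarrow> Q w"
    have "adjoin z M \<in> ?A"
      using add_subgroup_adjoin[OF sub(1)] subset_trans[OF sub(2) subset_adjoin] Qz
      by (intro CollectI conjI ballI)
    then have "adjoin z M = M" using subset_adjoin by (rule max)
    then show "z \<in> M" using mem_adjoin[OF sub(1), of z] by simp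
  qed
qed

text \<open>
  A partial homomorphism is represented by a subgroup of the product group. The bound \<open>t \<le> p x\<close> on its
  elements already makes it single-valued: over 0 it yields both \<open>t \<le> 0\<close> and \<open>- t \<le> 0\<close>.
\<close>

lemma group_Hahn_Banach:
  fixes p :: "'a::ab_group_add \<Rightarrow> real"
  assumes H: "add_subgroup H" and f: "f \<in> H"
    and add: "\<And>x y. x \<in> H \<Longrightarrow> y \<in> H \<Longrightarrow> p (x + y) \<le> p x + p y"
    and hom: "\<And>n x. x \<in> H \<Longrightarrow> p (nmul n x) = real n * p x"
  obtains L where "\<And>x y. x \<in> H \<Longrightarrow> y \<in> H \<Longrightarrow> L (x + y) = L x + L y"
    "\<And>x. x \<in> H \<Longrightarrow> L x \<le> p x" "L f = p f"
proof -
  let ?Q = "\<lambda>(x, t). x \<in> H \<and> t \<le> p x"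
  have p0: "p 0 = 0" using hom[OF f, of 0] by simp
  have neg: "- p x \<le> p (- x)" if "x \<in> H" for x
    using add[OF that add_subgroup_uminus[OF H that]] p0 by simp
  \<comment> \<open>The graph of n f \<mapsto> n p(f) on the cyclic group of \<open>f\<close>;
    starting from it forces \<open>L f = p f\<close>. Negative multiples are covered by
    \<open>neg\<close>.\<close>
  let ?R = "adjoin (f, p f) {(0, 0)}"
  have R: "add_subgroup ?R"
    by (rule add_subgroup_adjoin) (simp add: add_subgroup_def zero_prod_def)
  have QR: "?Q z" if "z \<in> ?R" for z
    using that
  proof (cases rule: adjoin_cases)
    case (1 m n)
    then show ?thesis
      using f H by (auto simp: nmul_Pair hom nmul_real add_subgroup_nmul)
  next
    case (2 m n)
    have "- (real n * p f) \<le> p (- nmul n f)"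
      using neg[OF add_subgroup_nmul[OF H f], of n] hom[OF f, of n] by simp
    then show ?thesis
      using 2 f H by (auto simp: nmul_Pair nmul_real add_subgroup_nmul add_subgroup_uminus)
  qed
  obtain M where M: "add_subgroup M" "?R \<subseteq> M" "\<And>z. z \<in> M \<Longrightarrow> ?Q z"
    and max: "\<And>z. (\<And>w. w \<in> adjoin z M \<Longrightarrow> ?Q w) \<Longrightarrow> z \<in> M"
    using maximal_add_subgroup[of ?R ?Q, OF R QR] by blast
  have total: "\<exists>t. (x, t) \<in> M" if x: "x \<in> H" for x
  proof -
    \<comment> \<open>A value t at \<open>x\<close> has to satisfy s - n t \<le> p(a - n x) and u +
      m t \<le> p(b + m x) for all (a, s) and (b, u) in \<open>M\<close>. The first kind bounds t
      from below by the elements of \<open>Lo\<close>, the second from above, and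
      \<open>lohi\<close> shows that the bounds are compatible.\<close>
    define Lo where "Lo = {(s - p (a - nmul n x)) / real n | s a n. (a, s) \<in> M \<and> n \<ge> 1}"
    have lohi: "(s - p (a - nmul n x)) / real n \<le> (p (b + nmul m x) - u) / real m"
      if "(a, s) \<in> M" "n \<ge> 1" "(b, u) \<in> M" "m \<ge> 1" for s a n b u m
    proof -
      have aH: "a \<in> H" "b \<in> H" using M(3) that by auto
      have "(nmul m a + nmul n b, real m * s + real n * u) \<in> M"
        using add_subgroup_add[OF M(1) add_subgroup_nmul[OF M(1) that(1), of m]
            add_subgroup_nmul[OF M(1) that(3), of n]]
        by (simp add: nmul_Pair nmul_real)
      then have "real m * s + real n * u \<le> p (nmul m a + nmul n b)" using M(3) by fastforce
      \<comment> \<open>Scaling one constraint by m and the other by n makes the multiples of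
        \<open>x\<close> cancel.\<close>
      also have "nmul m a + nmul n b = nmul m (a - nmul n x) + nmul n (b + nmul m x)"
        by (simp add: nmul_diff nmul_add_right mult.commute flip: nmul_mult)
      also have "p \<dots> \<le> p (nmul m (a - nmul n x)) + p (nmul n (b + nmul m x))"
        by (intro add add_subgroup_nmul add_subgroup_diff add_subgroup_add H aH x)
      also have "\<dots> = real m * p (a - nmul n x) + real n * p (b + nmul m x)"
        using aH x by (simp add: hom H add_subgroup_nmul add_subgroup_diff add_subgroup_add)
      finally show ?thesis using that by (simp add: field_simps)
    qed
    have zM: "(0, 0) \<in> M" using add_subgroup_zero[OF M(1)] by (simp add: zero_prod_def)
    have ne: "Lo \<noteq> {}" unfolding Lo_def using zM by blast
    define t where "t = Sup Lo"
    have bdd: "bdd_above Lo"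
      by (rule bdd_aboveI[of _ "(p (0 + nmul 1 x) - 0) / real 1"])
        (use lohi[OF _ _ zM, of _ _ _ 1] in \<open>auto simp: Lo_def\<close>)
    have lo: "(s - p (a - nmul n x)) / real n \<le> t" if "(a, s) \<in> M" "n \<ge> 1" for s a n
      unfolding t_def by (rule cSup_upper[OF _ bdd]) (use that in \<open>auto simp: Lo_def\<close>)
    have hi: "t \<le> (p (b + nmul m x) - u) / real m" if "(b, u) \<in> M" "m \<ge> 1" for b u m
      unfolding t_def by (rule cSup_least[OF ne]) (use lohi[OF _ _ that] in \<open>auto simp: Lo_def\<close>)
    have "(x, t) \<in> M"
    proof (rule max)
      fix w assume "w \<in> adjoin (x, t) M"
      then show "?Q w"
      proof (cases rule: adjoin_cases)
        case (1 m n)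
        obtain b u where m: "m = (b, u)" by fastforce
        show ?thesis
        proof (cases "n = 0")
          case True
          then have "w = m" using 1 by simp
          then show ?thesis using 1 M(3)[of m] by blast
        next
          case False
          then have "t \<le> (p (b + nmul n x) - u) / real n" using hi 1 m by auto
          then have "u + real n * t \<le> p (b + nmul n x)" using False by (simp add: field_simps)
          moreover have "b \<in> H" using M(3) 1 m by auto
          ultimately show ?thesis using 1 m x H
            by (auto simp: nmul_Pair nmul_real add_subgroup_nmul add_subgroup_add)
        qed
      next
        case (2 m n)
        obtain b u where m: "m = (b, u)" by fastforce
        show ?thesis
        proof (cases "n = 0")
          case True
          then have "w = m" using 2 by simp
          then show ?thesis using 2 M(3)[of m] by blast
        next
          case False
          then have "(u - p (b - nmul n x)) / real n \<le> t" using lo 2 m by auto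
          then have "u - real n * t \<le> p (b - nmul n x)" using False by (simp add: field_simps)
          moreover have "b \<in> H" using M(3) 2 m by auto
          ultimately show ?thesis using 2 m x H
            by (auto simp: nmul_Pair nmul_real add_subgroup_nmul add_subgroup_diff)
        qed
      qed
    qed
    then show ?thesis by blast
  qed
  have single: "t = u" if "(x, t) \<in> M" "(x, u) \<in> M" for x t u
  proof -
    have "t - u \<le> p 0" "u - t \<le> p 0"
      using M(3) add_subgroup_diff[OF M(1) that] add_subgroup_diff[OF M(1) that(2,1)] by fastforce+
    then show ?thesis using p0 by simp
  qed
  define L where "L x = (THE t. (x, t) \<in> M)" for x
  have L: "(x, t) \<in> M \<Longrightarrow> L x = t" for x t
    unfolding L_def using single by blast
  have LM: "x \<in> H \<Longrightarrow> (x, L x) \<in> M" for x using total L by metis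
  show thesis
  proof (rule that[of L])
    fix x y assume "x \<in> H" "y \<in> H"
    then show "L (x + y) = L x + L y"
      using add_subgroup_add[OF M(1) LM LM] by (auto intro!: L)
  next
    fix x assume "x \<in> H" then show "L x \<le> p x" using M(3)[OF LM] by auto
  next
    have "(f, p f) \<in> ?R" by (rule mem_adjoin) (simp add: add_subgroup_def zero_prod_def)
    then show "L f = p f" using M(2) by (intro L) blast
  qed
qed

text \<open>The case \<open>q = 0\<close> occurs when no positive multiple of \<open>x\<close> lies in \<open>D\<close>.\<close>

lemma order_mod_subgroup:
  assumes D: "add_subgroup D"
  shows "\<exists>q. \<forall>k. nmul k x \<in> D \<longleftrightarrow> q dvd k"
proof (cases "\<exists>n. n \<ge> 1 \<and> nmul n x \<in> D")
  case True
  define q where "q = (LEAST n. n \<ge> 1 \<and> nmul n x \<in> D)"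
  have q: "q \<ge> 1" "nmul q x \<in> D"
    using LeastI_ex[OF True] unfolding q_def by auto
  have least: "q \<le> k" if "k \<ge> 1" "nmul k x \<in> D" for k
    unfolding q_def using that by (simp add: Least_le)
  have qD: "nmul (j * q) x \<in> D" for j
    using add_subgroup_nmul[OF D q(2)] by (simp add: nmul_mult)
  have "nmul k x \<in> D \<longleftrightarrow> q dvd k" for k
  proof
    assume "nmul k x \<in> D"
    then have "nmul k x - nmul (k div q * q) x \<in> D" using qD by (rule add_subgroup_diff[OF D])
    moreover have "nmul k x - nmul (k div q * q) x = nmul (k mod q) x"
      using nmul_add_left[of "k div q * q" "k mod q" x] by (simp add: algebra_simps)
    ultimately have "nmul (k mod q) x \<in> D" by simp
    then have "\<not> k mod q \<ge> 1"
      using least[of "k mod q"] mod_less_divisor[of q k] q(1) by linarith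
    then show "q dvd k" by (simp add: dvd_eq_mod_eq_0)
  next
    assume "q dvd k"
    then obtain j where "k = j * q" by (metis dvdE mult.commute)
    then show "nmul k x \<in> D" using qD by simp
  qed
  then show ?thesis by blast
next
  case False
  then have "nmul k x \<in> D \<longleftrightarrow> 0 dvd k" for k
    using add_subgroup_zero[OF D] by (cases k) (auto simp del: nmul.simps(2))
  then show ?thesis by blast
qed

text \<open>
  \<open>M\<close> is a homomorphism with values in \<open>W\<close> modulo \<open>Z\<close>. Working with relations avoids forming the quotient;
  homomorphisms into the circle arise for \<open>W = \<real>\<close> and \<open>Z = \<int>\<close>.
\<close>

lemma extend_to_divisible:
  fixes R :: "('a::ab_group_add \<times> 'b::ab_group_add) set"
  assumes R: "add_subgroup R" and RW: "\<And>x s. (x, s) \<in> R \<Longrightarrow> s \<in> W"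
    and RZ: "\<And>s. (0, s) \<in> R \<Longrightarrow> s \<in> Z"
    and W: "add_subgroup W" and div: "\<And>s n. s \<in> W \<Longrightarrow> n \<ge> 1 \<Longrightarrow> \<exists>t\<in>W. nmul n t = s"
  obtains M where "add_subgroup M" "R \<subseteq> M" "\<And>x s. (x, s) \<in> M \<Longrightarrow> s \<in> W"
    "\<And>s. (0, s) \<in> M \<Longrightarrow> s \<in> Z" "\<And>x. \<exists>s. (x, s) \<in> M"
proof -
  let ?Q = "\<lambda>(x, s). s \<in> W \<and> (x = 0 \<longrightarrow> s \<in> Z)"
  have QR: "?Q z" if "z \<in> R" for z using that RW RZ by (cases z) auto
  obtain M where M: "add_subgroup M" "R \<subseteq> M" "\<And>z. z \<in> M \<Longrightarrow> ?Q z"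
    and max: "\<And>z. (\<And>w. w \<in> adjoin z M \<Longrightarrow> ?Q w) \<Longrightarrow> z \<in> M"
    using maximal_add_subgroup[of R ?Q, OF R QR] by blast
  define D where "D = fst ` M"
  have D: "add_subgroup D"
    using M(1) unfolding add_subgroup_def D_def
    by (auto simp: image_iff) (metis fst_zero, metis fst_conv fst_diff)
  have "\<exists>s. (x, s) \<in> M" for x
  proof -
    obtain q where q: "\<forall>k. nmul k x \<in> D \<longleftrightarrow> q dvd k"
      using order_mod_subgroup[OF D, of x] by (elim exE)
    \<comment> \<open>A q-th part of the value already prescribed at q x; for q = 0 nothing is
      prescribed and 0 serves.\<close>
    have "\<exists>s\<in>W. (nmul q x, nmul q s) \<in> M"
    proof (cases "q = 0")
      case True
      have "(0, 0) \<in> M" using add_subgroup_zero[OF M(1)] by (simp only: zero_prod_def)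
      then show ?thesis
        using True by (intro bexI[of _ 0] add_subgroup_zero[OF W]) simp
    next
      case False
      obtain t where t: "(nmul q x, t) \<in> M" using spec[OF q, of q] unfolding D_def by force
      obtain s where "s \<in> W" "nmul q s = t" using div[of t q] M(3)[OF t] False by auto
      then show ?thesis using t by (intro bexI[of _ s]) simp_all
    qed
    then obtain s where s: "s \<in> W" "(nmul q x, nmul q s) \<in> M" by (elim bexE)
    \<comment> \<open>Multiples of \<open>x\<close> in the domain of \<open>M\<close> already carry
      the value that (x, s) would give them, so adjoining this pair creates no new values over
      0.\<close>
    have dvd: "(nmul k x, nmul k s) \<in> M" if "nmul k x \<in> D" for k
    proof -
      have "q dvd k" using that q by simp
      then obtain j where "k = j * q" by (metis dvdE mult.commute)
      then show ?thesis
        using add_subgroup_nmul[OF M(1) s(2), of j] by (simp add: nmul_Pair nmul_mult)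
    qed
    have "(x, s) \<in> M"
    proof (rule max)
      fix w assume w: "w \<in> adjoin (x, s) M"
      show "?Q w"
        using w
      proof (cases rule: adjoin_cases)
        case (1 m k)
        obtain b u where m: "m = (b, u)" by fastforce
        have "u + nmul k s \<in> W"
          using 1 m M(3) W s(1) by (fastforce intro: add_subgroup_add add_subgroup_nmul)
        moreover have "u + nmul k s \<in> Z" if "b + nmul k x = 0"
        proof -
          have "nmul k x = - b" using that by (metis add_eq_0_iff)
          then have "nmul k x \<in> D" using add_subgroup_uminus[OF D] 1 m
            by (force simp: D_def)
          from add_subgroup_add[OF M(1) 1(1) dvd[OF this]] show ?thesis
            using M(3) that m by fastforce
        qed
        ultimately show ?thesis using 1 m by (auto simp: nmul_Pair)
      next
        case (2 m k)
        obtain b u where m: "m = (b, u)" by fastforce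
        have "u - nmul k s \<in> W"
          using 2 m M(3) W s(1) by (fastforce intro: add_subgroup_diff add_subgroup_nmul)
        moreover have "u - nmul k s \<in> Z" if "b - nmul k x = 0"
        proof -
          have "nmul k x \<in> D" using 2 m that by (force simp: D_def)
          from add_subgroup_diff[OF M(1) 2(1) dvd[OF this]] show ?thesis
            using M(3) that m by fastforce
        qed
        ultimately show ?thesis using 2 m by (auto simp: nmul_Pair)
      qed
    qed
    then show ?thesis by blast
  qed
  then show thesis
    using that[OF M(1,2)] M(3) by fastforce
qed

section \<open>Small characters on non-compact groups\<close>

lemma open_diff_vimage:
  fixes x :: "'a::topological_ab_group_add"
  assumes "open U"
  shows "open {y. y - x \<in> U}" "open {y. x - y \<in> U}"
proof -
  have "continuous_on UNIV (\<lambda>y. y - x)" "continuous_on UNIV (\<lambda>y. x - y)"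
    by (intro continuous_intros)+
  from this[THEN open_vimage[OF assms]] show "open {y. y - x \<in> U}" "open {y. x - y \<in> U}"
    by (simp_all add: vimage_def)
qed

section \<open>Word length and its growth rate in a compactly generated open subgroup\<close>

primrec msum :: "'a::comm_monoid_add set \<Rightarrow> nat \<Rightarrow> 'a set" where
  "msum V 0 = {0}"
| "msum V (Suc n) = (\<lambda>(v, x). v + x) ` (V \<times> msum V n)"

lemma msum_SucI: "v \<in> V \<Longrightarrow> x \<in> msum V n \<Longrightarrow> v + x \<in> msum V (Suc n)"
  by force

lemma msum_SucE:
  assumes "x \<in> msum V (Suc n)"
  obtains v y where "v \<in> V" "y \<in> msum V n" "x = v + y"
  using assms by auto

lemma msum_add: "x \<in> msum V m \<Longrightarrow> y \<in> msum V n \<Longrightarrow> x + y \<in> msum V (m + n)"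
proof (induction m arbitrary: x)
  case (Suc m)
  obtain v z where "v \<in> V" "z \<in> msum V m" "x = v + z" using Suc.prems(1) by (rule msum_SucE)
  then show ?case using msum_SucI[of v V "z + y" "m + n"] Suc.IH[of z] Suc.prems(2)
    by (simp add: add.assoc del: msum.simps(2))
qed simp

lemma msum_uminus:
  fixes V :: "'a::ab_group_add set"
  assumes "\<And>v. v \<in> V \<Longrightarrow> - v \<in> V"
  shows "x \<in> msum V n \<Longrightarrow> - x \<in> msum V n"
proof (induction n arbitrary: x)
  case (Suc n)
  obtain v z where *: "v \<in> V" "z \<in> msum V n" "x = v + z" using Suc.prems by (rule msum_SucE)
  then show ?case using msum_SucI[of "-v" V "- z" n] assms Suc.IH by (simp del: msum.simps(2))
qed simp

lemma msum_mono:
  assumes "0 \<in> V" "m \<le> n"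
  shows "msum V m \<subseteq> msum V n"
  using assms(2)
proof (induction n rule: dec_induct)
  case (step n)
  have "msum V n \<subseteq> msum V (Suc n)" using msum_SucI[OF assms(1), of _ n] by (auto simp del: msum.simps)
  then show ?case using step.IH by (rule subset_trans[rotated])
qed simp

lemma compact_msum:
  fixes V :: "'a::topological_ab_group_add set"
  assumes "compact V"
  shows "compact (msum V n)"
proof (induction n)
  case (Suc n)
  then show ?case
    unfolding msum.simps case_prod_unfold
    by (intro compact_continuous_image compact_Times assms continuous_intros)
qed simp

text \<open>In general only the generated submonoid; it is a subgroup when \<open>V\<close> is
  symmetric, as in the locale below.\<close>

definition hull_grp :: "'a::comm_monoid_add set \<Rightarrow> 'a set" where
  "hull_grp V = (\<Union>n. msum V n)"

lemma hull_grpI: "x \<in> msum V n \<Longrightarrow> x \<in> hull_grp V"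
  by (auto simp: hull_grp_def)

lemma msum_one: "v \<in> V \<Longrightarrow> v \<in> msum V 1"
  using msum_SucI[of v V 0 0] by (simp del: msum.simps(2))

lemma hull_grp_superset: "V \<subseteq> hull_grp V"
  using msum_one hull_grpI by blast

locale sym_nbhd =
  fixes V :: "'a::{topological_ab_group_add, t2_space} set"
  assumes cpt: "compact V" and sym: "\<And>v. v \<in> V \<Longrightarrow> - v \<in> V" and nbhd: "0 \<in> interior V"
begin

abbreviation "H \<equiv> hull_grp V"

lemma zero_mem: "0 \<in> V"
  using nbhd interior_subset by blast

lemma subgroup_H: "add_subgroup H"
  unfolding add_subgroup_def
proof (intro conjI ballI)
  show "0 \<in> H" using hull_grpI[of 0 V 0] by simp
next
  fix x y assume "x \<in> H" "y \<in> H"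
  then obtain m n where "x \<in> msum V m" "y \<in> msum V n" by (auto simp: hull_grp_def)
  then have "x + - y \<in> msum V (m + n)" by (intro msum_add msum_uminus sym)
  then show "x - y \<in> H" using hull_grpI[of "x + - y"] by simp
qed

lemma open_H: "open H"
proof (subst open_subopen, intro ballI)
  fix x assume x: "x \<in> H"
  show "\<exists>T. open T \<and> x \<in> T \<and> T \<subseteq> H"
  proof (intro exI conjI)
    show "open {y. y - x \<in> interior V}" by (intro open_diff_vimage open_interior)
    show "x \<in> {y. y - x \<in> interior V}" using nbhd by simp
    show "{y. y - x \<in> interior V} \<subseteq> H"
    proof
      fix y assume "y \<in> {y. y - x \<in> interior V}"
      then have "y - x \<in> H" using interior_subset hull_grp_superset by blast
      from add_subgroup_add[OF subgroup_H this x] show "y \<in> H" by simp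
    qed
  qed
qed

definition wlen :: "'a \<Rightarrow> nat" where
  "wlen x = (LEAST n. x \<in> msum V n)"

lemma wlen_mem: "x \<in> H \<Longrightarrow> x \<in> msum V (wlen x)"
  unfolding wlen_def hull_grp_def by (rule LeastI_ex) auto

lemma wlen_le: "x \<in> msum V n \<Longrightarrow> wlen x \<le> n"
  unfolding wlen_def by (rule Least_le)

lemma wlen_add: "x \<in> H \<Longrightarrow> y \<in> H \<Longrightarrow> wlen (x + y) \<le> wlen x + wlen y"
  by (intro wlen_le msum_add wlen_mem)

lemma wlen_zero: "wlen 0 = 0"
  using wlen_le[of 0 0] by simp

lemma wlen_nmul: "x \<in> H \<Longrightarrow> wlen (nmul n x) \<le> n * wlen x"
proof (induction n)
  case (Suc n)
  then show ?case using wlen_add[of x "nmul n x"] add_subgroup_nmul[OF subgroup_H, of x n] by simp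
qed (simp add: wlen_zero)

lemma wlen_sum:
  "finite A \<Longrightarrow> (\<And>i. i \<in> A \<Longrightarrow> g i \<in> H) \<Longrightarrow> sum g A \<in> H \<and> wlen (sum g A) \<le> (\<Sum>i\<in>A. wlen (g i))"
proof (induction A rule: finite_induct)
  case empty
  then show ?case by (simp add: wlen_zero add_subgroup_zero[OF subgroup_H])
next
  case (insert i A)
  then have IH: "sum g A \<in> H" "wlen (sum g A) \<le> (\<Sum>i\<in>A. wlen (g i))" and gi: "g i \<in> H" by auto
  then show ?case
    using insert(1,2) wlen_add[OF gi IH(1)] add_subgroup_add[OF subgroup_H gi IH(1)] by simp
qed

text \<open>The stable word length; by subadditivity the infimum is also the limit of the quotients.
  Unlike \<open>wlen\<close> it is homogeneous, and it remains at most 1 on \<open>V\<close>, so it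
  can serve as the majorant in \<open>group_Hahn_Banach\<close>.\<close>

definition rate :: "'a \<Rightarrow> real" where
  "rate x = (INF n\<in>{1..}. real (wlen (nmul n x)) / real n)"

lemma bdd_rate: "bdd_below ((\<lambda>n. real (wlen (nmul n x)) / real n) ` {1..})"
  by (rule bdd_belowI[of _ 0]) auto

lemma rate_le: "n \<ge> 1 \<Longrightarrow> rate x \<le> real (wlen (nmul n x)) / real n"
  unfolding rate_def by (rule cINF_lower[OF bdd_rate]) simp

lemma rate_greatest: "(\<And>n. n \<ge> 1 \<Longrightarrow> c \<le> real (wlen (nmul n x)) / real n) \<Longrightarrow> c \<le> rate x"
  unfolding rate_def by (rule cINF_greatest) auto

text \<open>By commutativity nm(x + y) = m(n x) + n(m y), so a good n for \<open>x\<close> and a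
  good m for \<open>y\<close> can be used together through the multiple nm.\<close>

lemma rate_add:
  assumes x: "x \<in> H" and y: "y \<in> H"
  shows "rate (x + y) \<le> rate x + rate y"
proof -
  have *: "rate (x + y) \<le> real (wlen (nmul n x)) / n + real (wlen (nmul m y)) / m"
    if "n \<ge> 1" "m \<ge> 1" for n m
  proof -
    have nx: "nmul n x \<in> H" "nmul m y \<in> H" using x y by (auto intro: add_subgroup_nmul subgroup_H)
    have "wlen (nmul (n * m) (x + y)) = wlen (nmul m (nmul n x) + nmul n (nmul m y))"
      by (simp add: nmul_add_right mult.commute flip: nmul_mult)
    also have "\<dots> \<le> m * wlen (nmul n x) + n * wlen (nmul m y)"
      using wlen_add[OF add_subgroup_nmul[OF subgroup_H nx(1), of m] add_subgroup_nmul[OF subgroup_H nx(2), of n]]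
        wlen_nmul[OF nx(1), of m] wlen_nmul[OF nx(2), of n] by linarith
    finally have "real (wlen (nmul (n * m) (x + y))) \<le> real m * real (wlen (nmul n x)) + real n * real (wlen (nmul m y))"
      by (metis of_nat_add of_nat_le_iff of_nat_mult)
    then have "real (wlen (nmul (n * m) (x + y))) / real (n * m) \<le> real (wlen (nmul n x)) / n + real (wlen (nmul m y)) / m"
      using that by (simp add: field_simps)
    moreover have "n * m \<ge> 1" using that by simp
    ultimately show ?thesis using rate_le[of "n * m" "x + y"] by linarith
  qed
  have "rate (x + y) - real (wlen (nmul n x)) / n \<le> rate y" if n: "n \<ge> 1" for n
    by (rule rate_greatest) (use *[OF n] in \<open>simp add: algebra_simps\<close>)
  then have "rate (x + y) - rate y \<le> rate x"
    by (intro rate_greatest) (simp add: diff_le_eq add.commute)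
  then show ?thesis by simp
qed

lemma rate_nmul:
  assumes x: "x \<in> H"
  shows "rate (nmul k x) = real k * rate x"
proof (cases "k = 0")
  case True
  have "rate 0 \<le> 0" using rate_le[of 1 0] by (simp add: wlen_zero)
  moreover have "0 \<le> rate 0" by (rule rate_greatest) simp
  ultimately show ?thesis using True by simp
next
  case False
  show ?thesis
  proof (rule antisym)
    have "rate (nmul k x) / k \<le> rate x"
    proof (rule rate_greatest)
      fix n :: nat assume n: "n \<ge> 1"
      have "wlen (nmul n (nmul k x)) \<le> k * wlen (nmul n x)"
        using wlen_nmul[OF add_subgroup_nmul[OF subgroup_H x, of n], of k]
        by (simp add: mult.commute flip: nmul_mult)
      then have "real (wlen (nmul n (nmul k x))) / n \<le> real k * real (wlen (nmul n x)) / n"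
        using n by (metis divide_right_mono of_nat_0_le_iff of_nat_le_iff of_nat_mult)
      then have "rate (nmul k x) \<le> real k * real (wlen (nmul n x)) / n"
        using rate_le[OF n, of "nmul k x"] by linarith
      then show "rate (nmul k x) / k \<le> real (wlen (nmul n x)) / real n"
        using False by (simp add: field_simps)
    qed
    then show "rate (nmul k x) \<le> real k * rate x" using False by (simp add: field_simps)
  next
    show "real k * rate x \<le> rate (nmul k x)"
    proof (rule rate_greatest)
      fix n :: nat assume n: "n \<ge> 1"
      then have "rate x \<le> real (wlen (nmul (n * k) x)) / real (n * k)"
        using False by (intro rate_le) simp
      then show "real k * rate x \<le> real (wlen (nmul n (nmul k x))) / real n"
        using False n by (simp add: field_simps flip: nmul_mult)
    qed
  qed
qed

text \<open>Some n has n x of length below n/2; division of a by n with remainder then gives slope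
  1/2 for all multiples. What counts later is that the slope is below 1.\<close>

lemma wlen_nmul_half:
  assumes x: "x \<in> H" and "rate x \<le> 0"
  shows "\<exists>C. \<forall>a. real (wlen (nmul a x)) \<le> real a / 2 + C"
proof -
  have "rate x < 1/2" using assms(2) by simp
  then obtain n where n: "n \<ge> 1" "real (wlen (nmul n x)) / real n < 1/2"
    using cInf_lessD[of "(\<lambda>n. real (wlen (nmul n x)) / real n) ` {1..}" "1/2"]
    unfolding rate_def by auto
  have "real (wlen (nmul a x)) \<le> real a / 2 + real (n * wlen x)" for a
  proof -
    have "nmul a x = nmul (a div n) (nmul n x) + nmul (a mod n) x"
      using nmul_add_left[of "a div n * n" "a mod n" x] by (simp add: nmul_mult)
    then have "wlen (nmul a x) \<le> (a div n) * wlen (nmul n x) + (a mod n) * wlen x"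
      using wlen_add[OF add_subgroup_nmul[OF subgroup_H add_subgroup_nmul[OF subgroup_H x, of n], of "a div n"]
          add_subgroup_nmul[OF subgroup_H x, of "a mod n"]]
        wlen_nmul[OF add_subgroup_nmul[OF subgroup_H x, of n], of "a div n"] wlen_nmul[OF x, of "a mod n"]
      by simp
    also have "\<dots> \<le> (a div n) * wlen (nmul n x) + n * wlen x"
      using n(1) by (intro add_mono mult_right_mono) (auto intro: less_imp_le)
    finally have "real (wlen (nmul a x)) \<le> real ((a div n) * wlen (nmul n x) + n * wlen x)"
      by (simp only: of_nat_le_iff)
    then have "real (wlen (nmul a x)) \<le> real (a div n) * real (wlen (nmul n x)) + real (n * wlen x)"
      by simp
    also have "real (a div n) * real (wlen (nmul n x)) \<le> real (a div n) * (real n / 2)"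
      using n by (intro mult_left_mono) (auto simp: field_simps)
    also have "real (a div n) * (real n / 2) = real (a div n * n) / 2" by simp
    also have "\<dots> \<le> real a / 2"
      using div_times_less_eq_dividend[of a n] by (intro divide_right_mono) (simp_all only: of_nat_le_iff)
    finally show ?thesis by simp
  qed
  then show ?thesis by blast
qed

text \<open>Compactness of V + V. The centres of the covering translates are taken in V + V itself,
  which keeps \<open>F\<close> inside \<open>H\<close>, where lengths and rates are
  meaningful.\<close>

lemma finite_transversal:
  obtains F where "finite F" "F \<subseteq> H" "\<And>x y. x \<in> V \<Longrightarrow> y \<in> V \<Longrightarrow> \<exists>f\<in>F. x + y - f \<in> V"
proof -
  let ?K = "msum V 2"
  have "?K \<subseteq> (\<Union>f\<in>?K. {y. y - f \<in> interior V})" using nbhd by auto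
  then obtain F where F: "F \<subseteq> ?K" "finite F" "?K \<subseteq> (\<Union>f\<in>F. {y. y - f \<in> interior V})"
    by (rule compactE_image[OF compact_msum[OF cpt] open_diff_vimage(1)[OF open_interior]])
  show thesis
  proof (rule that[OF F(2)])
    show "F \<subseteq> H" using F(1) hull_grpI by blast
    fix x y assume "x \<in> V" "y \<in> V"
    then have "x + (y + 0) \<in> ?K" unfolding numeral_2_eq_2 by (intro msum_SucI) auto
    then obtain f where "f \<in> F" "x + y - f \<in> interior V" using F(3) by auto
    then show "\<exists>f\<in>F. x + y - f \<in> V" using interior_subset by blast
  qed
qed

text \<open>
  Since \<open>V + V \<subseteq> V + F\<close> with \<open>F\<close> finite, an element of length \<open>n + 1\<close> is one of \<open>V\<close> plus \<open>n\<close> summands from \<open>F\<close>.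
  If all rates vanished, this would give a bound \<open>n / 2 + C\<close> for its length, so lengths would be bounded.
\<close>

lemma exists_positive_rate:
  assumes "\<not> compact H"
  shows "\<exists>f\<in>H. rate f > 0"
proof (rule ccontr)
  assume "\<not> ?thesis"
  then have le: "\<And>f. f \<in> H \<Longrightarrow> rate f \<le> 0" by force
  obtain F where F: "finite F" "F \<subseteq> H" "\<And>x y. x \<in> V \<Longrightarrow> y \<in> V \<Longrightarrow> \<exists>f\<in>F. x + y - f \<in> V"
    using finite_transversal by blast
  have "\<forall>f\<in>F. \<exists>C. \<forall>a. real (wlen (nmul a f)) \<le> real a / 2 + C"
    using wlen_nmul_half le F(2) by blast
  then obtain C where C: "\<And>f a. f \<in> F \<Longrightarrow> real (wlen (nmul a f)) \<le> real a / 2 + C f" by metis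
  have rep: "\<exists>v\<in>V. \<exists>a. sum a F = n \<and> x = v + (\<Sum>f\<in>F. nmul (a f) f)" if "x \<in> msum V (Suc n)" for x n
    using that
  proof (induction n arbitrary: x)
    case 0
    then have "x \<in> V" by auto
    then show ?case by (intro bexI[of _ x] exI[of _ "\<lambda>_. 0"]) auto
  next
    case (Suc n)
    obtain w y where wy: "w \<in> V" "y \<in> msum V (Suc n)" "x = w + y"
      using Suc.prems by (rule msum_SucE)
    obtain v a where va: "v \<in> V" "sum a F = n" "y = v + (\<Sum>f\<in>F. nmul (a f) f)"
      using Suc.IH[OF wy(2)] by blast
    obtain g where g: "g \<in> F" "w + v - g \<in> V" using F(3)[OF wy(1) va(1)] by blast
    define b where "b f = a f + (if f = g then 1 else 0)" for f
    have "sum b F = Suc n" using va(2) g(1) F(1) by (simp add: b_def sum.distrib)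
    moreover have "(\<Sum>f\<in>F. nmul (b f) f) = (\<Sum>f\<in>F. nmul (a f) f) + (\<Sum>f\<in>F. if f = g then f else 0)"
      unfolding b_def nmul_add_left sum.distrib by (intro arg_cong2[of _ _ _ _ "(+)"] sum.cong) auto
    moreover have "(\<Sum>f\<in>F. if f = g then f else 0) = g" using F(1) g(1) by simp
    ultimately show ?case
      using g(2) by (intro bexI[of _ "w + v - g"] exI[of _ b]) (auto simp: wy va algebra_simps)
  qed
  \<comment> \<open>For \<open>wlen x = Suc n\<close> the estimate below reads n + 1 \<le> 1 + n/2 +
    sum C F, so the length is at most 1 + 2 * sum C F.\<close>
  define M where "M = nat \<lceil>2 + 2 * sum C F\<rceil> + 1"
  have bound: "wlen x \<le> M" if x: "x \<in> H" for x
  proof (cases "wlen x")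
    case (Suc n)
    obtain v a where va: "v \<in> V" "sum a F = n" "x = v + (\<Sum>f\<in>F. nmul (a f) f)"
      using rep wlen_mem[OF x] unfolding Suc by blast
    have S: "(\<Sum>f\<in>F. nmul (a f) f) \<in> H" "wlen (\<Sum>f\<in>F. nmul (a f) f) \<le> (\<Sum>f\<in>F. wlen (nmul (a f) f))"
      using wlen_sum[OF F(1), of "\<lambda>f. nmul (a f) f"] F(2) add_subgroup_nmul[OF subgroup_H] by blast+
    have v: "v \<in> H" "wlen v \<le> 1"
      using va(1) hull_grp_superset wlen_le[OF msum_one] by blast+
    have "wlen x \<le> 1 + (\<Sum>f\<in>F. wlen (nmul (a f) f))"
      using wlen_add[OF v(1) S(1)] S(2) v(2) unfolding va(3) by linarith
    then have "real (wlen x) \<le> 1 + real (\<Sum>f\<in>F. wlen (nmul (a f) f))" by linarith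
    also have "real (\<Sum>f\<in>F. wlen (nmul (a f) f)) \<le> (\<Sum>f\<in>F. real (a f) / 2 + C f)"
      unfolding of_nat_sum by (intro sum_mono C)
    also have "\<dots> = real n / 2 + sum C F"
      by (simp add: sum.distrib va(2)[symmetric] flip: sum_divide_distrib)
    finally have "real (wlen x) \<le> 2 + 2 * sum C F" using Suc by simp
    then show ?thesis unfolding M_def by linarith
  qed simp
  have "H = msum V M"
  proof
    show "H \<subseteq> msum V M" using bound wlen_mem msum_mono[OF zero_mem] by blast
    show "msum V M \<subseteq> H" by (auto intro: hull_grpI)
  qed
  then show False using compact_msum[OF cpt, of M] assms by simp
qed

text \<open>\<open>rate\<close> is at most 1 on \<open>V\<close>, and symmetry of \<open>V\<close>
  makes the bound two-sided. Boundedness on a neighbourhood of 0 is the form in which continuity of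
  \<open>L\<close> is used.\<close>

lemma real_character:
  assumes "\<not> compact H"
  obtains L f where "\<And>x y. x \<in> H \<Longrightarrow> y \<in> H \<Longrightarrow> L (x + y) = L x + L y"
    "\<And>x. x \<in> V \<Longrightarrow> \<bar>L x\<bar> \<le> (1::real)" "f \<in> H" "L f > 0"
proof -
  obtain f where f: "f \<in> H" "rate f > 0" using exists_positive_rate[OF assms] by blast
  obtain L where L: "\<And>x y. x \<in> H \<Longrightarrow> y \<in> H \<Longrightarrow> L (x + y) = L x + L y"
    "\<And>x. x \<in> H \<Longrightarrow> L x \<le> rate x" "L f = rate f"
    using group_Hahn_Banach[OF subgroup_H f(1), of rate] rate_add rate_nmul by metis
  have LV: "L x \<le> 1" if "x \<in> V" for x
  proof -
    have "wlen x \<le> 1" using that by (intro wlen_le msum_one)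
    then show ?thesis using L(2)[of x] rate_le[of 1 x] that hull_grp_superset by force
  qed
  have "L (- x) = - L x" if "x \<in> H" for x
    using L(1)[OF that add_subgroup_uminus[OF subgroup_H that]]
      L(1)[OF add_subgroup_zero[OF subgroup_H] add_subgroup_zero[OF subgroup_H]] by simp
  then have "\<bar>L x\<bar> \<le> 1" if "x \<in> V" for x
    using LV[OF that] LV[OF sym[OF that]] that hull_grp_superset by fastforce
  then show thesis using that[of L f] L f by simp
qed

end

section \<open>Sequences of circle-valued homomorphisms\<close>

lemma cis_2pi_eq_1_iff: "cis (2 * pi * r) = 1 \<longleftrightarrow> r \<in> \<int>"
proof
  assume "cis (2 * pi * r) = 1"
  then have "cos (2 * pi * r) = 1" by (metis cis.simps(1) one_complex.simps(1))
  then obtain n :: int where "2 * pi * r = of_int n * 2 * pi" using cos_one_2pi_int[of "2 * pi * r"] by auto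
  then have "r = of_int n" by simp
  then show "r \<in> \<int>" by simp
qed simp

lemma norm_cis_2pi_le: "norm (cis (2 * pi * r) - 1) \<le> 2 * pi * \<bar>r\<bar>"
proof -
  have "norm (cis (2 * pi * r) - 1) = 2 * \<bar>sin (pi * r)\<bar>"
    using dist_exp_i_1[of "2 * pi * r"] by (simp add: cis_conv_exp)
  also have "\<dots> \<le> 2 * \<bar>pi * r\<bar>" using abs_sin_x_le_abs_x[of "pi * r"] by simp
  finally show ?thesis by (simp add: abs_mult)
qed

text \<open>\<open>extend_to_divisible\<close> with W the absolutely summable sequences, divisible
  because they can be divided by n, and Z the integer-valued sequences. Two values of the extension
  at one point differ by an element of Z, which \<open>cis (2 * pi * _)\<close> does not
  see.\<close>

lemma characters_from_relation:
  fixes R :: "('a::ab_group_add \<times> (nat \<Rightarrow> real)) set"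
  assumes "add_subgroup R" "\<And>x s. (x, s) \<in> R \<Longrightarrow> summable (\<lambda>n. \<bar>s n\<bar>)"
    "\<And>s n. (0, s) \<in> R \<Longrightarrow> s n \<in> \<int>"
  obtains \<psi> :: "nat \<Rightarrow> 'a \<Rightarrow> complex" where
    "\<And>n x y. \<psi> n (x + y) = \<psi> n x * \<psi> n y" "\<And>n x. norm (\<psi> n x) = 1"
    "\<And>x. summable (\<lambda>n. norm (\<psi> n x - 1))"
    "\<And>x s n. (x, s) \<in> R \<Longrightarrow> \<psi> n x = cis (2 * pi * s n)"
proof -
  let ?W = "{s :: nat \<Rightarrow> real. summable (\<lambda>n. \<bar>s n\<bar>)}"
  let ?Z = "{s :: nat \<Rightarrow> real. \<forall>n. s n \<in> \<int>}"
  have W: "add_subgroup ?W"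
    unfolding add_subgroup_def
  proof (intro conjI ballI)
    fix s t assume "s \<in> ?W" "t \<in> ?W"
    then have "summable (\<lambda>n. \<bar>s n\<bar> + \<bar>t n\<bar>)" by (intro summable_add) auto
    then show "s - t \<in> ?W" by (auto elim!: summable_comparison_test'[where N = 0])
  qed auto
  have div: "\<exists>t\<in>?W. nmul n t = s" if "s \<in> ?W" "n \<ge> 1" for s n
  proof
    show "(\<lambda>i. s i / real n) \<in> ?W" using that summable_divide[of "\<lambda>n. \<bar>s n\<bar>" "real n"] by simp
    show "nmul n (\<lambda>i. s i / real n) = s"
      using that by (intro ext) (simp add: nmul_fun nmul_real)
  qed
  obtain M where M: "add_subgroup M" "R \<subseteq> M" "\<And>x s. (x, s) \<in> M \<Longrightarrow> s \<in> ?W"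
    "\<And>s. (0, s) \<in> M \<Longrightarrow> s \<in> ?Z" "\<And>x. \<exists>s. (x, s) \<in> M"
    by (rule extend_to_divisible[OF assms(1), of ?W ?Z]) (use assms(2,3) W div in auto)
  define \<sigma> where "\<sigma> x = (SOME s. (x, s) \<in> M)" for x
  have \<sigma>: "(x, \<sigma> x) \<in> M" for x using someI_ex[OF M(5)[of x]] by (simp add: \<sigma>_def)
  define \<psi> where "\<psi> n x = cis (2 * pi * \<sigma> x n)" for n x
  have \<psi>: "\<psi> n x = cis (2 * pi * s n)" if "(x, s) \<in> M" for x s n
  proof -
    have "(0, \<sigma> x - s) \<in> M" using add_subgroup_diff[OF M(1) \<sigma>[of x] that] by simp
    from M(4)[OF this] have "\<sigma> x n - s n \<in> \<int>" by simp
    then have "cis (2 * pi * (\<sigma> x n - s n)) * cis (2 * pi * s n) = cis (2 * pi * s n)"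
      by (metis cis_2pi_eq_1_iff mult_1)
    then show ?thesis unfolding \<psi>_def cis_mult by (simp add: algebra_simps)
  qed
  show thesis
  proof (rule that[of \<psi>])
    show "\<psi> n (x + y) = \<psi> n x * \<psi> n y" for n x y
    proof -
      have "(x + y, \<sigma> x + \<sigma> y) \<in> M" using add_subgroup_add[OF M(1) \<sigma> \<sigma>, of x y] by simp
      from \<psi>[OF this] show ?thesis by (simp add: \<psi>_def cis_mult distrib_left)
    qed
    show "norm (\<psi> n x) = 1" for n x by (simp add: \<psi>_def)
    show "summable (\<lambda>n. norm (\<psi> n x - 1))" for x
    proof (rule summable_comparison_test'[where N = 0])
      show "summable (\<lambda>n. 2 * pi * \<bar>\<sigma> x n\<bar>)" using M(3)[OF \<sigma>] by (intro summable_mult) auto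
    qed (use norm_cis_2pi_le in \<open>simp add: \<psi>_def\<close>)
    show "\<psi> n x = cis (2 * pi * s n)" if "(x, s) \<in> R" for x s n
      using \<psi> that M(2) by blast
  qed
qed

text \<open>Continuity is contained in \<open>small\<close>. Stating it for the whole sum yields one
  neighbourhood of 0 that serves every \<psi> n and every product of a subfamily.\<close>

locale slow_characters =
  fixes \<psi> :: "nat \<Rightarrow> 'a::topological_ab_group_add \<Rightarrow> complex"
  assumes mult: "\<psi> n (x + y) = \<psi> n x * \<psi> n y" and unit: "norm (\<psi> n x) = 1" and inj: "inj \<psi>"
    and summ: "summable (\<lambda>n. norm (\<psi> n x - 1))"
    and small: "e > 0 \<Longrightarrow> \<exists>U. open U \<and> 0 \<in> U \<and> (\<forall>x\<in>U. (\<Sum>n. norm (\<psi> n x - 1)) < e)"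

context sym_nbhd
begin

lemma slow_characters_from_real:
  assumes "\<not> compact H"
  shows "\<exists>\<psi> :: nat \<Rightarrow> 'a \<Rightarrow> complex. slow_characters \<psi>"
proof -
  obtain L f where L: "\<And>x y. x \<in> H \<Longrightarrow> y \<in> H \<Longrightarrow> L (x + y) = L x + L y"
    "\<And>x. x \<in> V \<Longrightarrow> \<bar>L x\<bar> \<le> (1::real)" "f \<in> H" "L f > 0"
    using real_character[OF assms] by metis
  \<comment> \<open>The factor 1 / (2 L f) gives \<psi> n f the angle pi / 2^n. These angles are
    distinct and lie in the interval from 0 to pi, where cosine is injective, so the \<psi> n are
    distinct.\<close>
  define s where "s x = (\<lambda>n. L x / (2 * L f) * (1/2) ^ n)" for x
  have sums: "(\<lambda>n. \<bar>s x n\<bar>) sums (\<bar>L x\<bar> / L f)" for x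
    using sums_mult[OF geometric_sums[of "1/2::real"], of "\<bar>L x\<bar> / (2 * L f)"] L(4)
    by (simp add: s_def abs_mult)
  have L0: "L 0 = 0"
    using L(1)[OF add_subgroup_zero[OF subgroup_H] add_subgroup_zero[OF subgroup_H]] by simp
  have Ldiff: "L (x - y) = L x - L y" if "x \<in> H" "y \<in> H" for x y
    using L(1)[OF add_subgroup_diff[OF subgroup_H that] that(2)] by simp
  have Lnmul: "L (nmul n x) = real n * L x" if "x \<in> H" for n x
    using that by (induction n) (auto simp: L0 L(1) add_subgroup_nmul[OF subgroup_H] algebra_simps)
  let ?R = "{(x, s x) | x. x \<in> H}"
  have R: "add_subgroup ?R"
    unfolding add_subgroup_def
  proof (intro conjI ballI)
    show "0 \<in> ?R"
      using add_subgroup_zero[OF subgroup_H] L0 by (auto simp: s_def zero_prod_def fun_eq_iff)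
    fix p q assume "p \<in> ?R" "q \<in> ?R"
    then obtain x y where *: "x \<in> H" "y \<in> H" "p = (x, s x)" "q = (y, s y)" by blast
    then have "s x - s y = s (x - y)"
      by (simp add: s_def fun_eq_iff Ldiff diff_divide_distrib left_diff_distrib)
    then show "p - q \<in> ?R" using * add_subgroup_diff[OF subgroup_H *(1,2)] by simp
  qed
  obtain \<psi> :: "nat \<Rightarrow> 'a \<Rightarrow> complex" where \<psi>:
    "\<And>n x y. \<psi> n (x + y) = \<psi> n x * \<psi> n y" "\<And>n x. norm (\<psi> n x) = 1"
    "\<And>x. summable (\<lambda>n. norm (\<psi> n x - 1))"
    "\<And>x u n. (x, u) \<in> ?R \<Longrightarrow> \<psi> n x = cis (2 * pi * u n)"
    by (rule characters_from_relation[OF R])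
      (use sums L0 in \<open>auto simp: sums_iff s_def\<close>)
  have \<psi>s: "\<psi> n x = cis (2 * pi * s x n)" if "x \<in> H" for n x
    using \<psi>(4) that by blast
  show ?thesis
  proof (rule exI[of _ \<psi>], standard)
    show "\<psi> n (x + y) = \<psi> n x * \<psi> n y" "norm (\<psi> n x) = 1" "summable (\<lambda>n. norm (\<psi> n x - 1))" for n x y
      by (rule \<psi>)+
  next
    show "inj \<psi>"
    proof (rule injI)
      fix m n assume "\<psi> m = \<psi> n"
      then have "cis (pi * (1/2) ^ m) = cis (pi * (1/2) ^ n)"
        using \<psi>s[OF L(3), of m] \<psi>s[OF L(3), of n] L(4) by (simp add: s_def mult_ac)
      then have "cos (pi * (1/2) ^ m) = cos (pi * (1/2) ^ n)" by (metis cis.simps(1))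
      moreover have "0 \<le> pi * (1/2) ^ k" "pi * (1/2) ^ k \<le> pi" for k
        by (simp_all add: power_le_one)
      ultimately have "pi * (1/2) ^ m = pi * (1/2) ^ n" using cos_inj_pi by blast
      then show "m = n" by (simp add: power_inject_exp')
    qed
  next
    fix e :: real assume e: "e > 0"
    define c where "c = 2 * pi / L f"
    have c: "c > 0" using L(4) by (simp add: c_def)
    obtain m :: nat where m: "m \<ge> 1" "c / e < real m"
      using reals_Archimedean2[of "max 1 (c / e)"] by (metis max_less_iff_conj of_nat_1 of_nat_less_iff less_imp_le)
    \<comment> \<open>If x and m x both lie in \<open>V\<close>, then |L(m x)| \<le> 1 gives |L x|
      \<le> 1/m; this is how smallness near 0 is obtained.\<close>
    let ?U = "interior V \<inter> nmul m -` interior V"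
    have cont: "continuous_on UNIV (nmul k :: 'a \<Rightarrow> 'a)" for k
      by (induction k) (auto intro!: continuous_intros)
    have "open ?U" using cont by (intro open_Int open_vimage open_interior)
    moreover have "0 \<in> ?U" using nbhd by simp
    moreover have "(\<Sum>n. norm (\<psi> n x - 1)) < e" if x: "x \<in> ?U" for x
    proof -
      have xV: "x \<in> V" "nmul m x \<in> V" using x interior_subset by auto
      then have xH: "x \<in> H" using hull_grp_superset by blast
      have "real m * \<bar>L x\<bar> \<le> 1" using L(2)[OF xV(2)] by (simp add: Lnmul[OF xH] abs_mult)
      then have Lx: "\<bar>L x\<bar> \<le> 1 / real m" using m(1) by (simp add: field_simps)
      have "(\<Sum>n. norm (\<psi> n x - 1)) \<le> (\<Sum>n. 2 * pi * \<bar>s x n\<bar>)"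
        using sums[of x] norm_cis_2pi_le \<psi>(3)[of x]
        by (intro suminf_le) (auto simp: \<psi>s[OF xH] sums_iff summable_mult)
      also have "\<dots> = c * \<bar>L x\<bar>"
        using suminf_mult[of "\<lambda>n. \<bar>s x n\<bar>" "2 * pi"] sums[of x] by (simp add: sums_iff c_def)
      also have "\<dots> \<le> c * (1 / real m)" using Lx c by (intro mult_left_mono) auto
      also have "\<dots> < e" using m e c by (simp add: field_simps)
      finally show ?thesis .
    qed
    ultimately show "\<exists>U. open U \<and> 0 \<in> U \<and> (\<forall>x\<in>U. (\<Sum>n. norm (\<psi> n x - 1)) < e)" by blast
  qed
qed

end

lemma (in sym_nbhd) compact_open_subgroup_if:
  "compact H \<Longrightarrow> add_subgroup H \<and> compact H \<and> open H"
  using subgroup_H open_H by blast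

lemma character_separating_subgroup:
  assumes H: "add_subgroup H" and x: "x \<notin> H"
  obtains M :: "('a::ab_group_add \<times> real) set" and r where "add_subgroup M" "\<And>h. h \<in> H \<Longrightarrow> (h, 0) \<in> M"
    "(x, r) \<in> M" "r \<notin> \<int>" "\<And>y. \<exists>s. (y, s) \<in> M" "\<And>s. (0, s) \<in> M \<Longrightarrow> s \<in> \<int>"
proof -
  obtain q where q: "\<forall>k. nmul k x \<in> H \<longleftrightarrow> q dvd k"
    using order_mod_subgroup[OF H, of x] by (elim exE)
  have q1: "q \<noteq> 1" using spec[OF q, of 1] x by auto
  \<comment> \<open>\<open>q\<close> is the order of \<open>x\<close> modulo \<open>H\<close>, so
    1/q is a non-integer whose q-th multiple is an integer. For infinite order (q = 0) the value is
    unconstrained and 1/2 is a non-integer.\<close>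
  define r :: real where "r = (if q = 0 then 1/2 else 1 / real q)"
  have r: "r \<notin> \<int>"
  proof
    assume "r \<in> \<int>"
    then obtain n :: int where n: "r = of_int n" by (elim Ints_cases)
    have "0 < r" "r < 1" using q1 by (auto simp: r_def)
    then show False using n by simp
  qed
  have rk: "real k * r \<in> \<int>" if "nmul k x \<in> H" for k
  proof -
    have "q dvd k" using q that by blast
    then obtain j where "k = q * j" by (rule dvdE)
    then show ?thesis by (simp add: r_def)
  qed
  let ?R = "adjoin (x, r) (H \<times> {0})"
  have H0: "add_subgroup (H \<times> {0::real})"
    using H by (auto simp: add_subgroup_def zero_prod_def)
  have RZ: "s \<in> \<int>" if "(0, s) \<in> ?R" for s
    using that
  proof (cases rule: adjoin_cases)
    case (1 m n)
    then obtain h where h: "h \<in> H" "h + nmul n x = 0" "s = real n * r"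
      by (auto simp: nmul_Pair nmul_real)
    then have "nmul n x = - h" by (metis add_eq_0_iff)
    then show ?thesis using rk add_subgroup_uminus[OF H h(1)] h(3) by simp
  next
    case (2 m n)
    then obtain h where h: "h \<in> H" "h = nmul n x" "s = - (real n * r)"
      by (auto simp: nmul_Pair nmul_real)
    then show ?thesis using rk[of n] by simp
  qed
  have U: "add_subgroup (UNIV :: real set)" by (simp add: add_subgroup_def)
  have div: "\<exists>t\<in>UNIV. nmul n t = s" if "n \<ge> 1" for s :: real and n
    using that by (intro bexI[of _ "s / real n"]) (simp_all add: nmul_real)
  show thesis
  proof (rule extend_to_divisible[OF add_subgroup_adjoin[OF H0, of "(x, r)"] UNIV_I RZ U div])
    fix M assume M: "add_subgroup M" "?R \<subseteq> M" "\<And>s. (0, s) \<in> M \<Longrightarrow> s \<in> \<int>" "\<And>x. \<exists>s. (x, s) \<in> M"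
    show thesis
    proof (rule that[OF M(1) _ _ r M(4,3)])
      show "(h, 0) \<in> M" if "h \<in> H" for h
        using subset_adjoin[of "H \<times> {0}" "(x, r)"] M(2) that by blast
      show "(x, r) \<in> M" using mem_adjoin[OF H0, of "(x, r)"] M(2) by blast
    qed
  qed
qed

text \<open>If the n-th character is trivial on \<open>H n\<close>, then at a point of
  \<open>H m\<close> only the characters with index below m can differ from 1, so summability is
  automatic on the union of the chain. All of them are trivial on the open set
  \<open>H 0\<close>.\<close>

lemma slow_characters_from_chain:
  fixes H :: "nat \<Rightarrow> 'a::topological_ab_group_add set"
  assumes H: "\<And>n. add_subgroup (H n)" and H0: "open (H 0)" and sub: "\<And>n. H n \<subset> H (Suc n)"
  shows "\<exists>\<psi> :: nat \<Rightarrow> 'a \<Rightarrow> complex. slow_characters \<psi>"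
proof -
  have mono: "H m \<subseteq> H n" if "m \<le> n" for m n
    using that by (rule lift_Suc_mono_le[rotated]) (use sub in blast)
  have "\<forall>n. \<exists>x. x \<in> H (Suc n) \<and> x \<notin> H n" using sub by blast
  then obtain x where x: "\<And>n. x n \<in> H (Suc n)" "\<And>n. x n \<notin> H n" by metis
  have "\<forall>n. \<exists>M (r::real). add_subgroup M \<and> (\<forall>h\<in>H n. (h, 0) \<in> M) \<and> (x n, r) \<in> M \<and> r \<notin> \<int> \<and>
      (\<forall>y. \<exists>s. (y, s) \<in> M) \<and> (\<forall>s. (0, s) \<in> M \<longrightarrow> s \<in> \<int>)"
  proof
    fix n
    show "\<exists>M (r::real). add_subgroup M \<and> (\<forall>h\<in>H n. (h, 0) \<in> M) \<and> (x n, r) \<in> M \<and> r \<notin> \<int> \<and>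
      (\<forall>y. \<exists>s. (y, s) \<in> M) \<and> (\<forall>s. (0, s) \<in> M \<longrightarrow> s \<in> \<int>)"
    proof (rule character_separating_subgroup[OF H[of n] x(2)[of n]])
      fix M :: "('a \<times> real) set" and r assume *: "add_subgroup M" "\<And>h. h \<in> H n \<Longrightarrow> (h, 0) \<in> M" "(x n, r) \<in> M"
        "r \<notin> \<int>" "\<And>y. \<exists>s. (y, s) \<in> M" "\<And>s. (0, s) \<in> M \<Longrightarrow> s \<in> \<int>"
      show "\<exists>M (r::real). add_subgroup M \<and> (\<forall>h\<in>H n. (h, 0) \<in> M) \<and> (x n, r) \<in> M \<and> r \<notin> \<int> \<and>
        (\<forall>y. \<exists>s. (y, s) \<in> M) \<and> (\<forall>s. (0, s) \<in> M \<longrightarrow> s \<in> \<int>)"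
        by (rule exI[of _ M], rule exI[of _ r]) (simp add: *)
    qed
  qed
  then obtain M :: "nat \<Rightarrow> ('a \<times> real) set" and r where M: "\<And>n. add_subgroup (M n)"
    "\<And>n h. h \<in> H n \<Longrightarrow> (h, 0) \<in> M n" "\<And>n. (x n, r n) \<in> M n" "\<And>n. r n \<notin> \<int>"
    "\<And>n y. \<exists>s. (y, s) \<in> M n" "\<And>n s. (0, s) \<in> M n \<Longrightarrow> s \<in> \<int>"
    by metis
  \<comment> \<open>Each \<open>M n\<close> is already total, but outside the union of the chain its
    values need not be summable in n. So only the part over the union is kept, with finitely
    supported choices of values, and all coordinates are extended afresh together.\<close>
  let ?R = "{(y, s). y \<in> (\<Union>n. H n) \<and> finite {n. s n \<noteq> 0} \<and> (\<forall>n. (y, s n) \<in> M n)}"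
  have R: "add_subgroup ?R"
    unfolding add_subgroup_def
  proof (intro conjI ballI)
    have "0 \<in> H 0" "(0, 0) \<in> M n" for n
      using add_subgroup_zero[OF H] M(2) by auto
    then show "0 \<in> ?R" by (auto simp: zero_prod_def)
    fix p q assume pq: "p \<in> ?R" "q \<in> ?R"
    obtain y s z t where p: "p = (y, s)" and q: "q = (z, t)" by (metis surj_pair)
    obtain m n where "y \<in> H m" "z \<in> H n" using pq p q by auto
    then have "y \<in> H (max m n)" "z \<in> H (max m n)"
      using mono[of m "max m n"] mono[of n "max m n"] by auto
    then have "y - z \<in> (\<Union>n. H n)" using add_subgroup_diff[OF H] by blast
    moreover have "finite {n. s n - t n \<noteq> 0}"
      by (rule finite_subset[of _ "{n. s n \<noteq> 0} \<union> {n. t n \<noteq> 0}"]) (use pq p q in auto)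
    moreover have "(y - z, s n - t n) \<in> M n" for n
      using add_subgroup_diff[OF M(1)[of n], of "(y, s n)" "(z, t n)"] pq p q by simp
    ultimately show "p - q \<in> ?R" by (simp add: p q)
  qed
  have summ: "summable (\<lambda>n. \<bar>s n\<bar>)" if "(y, s) \<in> ?R" for y s
    using that by (intro summable_finite[of "{n. s n \<noteq> 0}"]) auto
  have RZ: "s n \<in> \<int>" if "(0, s) \<in> ?R" for s n
    by (rule M(6)[of _ n]) (use that in simp)
  obtain \<psi> :: "nat \<Rightarrow> 'a \<Rightarrow> complex" where \<psi>:
    "\<And>n x y. \<psi> n (x + y) = \<psi> n x * \<psi> n y" "\<And>n x. norm (\<psi> n x) = 1"
    "\<And>x. summable (\<lambda>n. norm (\<psi> n x - 1))"
    "\<And>x u n. (x, u) \<in> ?R \<Longrightarrow> \<psi> n x = cis (2 * pi * u n)"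
    by (rule characters_from_relation[OF R]) (erule summ, erule RZ, rule that)
  have \<psi>M: "\<psi> n y = cis (2 * pi * t)" if y: "y \<in> H m" and t: "(y, t) \<in> M n" for n m y t
  proof -
    \<comment> \<open>A finitely supported choice with the prescribed value at index
      \<open>n\<close>: from \<open>m\<close> on 0 is allowed because y lies in \<open>H k\<close>,
      and below \<open>m\<close> any value will do.\<close>
    define s where "s k = (if k = n then t else if k \<ge> m then 0 else (SOME u. (y, u) \<in> M k))" for k
    have "(y, s k) \<in> M k" for k
      using t mono[of m k] y M(2)[of y k] someI_ex[OF M(5)[of y k]] by (auto simp: s_def)
    moreover have "finite {k. s k \<noteq> 0}"
      by (rule finite_subset[of _ "insert n {..<m}"]) (auto simp: s_def split: if_splits)
    ultimately have "\<psi> n y = cis (2 * pi * s n)" using y by (intro \<psi>(4)) auto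
    then show ?thesis by (simp add: s_def)
  qed
  have triv: "\<psi> n y = 1" if "y \<in> H n" for n y
    using \<psi>M[OF that M(2)[OF that]] by simp
  have neq: "\<psi> m \<noteq> \<psi> n" if "m < n" for m n
  proof
    assume eq: "\<psi> m = \<psi> n"
    have "x m \<in> H n" using x(1)[of m] mono[of "Suc m" n] that by auto
    then have "\<psi> m (x m) = 1" using triv eq by simp
    moreover have "\<psi> m (x m) = cis (2 * pi * r m)" by (rule \<psi>M[OF x(1) M(3)])
    ultimately show False using M(4) cis_2pi_eq_1_iff by simp
  qed
  show ?thesis
  proof (rule exI[of _ \<psi>], standard)
    show "\<psi> n (x + y) = \<psi> n x * \<psi> n y" "norm (\<psi> n x) = 1" "summable (\<lambda>n. norm (\<psi> n x - 1))" for n x y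
      by (rule \<psi>)+
  next
    show "inj \<psi>" by (rule injI) (metis neq linorder_neqE_nat)
    fix e :: real assume "e > 0"
    moreover have "\<psi> n y = 1" if "y \<in> H 0" for n y using triv that mono[of 0 n] by blast
    ultimately show "\<exists>U. open U \<and> 0 \<in> U \<and> (\<forall>x\<in>U. (\<Sum>n. norm (\<psi> n x - 1)) < e)"
      using H0 add_subgroup_zero[OF H] by (intro exI[of _ "H 0"]) simp
  qed
qed

text \<open>If every compact symmetric neighbourhood of 0 generates a compact subgroup, then a
  compact open subgroup together with one outside point and its negative generates a larger one.
  Since the group is not compact, an outside point is always available and the chain never
  stops.\<close>

lemma exists_slow_characters:
  assumes lc: "locally_compact_space (euclidean :: 'a::{topological_ab_group_add, t2_space} topology)"
    and nc: "\<not> compact (UNIV :: 'a::{topological_ab_group_add, t2_space} set)"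
  shows "\<exists>\<psi> :: nat \<Rightarrow> 'a::{topological_ab_group_add, t2_space} \<Rightarrow> complex. slow_characters \<psi>"
proof (cases "\<exists>V :: 'a set. sym_nbhd V \<and> \<not> compact (hull_grp V)")
  case True
  then obtain V :: "'a set" where "sym_nbhd V" "\<not> compact (hull_grp V)" by blast
  then show ?thesis by (rule sym_nbhd.slow_characters_from_real)
next
  case False
  then have cpt: "compact (hull_grp V)" if "sym_nbhd V" for V :: "'a set" using that by blast
  let ?P = "\<lambda>H :: 'a set. add_subgroup H \<and> compact H \<and> open H"
  have P: "?P (hull_grp V)" if "sym_nbhd V" for V :: "'a set"
    using sym_nbhd.compact_open_subgroup_if[OF that cpt[OF that]] .
  have "\<exists>U. open U \<and> (\<exists>K. compact K \<and> (0::'a) \<in> U \<and> U \<subseteq> K)"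
    using lc by (simp add: locally_compact_space_def)
  then obtain U K :: "'a set" where UK: "open U" "compact K" "0 \<in> U" "U \<subseteq> K" by blast
  have "sym_nbhd (K \<union> uminus ` K)"
  proof
    show "compact (K \<union> uminus ` K)"
      using UK(2) by (intro compact_Un compact_continuous_image continuous_intros)
    show "- v \<in> K \<union> uminus ` K" if "v \<in> K \<union> uminus ` K" for v using that by auto
    show "0 \<in> interior (K \<union> uminus ` K)" using UK by (intro interiorI[of U]) auto
  qed
  then have start: "\<exists>H. ?P H" using P by blast
  have step: "\<exists>H'. ?P H' \<and> H \<subset> H'" if H: "?P H" for H
  proof -
    obtain x where x: "x \<notin> H" using H nc by (metis UNIV_eq_I)
    let ?V = "H \<union> {x, - x}"
    have V: "sym_nbhd ?V"
    proof
      show "compact ?V" using H by (intro compact_Un) auto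
      show "- v \<in> ?V" if "v \<in> ?V" for v using that H add_subgroup_uminus by auto
      show "0 \<in> interior ?V" using H add_subgroup_zero by (intro interiorI[of H]) auto
    qed
    have "H \<subset> hull_grp ?V" using hull_grp_superset[of ?V] x by blast
    then show ?thesis using P[OF V] by blast
  qed
  have "\<exists>H. \<forall>n. ?P (H n) \<and> H n \<subset> H (Suc n)"
    using dependent_nat_choice[of "\<lambda>_. ?P" "\<lambda>_ H H'. H \<subset> H'"] start step by simp
  then obtain H where "\<forall>n. ?P (H n) \<and> H n \<subset> H (Suc n)" by (elim exE)
  then have "add_subgroup (H n)" "open (H 0)" "H n \<subset> H (Suc n)" for n by simp_all
  then show ?thesis by (rule slow_characters_from_chain)
qed

section \<open>Sequences of characters in the Bohr topology\<close>

lemma bohr_neighbourhood: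
  fixes W :: "'a::topological_ab_group_add set"
  assumes "openin bohr_topology W" "x \<in> W"
  shows "\<exists>\<Phi> d. finite \<Phi> \<and> 0 < d \<and> (\<forall>\<phi>\<in>\<Phi>. continuous_character \<phi>) \<and>
    (\<forall>y. (\<forall>\<phi>\<in>\<Phi>. norm (\<phi> y - \<phi> x) < d) \<longrightarrow> y \<in> W)"
proof -
  have "generate_topology_on {\<phi> -` U | \<phi> U. continuous_character \<phi> \<and> open U} W"
    using assms(1) unfolding bohr_topology_def by (rule openin_topology_generated_by)
  then show ?thesis using assms(2)
  proof (induction rule: generate_topology_on.induct)
    case (Int a b)
    obtain \<Phi> d \<Psi> d' where *: "finite \<Phi>" "0 < d" "\<forall>\<phi>\<in>\<Phi>. continuous_character \<phi>"
      "\<forall>y. (\<forall>\<phi>\<in>\<Phi>. norm (\<phi> y - \<phi> x) < d) \<longrightarrow> y \<in> a"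
      "finite \<Psi>" "0 < d'" "\<forall>\<phi>\<in>\<Psi>. continuous_character \<phi>"
      "\<forall>y. (\<forall>\<phi>\<in>\<Psi>. norm (\<phi> y - \<phi> x) < d') \<longrightarrow> y \<in> b"
      using Int by auto
    show ?case
      by (rule exI[of _ "\<Phi> \<union> \<Psi>"], rule exI[of _ "min d d'"]) (use * in auto)
  next
    case (UN K)
    then obtain k where k: "k \<in> K" "x \<in> k" by auto
    show ?case using UN.IH[OF k] k(1) by (meson UnionI)
  next
    case (Basis s)
    then obtain \<phi> U where \<phi>: "continuous_character \<phi>" "open U" "s = \<phi> -` U" by auto
    then obtain d where "d > 0" "\<And>w. dist w (\<phi> x) < d \<Longrightarrow> w \<in> U"
      using Basis.prems by (auto simp: open_dist)
    then show ?case
      using \<phi> by (intro exI[of _ "{\<phi>}"] exI[of _ d]) (auto simp: dist_norm)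
  qed auto
qed

lemma continuous_character_norm: "continuous_character \<phi> \<Longrightarrow> norm (\<phi> x) = 1"
  unfolding continuous_character_def by (metis dist_0_norm mem_sphere range_subsetD)

lemma continuous_character_mult: "continuous_character \<phi> \<Longrightarrow> \<phi> (x + y) = \<phi> x * \<phi> y"
  by (auto simp: continuous_character_def)

lemma unit_hom_diff:
  fixes \<phi> :: "'a::ab_group_add \<Rightarrow> complex"
  assumes "\<And>x y. \<phi> (x + y) = \<phi> x * \<phi> y" "\<And>x. norm (\<phi> x) = 1"
  shows "norm (\<phi> (x - y) - 1) = norm (\<phi> x - \<phi> y)"
proof -
  have "\<phi> x - \<phi> y = (\<phi> (x - y) - 1) * \<phi> y"
    using assms(1)[of "x - y" y] by (simp add: algebra_simps)
  then show ?thesis by (simp add: norm_mult assms(2))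
qed

lemma unit_hom_zero:
  fixes \<phi> :: "'a::ab_group_add \<Rightarrow> complex"
  assumes "\<And>x y. \<phi> (x + y) = \<phi> x * \<phi> y" "\<And>x. norm (\<phi> x) = 1"
  shows "\<phi> 0 = 1"
  using unit_hom_diff[OF assms, of 0 0] by simp

lemma continuous_characterI:
  fixes \<phi> :: "'a::topological_ab_group_add \<Rightarrow> complex"
  assumes hom: "\<And>x y. \<phi> (x + y) = \<phi> x * \<phi> y" "\<And>x. norm (\<phi> x) = 1"
    and small: "\<And>e. e > 0 \<Longrightarrow> \<exists>U. open U \<and> 0 \<in> U \<and> (\<forall>x\<in>U. norm (\<phi> x - 1) < e)"
  shows "continuous_character \<phi>"
proof -
  have "continuous_on UNIV \<phi>"
    unfolding continuous_on_def
  proof (intro ballI tendstoI)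
    fix x and e :: real assume "e > 0"
    then obtain U where U: "open U" "0 \<in> U" "\<forall>x\<in>U. norm (\<phi> x - 1) < e" using small by blast
    show "\<forall>\<^sub>F y in at x within UNIV. dist (\<phi> y) (\<phi> x) < e"
      unfolding eventually_at_topological
      by (rule exI[of _ "{y. y - x \<in> U}"])
        (use U open_diff_vimage(1)[of U x] unit_hom_diff[OF hom] in \<open>auto simp: dist_norm\<close>)
  qed
  then show ?thesis unfolding continuous_character_def using hom by auto
qed

text \<open>The finitely many functions take values in the unit disc, which balls of radius d/2
  cover finitely. The domain is an arbitrary type because the lemma is applied both to the group and
  to the indices of a sequence.\<close>

lemma finite_cells:
  fixes \<Phi> :: "('x \<Rightarrow> complex) set"
  assumes "finite \<Phi>" "\<forall>\<phi>\<in>\<Phi>. \<forall>x. norm (\<phi> x) \<le> 1" "d > 0"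
  shows "\<exists>\<C>. finite \<C> \<and> \<Union>\<C> = UNIV \<and> (\<forall>c\<in>\<C>. \<forall>x\<in>c. \<forall>y\<in>c. \<forall>\<phi>\<in>\<Phi>. norm (\<phi> x - \<phi> y) < d)"
  using assms(1,2)
proof (induction \<Phi> rule: finite_induct)
  case empty
  show ?case by (rule exI[of _ "{UNIV}"]) simp
next
  case (insert \<phi> \<Phi>)
  then obtain \<C> where \<C>: "finite \<C>" "\<Union>\<C> = UNIV"
    "\<forall>c\<in>\<C>. \<forall>x\<in>c. \<forall>y\<in>c. \<forall>\<phi>\<in>\<Phi>. norm (\<phi> x - \<phi> y) < d" by auto
  obtain k where k: "finite k" "cball (0::complex) 1 \<subseteq> (\<Union>z\<in>k. ball z (d/2))"
    using compact_cball[of "0::complex" 1] assms(3) unfolding compact_eq_totally_bounded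
    by (meson half_gt_zero)
  let ?D = "(\<lambda>(c, z). c \<inter> \<phi> -` ball z (d/2)) ` (\<C> \<times> k)"
  have "finite ?D" using \<C>(1) k(1) by simp
  moreover have "\<Union>?D = UNIV"
  proof -
    have "x \<in> \<Union>?D" for x
    proof -
      obtain c where "c \<in> \<C>" "x \<in> c" using \<C>(2) UNIV_I[of x] by (metis UnionE)
      moreover have "\<phi> x \<in> cball 0 1" using insert.prems by simp
      then obtain z where "z \<in> k" "\<phi> x \<in> ball z (d/2)" using k(2) by blast
      ultimately show ?thesis by (intro UnionI[of "c \<inter> \<phi> -` ball z (d/2)"]) auto
    qed
    then show ?thesis by blast
  qed
  moreover have "norm (\<phi>' x - \<phi>' y) < d"
    if cD: "c \<in> ?D" and xy: "x \<in> c" "y \<in> c" and \<phi>': "\<phi>' \<in> insert \<phi> \<Phi>" for c x y \<phi>'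
  proof -
    obtain b z where c: "c = b \<inter> \<phi> -` ball z (d/2)" "b \<in> \<C>" using cD by auto
    have "dist (\<phi> x) (\<phi> y) < d"
      by (rule dist_triangle_half_r[of z]) (use xy c in auto)
    then show ?thesis using \<C>(3) xy \<phi>' c by (auto simp: dist_norm)
  qed
  ultimately show ?case by (intro exI[of _ ?D]) blast
qed

text \<open>\<rho>(2y) - 1 = (\<rho> y + 1)(\<rho> y - 1), and the first factor has modulus at least
  2 - 1/2. Each doubling thus expands the distance from 1 by 3/2, which cannot go on below the bound
  1/2 unless that distance is 0.\<close>

lemma unit_hom_trivial:
  fixes \<rho> :: "'a::ab_group_add \<Rightarrow> complex"
  assumes hom: "\<And>x y. \<rho> (x + y) = \<rho> x * \<rho> y" and near: "\<And>x. norm (\<rho> x - 1) \<le> 1/2"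
  shows "\<rho> x = 1"
proof (rule ccontr)
  assume ne: "\<rho> x \<noteq> 1"
  have double: "norm (\<rho> (y + y) - 1) \<ge> 3/2 * norm (\<rho> y - 1)" for y
  proof -
    have "norm (\<rho> y + 1) \<ge> 3/2"
      using near[of y] norm_triangle_ineq4[of "\<rho> y + 1" "\<rho> y - 1"] by simp
    then have "3/2 * norm (\<rho> y - 1) \<le> norm (\<rho> y + 1) * norm (\<rho> y - 1)"
      by (intro mult_right_mono) auto
    also have "\<dots> = norm (\<rho> (y + y) - 1)"
      unfolding hom norm_mult[symmetric] by (simp add: algebra_simps)
    finally show ?thesis .
  qed
  have "\<exists>y. norm (\<rho> y - 1) \<ge> (3/2) ^ k * norm (\<rho> x - 1)" for k
  proof (induction k)
    case (Suc k)
    then obtain y where "norm (\<rho> y - 1) \<ge> (3/2) ^ k * norm (\<rho> x - 1)" by blast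
    then have "norm (\<rho> (y + y) - 1) \<ge> (3/2) ^ Suc k * norm (\<rho> x - 1)" using double[of y] by simp
    then show ?case by blast
  qed auto
  then have "(3/2) ^ k * norm (\<rho> x - 1) \<le> 1/2" for k using near order_trans by blast
  then have le: "(3/2) ^ k * norm (\<rho> x - 1) \<le> 1/2" for k .
  obtain k where k: "1 / norm (\<rho> x - 1) < (3/2) ^ k"
    using real_arch_pow[of "3/2"] by auto
  have "1 < (3/2) ^ k * norm (\<rho> x - 1)" using k ne by (simp add: pos_divide_less_eq)
  then show False using le[of k] by linarith
qed

section \<open>Infinite products of subfamilies\<close>

context slow_characters
begin

lemma continuous_psi: "continuous_character (\<psi> n)"
proof (rule continuous_characterI[OF mult unit])
  fix e :: real assume "e > 0"
  then obtain U where U: "open U" "0 \<in> U" "\<forall>x\<in>U. (\<Sum>n. norm (\<psi> n x - 1)) < e" using small by blast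
  have "norm (\<psi> n x - 1) \<le> (\<Sum>n. norm (\<psi> n x - 1))" for x
    using sum_le_suminf[OF summ[of x], of "{n}"] by simp
  then show "\<exists>U. open U \<and> 0 \<in> U \<and> (\<forall>x\<in>U. norm (\<psi> n x - 1) < e)"
    using U by (meson order_le_less_trans)
qed

definition pprod :: "nat set \<Rightarrow> 'a \<Rightarrow> nat \<Rightarrow> complex" where
  "pprod A x N = (\<Prod>n<N. if n \<in> A then \<psi> n x else 1)"

definition subprod :: "nat set \<Rightarrow> 'a \<Rightarrow> complex" where
  "subprod A x = lim (pprod A x)"

lemma norm_pprod: "norm (pprod A x N) = 1"
  by (simp add: pprod_def prod_norm[symmetric] unit if_distrib cong: if_cong)

text \<open>Partial products have modulus 1, so the n-th increment is at most |\<psi> n x - 1|,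
  which is summable.\<close>

lemma pprod_tendsto: "pprod A x \<longlonglongrightarrow> subprod A x"
proof -
  have "norm (pprod A x (Suc n) - pprod A x n) \<le> norm (\<psi> n x - 1)" for n
  proof (cases "n \<in> A")
    case True
    then have "pprod A x (Suc n) - pprod A x n = pprod A x n * (\<psi> n x - 1)"
      by (simp add: pprod_def algebra_simps)
    then show ?thesis by (simp add: norm_mult norm_pprod)
  qed (simp add: pprod_def)
  then have "summable (\<lambda>n. pprod A x (Suc n) - pprod A x n)"
    by (intro summable_comparison_test'[OF summ, where N = 0]) simp
  then have "convergent (\<lambda>N. pprod A x N - pprod A x 0)"
    unfolding summable_iff_convergent by (simp add: sum_lessThan_telescope)
  from convergent_add[OF this convergent_const[of "pprod A x 0"]] have "convergent (pprod A x)" by simp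
  then show ?thesis unfolding subprod_def convergent_LIMSEQ_iff .
qed

lemma subprod_mult: "subprod A (x + y) = subprod A x * subprod A y"
proof -
  have "pprod A (x + y) N = pprod A x N * pprod A y N" for N
    unfolding pprod_def prod.distrib[symmetric] by (intro prod.cong) (auto simp: mult)
  then have "pprod A (x + y) \<longlonglongrightarrow> subprod A x * subprod A y"
    using tendsto_mult[OF pprod_tendsto pprod_tendsto, of A x A y] by presburger
  then show ?thesis using pprod_tendsto LIMSEQ_unique by blast
qed

lemma norm_subprod: "norm (subprod A x) = 1"
  using tendsto_norm[OF pprod_tendsto, of A x] by (simp add: norm_pprod LIMSEQ_const_iff)

lemma norm_pprod_minus_1: "norm (pprod A x N - 1) \<le> (\<Sum>n\<in>{..<N} \<inter> A. norm (\<psi> n x - 1))"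
proof (induction N)
  case (Suc N)
  show ?case
  proof (cases "N \<in> A")
    case True
    have eq: "pprod A x (Suc N) - 1 = (pprod A x N - 1) + pprod A x N * (\<psi> N x - 1)"
      using True by (simp add: pprod_def algebra_simps)
    have "norm (pprod A x (Suc N) - 1) \<le> norm (pprod A x N - 1) + norm (\<psi> N x - 1)"
      unfolding eq using norm_triangle_ineq[of "pprod A x N - 1" "pprod A x N * (\<psi> N x - 1)"]
      by (simp only: norm_mult norm_pprod mult_1)
    then show ?thesis using Suc True by (simp add: lessThan_Suc)
  qed (use Suc in \<open>simp add: pprod_def lessThan_Suc\<close>)
qed (simp add: pprod_def)

lemma norm_subprod_minus_1:
  assumes "\<And>N. (\<Sum>n\<in>{..<N} \<inter> A. norm (\<psi> n x - 1)) \<le> c"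
  shows "norm (subprod A x - 1) \<le> c"
proof (rule LIMSEQ_le_const2)
  show "(\<lambda>N. norm (pprod A x N - 1)) \<longlonglongrightarrow> norm (subprod A x - 1)"
    by (intro tendsto_intros pprod_tendsto)
  show "\<exists>N. \<forall>n\<ge>N. norm (pprod A x n - 1) \<le> c"
    using norm_pprod_minus_1 assms order_trans by blast
qed

lemma continuous_subprod: "continuous_character (subprod A)"
proof (rule continuous_characterI[OF subprod_mult norm_subprod])
  fix e :: real assume "e > 0"
  then obtain U where U: "open U" "0 \<in> U" "\<forall>x\<in>U. (\<Sum>n. norm (\<psi> n x - 1)) < e" using small by blast
  have "norm (subprod A x - 1) \<le> (\<Sum>n. norm (\<psi> n x - 1))" for x
    by (intro norm_subprod_minus_1 sum_le_suminf summ) auto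
  then show "\<exists>U. open U \<and> 0 \<in> U \<and> (\<forall>x\<in>U. norm (subprod A x - 1) < e)"
    using U by (meson order_le_less_trans)
qed

lemma subprod_split:
  assumes "m \<in> A"
  shows "subprod A x = \<psi> m x * subprod (A - {m}) x"
proof -
  have "pprod A x N = \<psi> m x * pprod (A - {m}) x N" if "N > m" for N
  proof -
    have "pprod A x N = \<psi> m x * (\<Prod>n\<in>{..<N} - {m}. if n \<in> A then \<psi> n x else 1)"
      unfolding pprod_def using that assms by (subst prod.remove[of _ m]) auto
    also have "(\<Prod>n\<in>{..<N} - {m}. if n \<in> A then \<psi> n x else 1) = (\<Prod>n\<in>{..<N} - {m}. if n \<in> A - {m} then \<psi> n x else 1)"
      by (intro prod.cong) auto
    also have "\<dots> = pprod (A - {m}) x N"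
      unfolding pprod_def using that by (subst (2) prod.remove[of _ m]) auto
    finally show ?thesis .
  qed
  then have "\<forall>\<^sub>F N in sequentially. \<psi> m x * pprod (A - {m}) x N = pprod A x N"
    unfolding eventually_sequentially by (metis Suc_le_lessD)
  then have "pprod A x \<longlonglongrightarrow> \<psi> m x * subprod (A - {m}) x"
    by (rule Lim_transform_eventually[rotated]) (intro tendsto_intros pprod_tendsto)
  then show ?thesis using pprod_tendsto LIMSEQ_unique by blast
qed

text \<open>Points that the \<psi> n do not separate are not separated by their products either.
  This identifies the two limits found along different subsequences in
  \<open>uniform_on_bohr_compact\<close>.\<close>

lemma subprod_eqI:
  assumes "\<And>n. \<psi> n x = \<psi> n y"
  shows "subprod A x = subprod A y"
  unfolding subprod_def pprod_def by (simp add: assms cong: if_cong)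

end

text \<open>Countably many characters map \<open>K\<close> onto a compact subset of a countable
  product, which is metrizable, so the image is sequentially compact. The limit is then lifted to a
  point of \<open>K\<close>; no convergence in the Bohr topology is claimed.\<close>

lemma bohr_compact_subsequence:
  fixes g :: "nat \<Rightarrow> 'a::topological_ab_group_add \<Rightarrow> complex" and x :: "nat \<Rightarrow> 'a"
  assumes K: "compactin bohr_topology K" and g: "\<And>n. continuous_character (g n)"
    and x: "\<And>j. x j \<in> K"
  shows "\<exists>(r :: nat \<Rightarrow> nat) y. strict_mono r \<and> y \<in> K \<and> (\<forall>n. (\<lambda>j. g n (x (r j))) \<longlonglongrightarrow> g n y)"
proof -
  let ?\<Phi> = "\<lambda>x n. g n x"
  have "continuous_map bohr_topology (product_topology (\<lambda>n::nat. euclidean) UNIV) ?\<Phi>"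
    unfolding continuous_map_componentwise_UNIV
    by (intro allI continuous_map_bohr_topology g)
  then have "continuous_map bohr_topology euclidean ?\<Phi>"
    by (simp add: euclidean_product_topology)
  from image_compactin[OF K this] have "compact (?\<Phi> ` K)" by simp
  then have sc: "seq_compact (?\<Phi> ` K)" by (simp only: compact_eq_seq_compact_metric)
  have "\<forall>j. ?\<Phi> (x j) \<in> ?\<Phi> ` K" using x by blast
  from seq_compactE[OF sc this]
  obtain l r where r: "l \<in> ?\<Phi> ` K" "strict_mono r" "((\<lambda>j. ?\<Phi> (x j)) \<circ> r) \<longlonglongrightarrow> l"
    by blast
  then obtain y where y: "y \<in> K" "l = ?\<Phi> y" by blast
  have "(\<lambda>j. g n (x (r j))) \<longlonglongrightarrow> g n y" for n
    using continuous_on_tendsto_compose[OF continuous_on_product_coordinates[of n] r(3)] y(2)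
    by (simp add: o_def)
  then show ?thesis using r(2) y(1) by blast
qed

context slow_characters
begin

text \<open>
  The hump at \<open>z (k i)\<close> is the factor with index \<open>N (k i)\<close>: earlier factors are close to 1 there because
  \<open>\<psi> n (z j)\<close> tends to 1 in \<open>j\<close>, later ones because \<open>\<psi> n (z j)\<close> is summably close to 1 in \<open>n\<close>.
\<close>

lemma gliding_hump:
  assumes e: "e > 0" and N: "\<And>j. j \<le> N j" and z: "\<And>n. (\<lambda>j. \<psi> n (z j)) \<longlonglongrightarrow> 1"
    and far: "\<And>j. norm (\<psi> (N j) (z j) - 1) \<ge> e"
  shows "\<exists>A (k :: nat \<Rightarrow> nat). strict_mono k \<and> (\<forall>i. norm (subprod A (z (k i)) - 1) \<ge> e / 2)"
proof -
  let ?f = "\<lambda>n j. norm (\<psi> n (z j) - 1)"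
  \<comment> \<open>The factors before and after the hump cost e/4 each, leaving e/2 of a hump of
    size e.\<close>
  let ?\<eta> = "e / 4"
  let ?Rel = "\<lambda>j j'. j < j' \<and> N j < N j' \<and> (\<Sum>n\<le>N j. ?f n j') \<le> ?\<eta> \<and> (\<Sum>n. ?f (n + N j') j) \<le> ?\<eta>"
  have step: "\<exists>j'. ?Rel j j'" for j
  proof -
    have "(\<lambda>j'. \<Sum>n\<le>N j. ?f n j') \<longlonglongrightarrow> (\<Sum>n\<le>N j. norm (1 - 1 :: complex))"
      by (intro tendsto_intros z)
    then have "\<forall>\<^sub>F j' in sequentially. (\<Sum>n\<le>N j. ?f n j') < ?\<eta>"
      by (rule order_tendstoD) (use e in simp)
    then obtain J where J: "\<And>j'. j' \<ge> J \<Longrightarrow> (\<Sum>n\<le>N j. ?f n j') < ?\<eta>"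
      unfolding eventually_sequentially by blast
    obtain M where M: "\<And>n. n \<ge> M \<Longrightarrow> norm (\<Sum>i. ?f (i + n) j) < ?\<eta>"
      using suminf_exist_split[OF _ summ[of "z j"], of ?\<eta>] e by auto
    let ?j = "Suc (j + J + M + N j)"
    have "?j \<ge> J" "N ?j \<ge> M" "N j < N ?j" using N[of ?j] by auto
    then have "?Rel j ?j" using J[of ?j] M[of "N ?j"] by (simp add: less_imp_le)
    then show ?thesis by blast
  qed
  have "\<exists>k. \<forall>i. True \<and> ?Rel (k i) (k (Suc i))"
    using dependent_nat_choice[of "\<lambda>_ _. True" "\<lambda>_. ?Rel"] step by blast
  then obtain k where k: "\<forall>i. ?Rel (k i) (k (Suc i))" by auto
  have km: "strict_mono k" "strict_mono (\<lambda>i. N (k i))"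
    using k by (auto intro!: strict_monoI_Suc)
  have Nle: "N (k i) \<le> N (k l)" if "i \<le> l" for i l
    using strict_mono_less_eq[OF km(2)] that by simp
  define A where "A = range (\<lambda>i. N (k i))"
  have "norm (subprod A (z (k i)) - 1) \<ge> e / 2" for i
  proof -
    let ?m = "N (k i)" and ?M = "N (k (Suc i))"
    \<comment> \<open>For i = 0 there is no earlier hump; truncated subtraction would make
      \<open>k (i - 1)\<close> the hump itself.\<close>
    define Q where "Q = (if i = 0 then {} else {..N (k (i - 1))})"
    have Q: "(\<Sum>n\<in>Q. ?f n (k i)) \<le> ?\<eta>"
      using spec[OF k, of "i - 1"] e by (cases i) (auto simp: Q_def)
    have finQ: "finite Q" by (simp add: Q_def)
    have "norm (subprod (A - {?m}) (z (k i)) - 1) \<le> ?\<eta> + ?\<eta>"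
    proof (rule norm_subprod_minus_1)
      fix T
      \<comment> \<open>Other members of \<open>A\<close> come at or before the previous hump index
        or at or after the next one. The length T only keeps the second block finite while
        containing all indices below T.\<close>
      have "{..<T} \<inter> (A - {?m}) \<subseteq> Q \<union> {?M..<?M + T}"
      proof
        fix n assume n: "n \<in> {..<T} \<inter> (A - {?m})"
        then obtain l where l: "n = N (k l)" "l \<noteq> i" by (auto simp: A_def)
        show "n \<in> Q \<union> {?M..<?M + T}"
        proof (cases "l < i")
          case True
          then have "l \<le> i - 1" "i \<noteq> 0" by auto
          then show ?thesis using Nle[of l "i - 1"] l by (simp add: Q_def)
        next
          case False
          then show ?thesis using Nle[of "Suc i" l] l n by auto
        qed
      qed
      then have "(\<Sum>n\<in>{..<T} \<inter> (A - {?m}). ?f n (k i)) \<le> (\<Sum>n\<in>Q \<union> {?M..<?M + T}. ?f n (k i))"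
        using finQ by (intro sum_mono2) auto
      also have "\<dots> \<le> (\<Sum>n\<in>Q. ?f n (k i)) + (\<Sum>n\<in>{?M..<?M + T}. ?f n (k i))"
        using sum_Un_nat finQ by (subst sum.union_inter[symmetric]) (auto simp: sum_nonneg)
      also have "(\<Sum>n\<in>{?M..<?M + T}. ?f n (k i)) = (\<Sum>n<T. ?f (n + ?M) (k i))"
        using sum.shift_bounds_nat_ivl[of "\<lambda>n. ?f n (k i)" 0 ?M T] by (simp add: add.commute atLeast0LessThan)
      also have "\<dots> \<le> (\<Sum>n. ?f (n + ?M) (k i))"
        by (intro sum_le_suminf summable_ignore_initial_segment[OF summ]) auto
      also have "\<dots> \<le> ?\<eta>" using spec[OF k, of i] by blast
      finally show "(\<Sum>n\<in>{..<T} \<inter> (A - {?m}). ?f n (k i)) \<le> ?\<eta> + ?\<eta>" using Q by simp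
    qed
    moreover have "subprod A (z (k i)) = \<psi> ?m (z (k i)) * subprod (A - {?m}) (z (k i))"
      by (rule subprod_split) (simp add: A_def)
    then have eq: "subprod A (z (k i)) - 1 = (\<psi> ?m (z (k i)) - 1) + \<psi> ?m (z (k i)) * (subprod (A - {?m}) (z (k i)) - 1)"
      by (simp add: algebra_simps)
    have "norm (\<psi> ?m (z (k i)) - 1) - norm (subprod (A - {?m}) (z (k i)) - 1) \<le> norm (subprod A (z (k i)) - 1)"
      unfolding eq using norm_diff_ineq[of "\<psi> ?m (z (k i)) - 1" "\<psi> ?m (z (k i)) * (subprod (A - {?m}) (z (k i)) - 1)"]
      by (simp only: norm_mult unit mult_1)
    ultimately show ?thesis using far[of "k i"] by linarith
  qed
  then show ?thesis using km(1) by (intro exI[of _ A] exI[of _ k] conjI allI)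
qed

lemma psi_tendsto_1: "(\<lambda>n. \<psi> n x) \<longlonglongrightarrow> 1"
  using summable_LIMSEQ_zero[OF summ[of x]] by (simp add: tendsto_norm_zero_iff LIM_zero_iff)

text \<open>Along a subsequence of a counterexample all \<psi> m converge to their values at some y.
  The differences from y satisfy the hypotheses of \<open>gliding_hump\<close>, so some
  \<open>subprod A\<close> stays away from its value at y. A further subsequence, along which
  \<open>subprod A\<close> also converges, shows that it must tend to that value.\<close>

lemma uniform_on_bohr_compact:
  assumes K: "compactin bohr_topology K" and e: "e > 0"
  shows "\<forall>\<^sub>F n in sequentially. \<forall>x\<in>K. norm (\<psi> n x - 1) < e"
proof (rule ccontr)
  assume "\<not> ?thesis"
  then have "\<forall>j. \<exists>n x. j \<le> n \<and> x \<in> K \<and> norm (\<psi> n x - 1) \<ge> e"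
    unfolding eventually_sequentially by (simp add: not_less) blast
  then obtain n x where nx: "\<And>j. j \<le> n j" "\<And>j. x j \<in> K" "\<And>j. norm (\<psi> (n j) (x j) - 1) \<ge> e"
    by metis
  obtain r :: "nat \<Rightarrow> nat" and y where r: "strict_mono r" "y \<in> K" "\<forall>m. (\<lambda>j. \<psi> m (x (r j))) \<longlonglongrightarrow> \<psi> m y"
    using bohr_compact_subsequence[where g = \<psi> and x = x, OF K continuous_psi nx(2)] by (elim exE conjE)
  have diff: "norm (\<psi> m (u - v) - 1) = norm (\<psi> m u - \<psi> m v)" for m u v
    by (rule unit_hom_diff[OF mult unit])
  have "\<forall>\<^sub>F m in sequentially. dist (\<psi> m y) 1 < e / 2"
    using psi_tendsto_1[of y] e by (intro tendstoD) auto
  then obtain J where J: "\<And>m. m \<ge> J \<Longrightarrow> norm (\<psi> m y - 1) < e / 2"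
    unfolding eventually_sequentially by (auto simp: dist_norm)
  \<comment> \<open>The shift by J puts \<psi> (N j) y within e/2 of 1, so subtracting y leaves a
    distance of at least e/2.\<close>
  define z where "z j = x (r (j + J)) - y" for j
  define N where "N j = n (r (j + J))" for j
  have NJ: "j + J \<le> N j" for j
    using nx(1)[of "r (j + J)"] seq_suble[OF r(1), of "j + J"] by (simp add: N_def)
  have "(\<lambda>j. \<psi> m (z j)) \<longlonglongrightarrow> 1" for m
  proof -
    have "(\<lambda>j. norm (\<psi> m (x (r (j + J))) - \<psi> m y)) \<longlonglongrightarrow> 0"
      using LIMSEQ_ignore_initial_segment[OF spec[OF r(3), of m], of J]
      by (simp add: tendsto_norm_zero_iff LIM_zero_iff)
    then have "(\<lambda>j. norm (\<psi> m (z j) - 1)) \<longlonglongrightarrow> 0" by (simp add: z_def diff)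
    then show ?thesis by (simp add: tendsto_norm_zero_iff LIM_zero_iff)
  qed
  moreover have "norm (\<psi> (N j) (z j) - 1) \<ge> e / 2" for j
  proof -
    have "e \<le> norm (\<psi> (N j) (x (r (j + J))) - 1)" using nx(3) by (simp add: N_def)
    also have "\<dots> \<le> norm (\<psi> (N j) (x (r (j + J))) - \<psi> (N j) y) + norm (\<psi> (N j) y - 1)"
      using norm_triangle_ineq[of "\<psi> (N j) (x (r (j + J))) - \<psi> (N j) y" "\<psi> (N j) y - 1"] by simp
    also have "norm (\<psi> (N j) y - 1) < e / 2" using NJ[of j] by (intro J) simp
    finally show ?thesis by (simp add: z_def diff)
  qed
  moreover have "j \<le> N j" for j using NJ[of j] by simp
  moreover have "e / 2 > 0" using e by simp
  ultimately have "\<exists>A (k :: nat \<Rightarrow> nat). strict_mono k \<and> (\<forall>i. norm (subprod A (z (k i)) - 1) \<ge> e / 2 / 2)"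
    by (intro gliding_hump)
  then obtain A and k :: "nat \<Rightarrow> nat" where Ak: "strict_mono k" "\<And>i. norm (subprod A (z (k i)) - 1) \<ge> e / 2 / 2"
    by blast
  \<comment> \<open>The new character takes index 0, so that one subsequence serves it and all the
    \<psi> n.\<close>
  define g where "g m = (case m of 0 \<Rightarrow> subprod A | Suc l \<Rightarrow> \<psi> l)" for m
  have g: "continuous_character (g m)" for m
    by (cases m) (simp_all add: g_def continuous_subprod continuous_psi)
  obtain r' :: "nat \<Rightarrow> nat" and y' where r': "strict_mono r'" "\<forall>m. (\<lambda>j. g m (x (r (k (r' j) + J)))) \<longlonglongrightarrow> g m y'"
    using bohr_compact_subsequence[where g = g and x = "\<lambda>i. x (r (k i + J))", OF K g nx(2)] by (elim exE conjE)
  have "\<psi> m y' = \<psi> m y" for m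
  proof (rule LIMSEQ_unique)
    show "(\<lambda>j. \<psi> m (x (r (k (r' j) + J)))) \<longlonglongrightarrow> \<psi> m y'"
      using spec[OF r'(2), of "Suc m"] by (simp add: g_def)
    have "strict_mono (\<lambda>j. k (r' j) + J)"
      using Ak(1) r'(1) by (auto simp: strict_mono_def)
    from LIMSEQ_subseq_LIMSEQ[OF spec[OF r(3), of m] this]
    show "(\<lambda>j. \<psi> m (x (r (k (r' j) + J)))) \<longlonglongrightarrow> \<psi> m y" by (simp add: o_def)
  qed
  then have "subprod A y' = subprod A y" by (rule subprod_eqI)
  then have "(\<lambda>j. subprod A (x (r (k (r' j) + J)))) \<longlonglongrightarrow> subprod A y"
    using spec[OF r'(2), of 0] by (simp add: g_def)
  then have "(\<lambda>j. norm (subprod A (x (r (k (r' j) + J))) - subprod A y)) \<longlonglongrightarrow> 0"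
    by (simp add: tendsto_norm_zero_iff LIM_zero_iff)
  moreover have "norm (subprod A (z j) - 1) = norm (subprod A (x (r (j + J))) - subprod A y)" for j
    unfolding z_def by (rule unit_hom_diff[OF subprod_mult norm_subprod])
  ultimately have "(\<lambda>j. norm (subprod A (z (k (r' j))) - 1)) \<longlonglongrightarrow> 0" by simp
  then have "\<forall>\<^sub>F j in sequentially. norm (subprod A (z (k (r' j))) - 1) < e / 2 / 2"
    by (rule order_tendstoD) (use e in simp)
  then show False using Ak(2) by (simp add: not_less[symmetric])
qed

text \<open>
  On a Bohr neighbourhood \<open>W\<close> of 0 where all \<open>\<psi> n\<close> are close to 1, finitely many translates of \<open>W\<close> cover the
  group. By pigeonhole two of the \<open>\<psi> n\<close> almost agree at the translation points, hence everywhere; but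
  a character that stays close to 1 is trivial.
\<close>

lemma not_equicontinuous:
  "\<not> equicontinuous_family bohr_topology (range (\<lambda>n x. Re (\<psi> n x)))"
proof
  assume equi: "equicontinuous_family bohr_topology (range (\<lambda>n x. Re (\<psi> n x)))"
  \<comment> \<open>Since |\<psi> n t - 1|^2 = 2 - 2 Re(\<psi> n t), closeness 1/128 of the real
    parts gives distance at most 1/8 from 1.\<close>
  obtain W where W: "openin bohr_topology W" "0 \<in> W"
    "\<forall>t\<in>W. \<forall>f\<in>range (\<lambda>n x. Re (\<psi> n x)). \<bar>f t - f 0\<bar> < 1 / 128"
    using equi[unfolded equicontinuous_family_def, THEN bspec[of _ _ 0], THEN spec[of _ "1/128"]]
    by auto
  have near: "norm (\<psi> n t - 1) \<le> 1 / 8" if "t \<in> W" for n t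
  proof -
    have "\<psi> n 0 = 1" by (rule unit_hom_zero[OF mult unit])
    then have "\<bar>Re (\<psi> n t) - 1\<bar> < 1 / 128"
      using bspec[OF bspec[OF W(3) that] rangeI, of n] by simp
    moreover have "(norm (\<psi> n t - 1))\<^sup>2 = 2 - 2 * Re (\<psi> n t)"
    proof -
      have "(Re (\<psi> n t))\<^sup>2 + (Im (\<psi> n t))\<^sup>2 = 1" using unit[of n t] cmod_power2[of "\<psi> n t"] by simp
      moreover have "(norm (\<psi> n t - 1))\<^sup>2 = (Re (\<psi> n t) - 1)\<^sup>2 + (Im (\<psi> n t))\<^sup>2"
        by (simp add: cmod_power2)
      ultimately show ?thesis unfolding power2_diff by simp
    qed
    ultimately have "(norm (\<psi> n t - 1))\<^sup>2 \<le> 1 / 64"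
      using abs_ge_minus_self[of "Re (\<psi> n t) - 1"] by linarith
    also have "1 / 64 = (1 / 8 :: real)\<^sup>2" by (simp add: power2_eq_square)
    finally show ?thesis by (rule power2_le_imp_le) simp
  qed
  obtain \<Phi> d where \<Phi>: "finite \<Phi>" "0 < d" "\<forall>\<phi>\<in>\<Phi>. continuous_character \<phi>"
    "\<forall>y. (\<forall>\<phi>\<in>\<Phi>. norm (\<phi> y - \<phi> 0) < d) \<longrightarrow> y \<in> W"
    using bohr_neighbourhood[OF W(1,2)] by (elim exE conjE)
  have phi1: "\<forall>\<phi>\<in>\<Phi>. \<forall>x. norm (\<phi> x) \<le> 1"
    using continuous_character_norm \<Phi>(3) by fastforce
  obtain \<C> where \<C>: "finite \<C>" "\<Union>\<C> = UNIV" "\<forall>c\<in>\<C>. \<forall>x\<in>c. \<forall>y\<in>c. \<forall>\<phi>\<in>\<Phi>. norm (\<phi> x - \<phi> y) < d"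
    using finite_cells[OF \<Phi>(1) phi1 \<Phi>(2)] by (elim exE conjE)
  define p where "p c = (SOME x. x \<in> c)" for c :: "'a set"
  have cell: "norm (\<psi> n x - \<psi> n (p c)) \<le> 1 / 8" if c: "c \<in> \<C>" and x: "x \<in> c" for n x c
  proof -
    have pc: "p c \<in> c" unfolding p_def using x by (rule someI)
    have "norm (\<phi> (x - p c) - \<phi> 0) < d" if "\<phi> \<in> \<Phi>" for \<phi>
    proof -
      have \<phi>: "continuous_character \<phi>" using \<Phi>(3) that by blast
      note hom = continuous_character_mult[OF \<phi>] continuous_character_norm[OF \<phi>]
      show ?thesis
        using \<C>(3) c x pc that unfolding unit_hom_zero[OF hom] unit_hom_diff[OF hom] by blast
    qed
    then have "x - p c \<in> W" using \<Phi>(4) by blast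
    moreover have "norm (\<psi> n (x - p c) - 1) = norm (\<psi> n x - \<psi> n (p c))"
      by (rule unit_hom_diff[OF mult unit])
    ultimately show ?thesis using near[of "x - p c" n] by simp
  qed
  \<comment> \<open>The roles of points and characters are exchanged: each representative
    \<open>p c\<close> becomes a bounded function of the index n.\<close>
  let ?\<Psi> = "(\<lambda>c n. \<psi> n (p c)) ` \<C>"
  have "\<forall>\<phi>\<in>?\<Psi>. \<forall>n. norm (\<phi> n) \<le> 1" using unit by simp
  from finite_cells[OF finite_imageI[OF \<C>(1)] this, of "1/8", OF divide_pos_pos[OF zero_less_one zero_less_numeral]]
  obtain \<D> :: "nat set set" where \<D>: "finite \<D>" "\<Union>\<D> = UNIV"
    "\<forall>D\<in>\<D>. \<forall>m\<in>D. \<forall>n\<in>D. \<forall>\<phi>\<in>?\<Psi>. norm (\<phi> m - \<phi> n) < 1 / 8"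
    by (elim exE conjE)
  have "\<exists>D\<in>\<D>. infinite D"
    using \<D>(1,2) infinite_UNIV_nat finite_Union by metis
  then obtain D where D: "D \<in> \<D>" "infinite D" by blast
  obtain m n where mn: "m \<in> D" "n \<in> D" "m \<noteq> n"
    using D(2) by (metis finite.emptyI finite_insert insertI1 insert_absorb2 is_singletonI' is_singleton_def)
  \<comment> \<open>Two passages within the cell of x and one between the indices at its
    representative: 3/8 in total, below the 1/2 required by \<open>unit_hom_trivial\<close>.\<close>
  have close: "norm (\<psi> m x - \<psi> n x) \<le> 1 / 2" for x
  proof -
    obtain c where c: "c \<in> \<C>" "x \<in> c" using \<C>(2) UNIV_I[of x] by (metis UnionE)
    have "norm (\<psi> m (p c) - \<psi> n (p c)) < 1 / 8" 
      using \<D>(3)[THEN bspec, OF D(1), THEN bspec, OF mn(1), THEN bspec, OF mn(2), THEN bspec, OF imageI[OF c(1)]] .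
    then show ?thesis
      using cell[OF c, of m] cell[OF c, of n]
        norm_triangle_ineq[of "\<psi> m x - \<psi> m (p c)" "\<psi> m (p c) - \<psi> n x"]
        norm_triangle_ineq[of "\<psi> m (p c) - \<psi> n (p c)" "\<psi> n (p c) - \<psi> n x"]
      by (simp add: norm_minus_commute)
  qed
  have nz: "\<psi> n x \<noteq> 0" for n x using unit[of n x] by auto
  have "\<psi> m x / \<psi> n x = 1" for x
  proof (rule unit_hom_trivial[of "\<lambda>x. \<psi> m x / \<psi> n x"])
    show "\<psi> m (x + y) / \<psi> n (x + y) = \<psi> m x / \<psi> n x * (\<psi> m y / \<psi> n y)" for x y by (simp add: mult)
    fix x
    have "\<psi> m x / \<psi> n x - 1 = (\<psi> m x - \<psi> n x) / \<psi> n x" using nz by (simp add: field_simps)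
    then show "norm (\<psi> m x / \<psi> n x - 1) \<le> 1 / 2" using close[of x] by (simp add: norm_divide unit)
  qed
  then have "\<psi> m = \<psi> n" using nz by (simp add: fun_eq_iff)
  then show False using inj mn(3) by (simp add: inj_def)
qed

end

section \<open>Failure of the sequential Ascoli property for non-compact groups\<close>

lemma limitin_compact_open_const:
  fixes s :: "nat \<Rightarrow> 'a \<Rightarrow> real"
  assumes s: "\<And>n. s n \<in> cont_functions X" and f: "f \<in> cont_functions X" "\<And>x. x \<in> topspace X \<Longrightarrow> f x = c"
    and unif: "\<And>K e. compactin X K \<Longrightarrow> e > 0 \<Longrightarrow> \<forall>\<^sub>F n in sequentially. \<forall>x\<in>K. \<bar>s n x - c\<bar> < e"
  shows "limitin (compact_open_topology X) s f sequentially"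
  unfolding limitin_def
proof (intro conjI allI impI)
  show "f \<in> topspace (compact_open_topology X)" using f(1) by simp
  fix W assume W: "openin (compact_open_topology X) W \<and> f \<in> W"
  then have "generate_topology_on {{f \<in> cont_functions X. f ` K \<subseteq> U} | K U. compactin X K \<and> open U} W"
    unfolding compact_open_topology_def by (intro openin_topology_generated_by) blast
  moreover have "f \<in> W" using W by blast
  ultimately show "\<forall>\<^sub>F n in sequentially. s n \<in> W"
  proof (induction rule: generate_topology_on.induct)
    case (Int a b)
    then show ?case by (simp add: eventually_conj_iff)
  next
    case (UN K)
    then obtain k where k: "k \<in> K" "f \<in> k" by auto
    show ?case using UN.IH[OF k] by (rule eventually_mono) (use k(1) in blast)
  next
    case (Basis W)
    then obtain K U where KU: "W = {f \<in> cont_functions X. f ` K \<subseteq> U}" "compactin X K" "open U" by blast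
    show ?case
    proof (cases "K = {}")
      \<comment> \<open>For empty \<open>K\<close> the subbasic set is the whole function space, and
        \<open>U\<close> need not contain c.\<close>
      case True
      then show ?thesis using KU s by simp
    next
      case False
      then have "c \<in> U" using Basis.prems f(2) KU compactin_subset_topspace[OF KU(2)] by force
      then obtain e where e: "e > 0" "\<And>w. dist w c < e \<Longrightarrow> w \<in> U" using KU(3) by (auto simp: open_dist)
      show ?thesis using unif[OF KU(2) e(1)]
        by (rule eventually_mono) (use e(2) s in \<open>auto simp: KU(1) dist_real_def\<close>)
    qed
  qed auto
qed

text \<open>The function space is real, so the witness is the sequence of real parts of the \<psi>
  n, converging to the constant 1.\<close>

lemma (in slow_characters) not_sequentially_Ascoli: "\<not> sequentially_Ascoli (bohr_topology :: 'a topology)"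
proof
  assume asc: "sequentially_Ascoli (bohr_topology :: 'a topology)"
  have s: "(\<lambda>x. Re (\<psi> n x)) \<in> cont_functions bohr_topology" for n
    unfolding cont_functions_def
    using continuous_map_compose[OF continuous_map_bohr_topology[OF continuous_psi[of n]], of euclideanreal Re]
    by (simp add: o_def continuous_on_Re continuous_on_id extensional_def)
  have "limitin (compact_open_topology bohr_topology) (\<lambda>n x. Re (\<psi> n x)) (\<lambda>_. 1) sequentially"
  proof (rule limitin_compact_open_const[where c = 1])
    show "(\<lambda>_. 1) \<in> cont_functions (bohr_topology :: 'a topology)"
      by (simp add: cont_functions_def extensional_def)
    fix K :: "'a set" and e :: real assume "compactin bohr_topology K" "e > 0"
    from uniform_on_bohr_compact[OF this]
    show "\<forall>\<^sub>F n in sequentially. \<forall>x\<in>K. \<bar>Re (\<psi> n x) - 1\<bar> < e"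
    proof (rule eventually_mono)
      fix n assume *: "\<forall>x\<in>K. norm (\<psi> n x - 1) < e"
      have "\<bar>Re (\<psi> n x) - 1\<bar> \<le> norm (\<psi> n x - 1)" for x
        using abs_Re_le_cmod[of "\<psi> n x - 1"] by simp
      then show "\<forall>x\<in>K. \<bar>Re (\<psi> n x) - 1\<bar> < e" using * order_le_less_trans by blast
    qed
  qed (use s in auto)
  moreover have "range (\<lambda>n x. Re (\<psi> n x)) \<subseteq> topspace (compact_open_topology bohr_topology)"
    using s by auto
  ultimately have "equicontinuous_family bohr_topology (range (\<lambda>n x. Re (\<psi> n x)))"
    using asc unfolding sequentially_Ascoli_def by blast
  then show False using not_equicontinuous by blast
qed

section \<open>The invariant mean on a compact abelian group\<close>

text \<open>A list, not a set, of translations: sums a + b arising from iterated averages may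
  coincide and must be counted with multiplicity.\<close>

definition avg :: "'a::ab_group_add list \<Rightarrow> ('a \<Rightarrow> 'b::real_normed_vector) \<Rightarrow> 'a \<Rightarrow> 'b" where
  "avg as f x = (\<Sum>a\<leftarrow>as. f (x + a)) /\<^sub>R real (length as)"

lemma sum_list_const_scaleR: "(\<Sum>a\<leftarrow>as. c) = real (length as) *\<^sub>R (c :: 'b::real_vector)"
  by (induction as) (auto simp: algebra_simps)

lemma avg_const: "as \<noteq> [] \<Longrightarrow> avg as (\<lambda>_. c) x = c"
  by (simp add: avg_def sum_list_const_scaleR)

lemma avg_single: "avg [a] f x = f (x + a)"
  by (simp add: avg_def)

lemma avg_add: "avg as (\<lambda>x. f x + g x) x = avg as f x + avg as g x"
  by (simp add: avg_def sum_list_addf scaleR_right_distrib)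

lemma avg_linear:
  assumes "bounded_linear T"
  shows "avg as (\<lambda>x. T (f x)) x = T (avg as f x)"
proof -
  interpret bounded_linear T by (rule assms)
  have "(\<Sum>a\<leftarrow>as. T (f (x + a))) = T (\<Sum>a\<leftarrow>as. f (x + a))"
    by (induction as) (auto simp: zero add)
  then show ?thesis by (simp add: avg_def scaleR)
qed

lemma avg_diff: "avg as (\<lambda>x. f x - g x) x = avg as f x - avg as g x"
  by (simp add: avg_def sum_list_subtractf scaleR_right_diff_distrib)

lemma norm_avg_le:
  assumes "as \<noteq> []" "\<And>y. norm (f y) \<le> e"
  shows "norm (avg as f x) \<le> e"
proof -
  have "norm (\<Sum>a\<leftarrow>as. f (x + a)) \<le> real (length as) * e"
  proof (induction as)
    case (Cons a as)
    have "norm (f (x + a) + (\<Sum>a\<leftarrow>as. f (x + a))) \<le> e + real (length as) * e"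
      by (rule order_trans[OF norm_triangle_ineq]) (intro add_mono assms(2) Cons)
    then show ?case by (simp add: algebra_simps)
  qed simp
  then show ?thesis using assms(1) by (simp add: avg_def field_simps)
qed

lemma avg_near:
  assumes "as \<noteq> []" "\<And>y. norm (f y - c) \<le> e"
  shows "norm (avg as f x - c) \<le> e"
proof -
  have "norm (avg as (\<lambda>y. f y - c) x) \<le> e" by (rule norm_avg_le[OF assms])
  then show ?thesis by (simp add: avg_diff avg_const[OF assms(1)])
qed

lemma avg_ge:
  fixes f :: "'a::ab_group_add \<Rightarrow> real"
  assumes "as \<noteq> []" "\<And>y. c \<le> f y"
  shows "c \<le> avg as f x"
proof -
  have "avg as (\<lambda>_. c) x \<le> avg as f x"
    unfolding avg_def using assms by (simp add: sum_list_mono divide_right_mono)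
  then show ?thesis by (simp add: avg_const[OF assms(1)])
qed

definition add_lists :: "'a::ab_group_add list \<Rightarrow> 'a list \<Rightarrow> 'a list" where
  "add_lists as bs = concat (map (\<lambda>a. map (\<lambda>b. a + b) bs) as)"

lemma add_lists_ne: "as \<noteq> [] \<Longrightarrow> bs \<noteq> [] \<Longrightarrow> add_lists as bs \<noteq> []"
  by (cases as; cases bs) (auto simp: add_lists_def)

lemma avg_avg: "avg as (avg bs f) x = avg (add_lists as bs) f x"
proof -
  have "(\<Sum>a\<leftarrow>as. (\<Sum>b\<leftarrow>bs. f (x + a + b))) = (\<Sum>c\<leftarrow>add_lists as bs. f (x + c))"
    by (induction as) (auto simp: add_lists_def o_def add.assoc)
  moreover have "(\<Sum>a\<leftarrow>as. avg bs f (x + a)) = (\<Sum>a\<leftarrow>as. (\<Sum>b\<leftarrow>bs. f (x + a + b))) /\<^sub>R real (length bs)"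
    by (induction as) (auto simp: avg_def scaleR_right_distrib)
  moreover have "length (add_lists as bs) = length as * length bs"
    by (induction as) (auto simp: add_lists_def)
  ultimately show ?thesis by (simp add: avg_def[of as] avg_def[of "add_lists as bs"] mult.commute)
qed

text \<open>Commutativity of the group enters here. It makes two nearly constant averages of one
  function comparable, by applying each list to the other average, and hence makes the mean
  unique.\<close>

lemma avg_commute: "avg as (avg bs f) x = avg bs (avg as f) x"
proof -
  have "(\<Sum>a\<leftarrow>as. (\<Sum>b\<leftarrow>bs. f (x + a + b))) = (\<Sum>b\<leftarrow>bs. (\<Sum>a\<leftarrow>as. f (x + b + a)))"
    by (induction as) (auto simp: sum_list_addf sum_list_const_scaleR add_ac)
  moreover have "(\<Sum>a\<leftarrow>as. avg bs f (x + a)) = (\<Sum>a\<leftarrow>as. (\<Sum>b\<leftarrow>bs. f (x + a + b))) /\<^sub>R real (length bs)" for as bs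
    by (induction as) (auto simp: avg_def scaleR_right_distrib)
  ultimately show ?thesis by (simp add: avg_def[of as "avg bs f"] avg_def[of bs "avg as f"] mult.commute)
qed

lemma continuous_on_avg:
  fixes f :: "'a::topological_ab_group_add \<Rightarrow> 'b::real_normed_vector"
  assumes "continuous_on UNIV f"
  shows "continuous_on UNIV (avg as f)"
proof -
  have "continuous_on UNIV (\<lambda>x. f (x + a))" for a
    by (rule continuous_on_compose2[OF assms]) (auto intro!: continuous_intros)
  then have "continuous_on UNIV (\<lambda>x. \<Sum>a\<leftarrow>as. f (x + a))"
    by (induction as) (auto intro!: continuous_intros)
  then show ?thesis unfolding avg_def by (intro continuous_intros)
qed

section \<open>Uniform estimates from compactness\<close>

locale compact_abelian_group =
  fixes T :: "'a::{topological_ab_group_add, t2_space} itself"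
  assumes compact_univ: "compact (UNIV :: 'a set)"
begin

text \<open>The tube lemma: compactness in the second variable makes continuity in the first
  uniform.\<close>

lemma joint_continuity:
  fixes F :: "'a \<Rightarrow> 'a \<Rightarrow> 'b::metric_space"
  assumes F: "continuous_on UNIV (\<lambda>p. F (fst p) (snd p))" and e: "e > 0"
  shows "\<exists>U. open U \<and> x \<in> U \<and> (\<forall>x'\<in>U. \<forall>y. dist (F x' y) (F x y) < e)"
proof -
  let ?W = "{p. dist (F (fst p) (snd p)) (F x (snd p)) < e}"
  have "continuous_on UNIV (\<lambda>p :: 'a \<times> 'a. F x (snd p))"
    using continuous_on_compose2[OF F, of UNIV "\<lambda>p. (x, snd p)"]
      continuous_on_Pair[OF continuous_on_const continuous_on_snd[OF continuous_on_id], of UNIV x] by simp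
  then have W: "open ?W" using F by (intro open_Collect_less continuous_intros)
  have "{x} \<times> UNIV \<subseteq> ?W" using e by auto
  from Elementary_Topology.tube_lemma[OF compact_univ W this]
  obtain U where U: "x \<in> U" "open U" "U \<times> UNIV \<subseteq> ?W" by (elim exE conjE)
  have "dist (F x' y) (F x y) < e" if "x' \<in> U" for x' y
    using subsetD[OF U(3), of "(x', y)"] that by simp
  then show ?thesis using U(1,2) by blast
qed

lemma uniform_continuity:
  fixes f :: "'a \<Rightarrow> 'b::metric_space"
  assumes f: "continuous_on UNIV f" and e: "e > 0"
  shows "\<exists>U. open U \<and> 0 \<in> U \<and> (\<forall>x y. x - y \<in> U \<longrightarrow> dist (f x) (f y) < e)"
proof -
  have "continuous_on UNIV (\<lambda>p :: 'a \<times> 'a. f (fst p + snd p))"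
    by (rule continuous_on_compose2[OF f]) (auto intro!: continuous_intros)
  from joint_continuity[where F = "\<lambda>u y. f (u + y)" and x = 0, OF this e]
  obtain U where U: "open U" "0 \<in> U" "\<forall>u\<in>U. \<forall>y. dist (f (u + y)) (f (0 + y)) < e" by blast
  have "dist (f x) (f y) < e" if "x - y \<in> U" for x y
    using bspec[OF U(3) that, THEN spec, of y] by simp
  then show ?thesis using U(1,2) by blast
qed

text \<open>With this list every average, whatever its base point, has a sample close to any
  prescribed z.\<close>

lemma finite_cover:
  fixes U :: "'a set"
  assumes "open U" "0 \<in> U"
  obtains as where "as \<noteq> []" "\<And>x z. \<exists>a\<in>set as. x + a - z \<in> U"
proof -
  have "UNIV \<subseteq> (\<Union>a\<in>UNIV. {y. a - y \<in> U})" using assms(2) by (auto intro!: exI)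
  moreover have "open {y. a - y \<in> U}" for a
    using continuous_on_diff[OF continuous_on_const continuous_on_id, of UNIV a]
      open_vimage[OF assms(1), of "\<lambda>y. a - y"] by (simp add: vimage_def)
  ultimately obtain F where F: "finite F" "UNIV \<subseteq> (\<Union>a\<in>F. {y. a - y \<in> U})"
    by (meson compactE_image[OF compact_univ])
  obtain as where as: "set as = F" using finite_list[OF F(1)] by blast
  show thesis
  proof (rule that[of as])
    show "as \<noteq> []" using as F(2) by auto
    fix x z
    have "z - x \<in> (\<Union>a\<in>F. {y. a - y \<in> U})" using F(2) by blast
    then show "\<exists>a\<in>set as. x + a - z \<in> U" unfolding as by (auto simp: algebra_simps)
  qed
qed

text \<open>
  If \<open>h\<close> is far below its upper bound at one point, it is so on a translate of \<open>U\<close>. Every average over the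
  list of translates meets that set, so averaging lowers the upper bound by a fixed amount.
\<close>

lemma avg_real_near_const:
  fixes f :: "'a \<Rightarrow> real"
  assumes f: "continuous_on UNIV f" and d: "d > 0"
  shows "\<exists>as c. as \<noteq> [] \<and> (\<forall>x. \<bar>avg as f x - c\<bar> \<le> 2 * d)"
proof -
  obtain U where U: "open U" "0 \<in> U" "\<forall>x y. x - y \<in> U \<longrightarrow> dist (f x) (f y) < d"
    using uniform_continuity[OF f d] by (elim exE conjE)
  obtain as where as: "as \<noteq> []" "\<And>x z. \<exists>a\<in>set as. x + a - z \<in> U"
    using finite_cover[OF U(1,2)] by metis
  let ?N = "real (length as)"
  have N: "?N > 0" using as(1) by simp
  \<comment> \<open>Some average has oscillation at most D. The descent below starts at 2 B and
    cannot pass below 0, so it must end in the alternative 2 d.\<close>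
  define P where "P D \<longleftrightarrow> (\<exists>bs lo. bs \<noteq> [] \<and> (\<forall>x. lo \<le> avg bs f x \<and> avg bs f x \<le> lo + D))" for D
  have step: "P (2 * d) \<or> P (D - d / ?N)" if PD: "P D" for D
  proof -
    obtain bs lo where bs: "bs \<noteq> []" "\<And>x. lo \<le> avg bs f x" "\<And>x. avg bs f x \<le> lo + D"
      using PD unfolding P_def by blast
    let ?h = "avg bs f"
    show ?thesis
    proof (cases "\<exists>z. ?h z < lo + D - 2 * d")
      case False
      then have "P (2 * d)" unfolding P_def
        using bs(1,3) by (intro exI[of _ bs] exI[of _ "lo + D - 2 * d"]) (auto simp: not_less)
      then show ?thesis ..
    next
      case True
      then obtain z where z: "?h z < lo + D - 2 * d" by blast
      \<comment> \<open>Averaging preserves the modulus of continuity, so the same \<open>U\<close>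
        and hence the same gain d/N serve in every round.\<close>
      have hz: "?h y \<le> lo + D - d" if "y - z \<in> U" for y
      proof -
        have "norm (avg bs (\<lambda>w. f (w + (y - z)) - f w) z) \<le> d"
        proof (rule norm_avg_le[OF bs(1)])
          fix w show "norm (f (w + (y - z)) - f w) \<le> d"
            using U(3)[rule_format, of "w + (y - z)" w] that by (simp add: dist_norm)
        qed
        moreover have "avg bs (\<lambda>w. f (w + (y - z))) z = ?h y"
          by (simp add: avg_def algebra_simps)
        ultimately have "\<bar>?h y - ?h z\<bar> \<le> d" by (simp add: avg_diff)
        then show ?thesis using z by linarith
      qed
      have "avg as ?h x \<le> lo + (D - d / ?N)" for x
      proof -
        obtain a where a: "a \<in> set as" "x + a - z \<in> U" using as(2) by blast
        have "(\<Sum>b\<leftarrow>as. ?h (x + b)) \<le> ?h (x + a) + (\<Sum>b\<leftarrow>remove1 a as. lo + D)"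
          unfolding sum_list_map_remove1[OF a(1)] by (intro add_left_mono sum_list_mono bs(3))
        also have "\<dots> \<le> (lo + D - d) + (?N - 1) * (lo + D)"
          using hz[OF a(2)] as(1) a(1) by (simp add: sum_list_const_scaleR length_remove1 of_nat_diff Suc_leI)
        also have "\<dots> = ?N * (lo + D - d / ?N)" using N by (simp add: field_simps)
        finally show ?thesis using N by (simp add: avg_def[of as] field_simps)
      qed
      moreover have "lo \<le> avg as ?h x" for x by (rule avg_ge[OF as(1) bs(2)])
      ultimately have "P (D - d / ?N)" unfolding P_def
        using add_lists_ne[OF as(1) bs(1)] unfolding avg_avg by (intro exI[of _ "add_lists as bs"] exI[of _ lo]) simp
      then show ?thesis ..
    qed
  qed
  have neg: "\<not> P D" if "D < 0" for D
    unfolding P_def using that by (auto simp: not_le)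
  have bdd: "compact (range f)" using compact_continuous_image[OF f compact_univ] .
  then obtain B where B: "\<And>x. \<bar>f x\<bar> \<le> B" unfolding compact_eq_bounded_closed bounded_iff by auto
  have "P (2 * B)"
  proof -
    have "- B \<le> f x \<and> f x \<le> - B + 2 * B" for x using B[of x] by linarith
    then show ?thesis unfolding P_def
      by (intro exI[of _ "[0]"] exI[of _ "- B"]) (simp add: avg_single)
  qed
  then have iter: "P (2 * d) \<or> P (2 * B - real k * (d / ?N))" for k
  proof (induction k)
    case (Suc k)
    have "2 * B - real (Suc k) * (d / ?N) = 2 * B - real k * (d / ?N) - d / ?N"
      by (simp only: of_nat_Suc distrib_right)
    then show ?case using Suc step[of "2 * B - real k * (d / ?N)"] by metis
  qed simp
  obtain k :: nat where "2 * B / (d / ?N) < real k" using reals_Archimedean2 by blast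
  then have "2 * B - real k * (d / ?N) < 0" using d N by (simp add: field_simps)
  then have "P (2 * d)" using iter[of k] neg by blast
  then obtain bs lo where "bs \<noteq> []" "\<And>x. lo \<le> avg bs f x" "\<And>x. avg bs f x \<le> lo + 2 * d"
    unfolding P_def by blast
  then show ?thesis by (intro exI[of _ bs] exI[of _ lo]) (simp add: abs_le_iff algebra_simps)
qed

abbreviation C :: "('a \<Rightarrow> complex) \<Rightarrow> bool" where
  "C f \<equiv> continuous_on UNIV f"

lemma C_shift:
  assumes "C f"
  shows "C (\<lambda>x. f (x + a))" "C (\<lambda>x. f (a + x))" "C (\<lambda>x. f (x - a))" "C (\<lambda>x. f (a - x))" "C (\<lambda>x. f (- x))"
  by (rule continuous_on_compose2[OF assms]; auto intro!: continuous_intros)+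

text \<open>Real and imaginary part come with different lists. The combined list works for both
  because further averaging cannot spoil near-constancy.\<close>

lemma avg_near_const:
  assumes f: "C f" and e: "e > 0"
  shows "\<exists>as c. as \<noteq> [] \<and> (\<forall>x. norm (avg as f x - c) \<le> e)"
proof -
  have "continuous_on UNIV (\<lambda>x. Re (f x))" "continuous_on UNIV (\<lambda>x. Im (f x))"
    using f by (auto intro!: continuous_intros)
  then obtain as bs c d where *: "as \<noteq> []" "\<And>x. \<bar>avg as (\<lambda>x. Re (f x)) x - c\<bar> \<le> 2 * (e / 4)"
    "bs \<noteq> []" "\<And>x. \<bar>avg bs (\<lambda>x. Im (f x)) x - d\<bar> \<le> 2 * (e / 4)"
    using avg_real_near_const[of _ "e / 4"] e by (metis divide_pos_pos zero_less_numeral)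
  have "norm (avg as (avg bs f) x - Complex c d) \<le> e" for x
  proof -
    let ?g = "avg as (avg bs f)"
    have "Re (?g x) = avg as (avg bs (\<lambda>x. Re (f x))) x" "Im (?g x) = avg as (avg bs (\<lambda>x. Im (f x))) x"
      by (simp_all add: avg_linear[OF bounded_linear_Re, symmetric] avg_linear[OF bounded_linear_Im, symmetric])
    moreover have "\<bar>avg bs (avg as (\<lambda>x. Re (f x))) x - c\<bar> \<le> 2 * (e / 4)"
      using avg_near[OF *(3), of "avg as (\<lambda>x. Re (f x))" c "2 * (e / 4)" x] *(2) by simp
    moreover have "\<bar>avg as (avg bs (\<lambda>x. Im (f x))) x - d\<bar> \<le> 2 * (e / 4)"
      using avg_near[OF *(1), of "avg bs (\<lambda>x. Im (f x))" d "2 * (e / 4)" x] *(4) by simp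
    ultimately have "\<bar>Re (?g x - Complex c d)\<bar> \<le> e / 2" "\<bar>Im (?g x - Complex c d)\<bar> \<le> e / 2"
      by (simp_all add: avg_commute[of as bs])
    then show ?thesis using cmod_le[of "?g x - Complex c d"] by linarith
  qed
  then have "\<forall>x. norm (avg (add_lists as bs) f x - Complex c d) \<le> e" by (simp add: avg_avg)
  then show ?thesis using add_lists_ne[OF *(1,3)] by blast
qed

lemma avg_near_unique:
  assumes "as \<noteq> []" "\<And>x. norm (avg as f x - c) \<le> e" "bs \<noteq> []" "\<And>x. norm (avg bs f x - d) \<le> e'"
  shows "norm (c - d :: complex) \<le> e + e'"
proof -
  have "norm (avg bs (avg as f) 0 - c) \<le> e" by (rule avg_near[OF assms(3,2)])
  moreover have "norm (avg as (avg bs f) 0 - d) \<le> e'" by (rule avg_near[OF assms(1,4)])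
  ultimately show ?thesis
    using norm_triangle_ineq4[of "avg as (avg bs f) 0 - d" "avg as (avg bs f) 0 - c"]
    by (simp add: avg_commute[of bs as])
qed

section \<open>The mean as an invariant, faithful functional\<close>

lemma mean_exists:
  assumes f: "C f"
  shows "\<exists>c. \<forall>e>0. \<exists>as. as \<noteq> [] \<and> (\<forall>x. norm (avg as f x - c) \<le> e)"
proof -
  have "\<forall>n. \<exists>as c. as \<noteq> [] \<and> (\<forall>x. norm (avg as f x - c) \<le> inverse (real (Suc n)))"
    using avg_near_const[OF f] by simp
  then obtain as c where ac: "\<And>n. as n \<noteq> []" "\<And>n x. norm (avg (as n) f x - c n) \<le> inverse (real (Suc n))"
    by metis
  have small: "\<exists>N. \<forall>n\<ge>N. inverse (real (Suc n)) < e" if "e > 0" for e :: real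
    using LIMSEQ_inverse_real_of_nat[THEN order_tendstoD(2), OF that] by (simp add: eventually_sequentially)
  have diff: "norm (c m - c n) \<le> inverse (real (Suc m)) + inverse (real (Suc n))" for m n
    by (rule avg_near_unique[OF ac ac])
  have "Cauchy c"
  proof (rule CauchyI)
    fix e :: real assume "e > 0"
    then obtain N where N: "\<forall>n\<ge>N. inverse (real (Suc n)) < e / 2" using small[of "e / 2"] by auto
    have "norm (c m - c n) < e" if "m \<ge> N" "n \<ge> N" for m n
      using diff[of m n] N[rule_format, OF that(1)] N[rule_format, OF that(2)] by linarith
    then show "\<exists>M. \<forall>m\<ge>M. \<forall>n\<ge>M. norm (c m - c n) < e" by blast
  qed
  then obtain l where l: "c \<longlonglongrightarrow> l" using Cauchy_convergent convergent_def by blast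
  have "\<exists>as. as \<noteq> [] \<and> (\<forall>x. norm (avg as f x - l) \<le> e)" if e: "e > 0" for e
  proof -
    obtain N where N: "\<forall>n\<ge>N. inverse (real (Suc n)) < e / 2" using small[of "e / 2"] e by auto
    obtain M where M: "\<forall>n\<ge>M. norm (c n - l) < e / 2" using LIMSEQ_D[OF l, of "e / 2"] e by auto
    let ?n = "max M N"
    have "norm (avg (as ?n) f x - l) \<le> e" for x
      using ac(2)[of ?n x] N[rule_format, of ?n] M[rule_format, of ?n]
        norm_triangle_ineq[of "avg (as ?n) f x - c ?n" "c ?n - l"] by simp
    then show ?thesis using ac(1) by blast
  qed
  then show ?thesis by blast
qed

text \<open>For continuous functions this is the normalised Haar integral, and \<open>SOME\<close>
  has exactly one candidate.\<close>

definition mean :: "('a \<Rightarrow> complex) \<Rightarrow> complex" where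
  "mean f = (SOME c. \<forall>e>0. \<exists>as. as \<noteq> [] \<and> (\<forall>x. norm (avg as f x - c) \<le> e))"

lemma mean_approx:
  assumes "C f" "e > 0"
  obtains as where "as \<noteq> []" "\<And>x. norm (avg as f x - mean f) \<le> e"
  using someI_ex[OF mean_exists[OF assms(1)]] assms(2) unfolding mean_def by blast

lemma mean_near:
  assumes "C f" "as \<noteq> []" "\<And>x. norm (avg as f x - c) \<le> e"
  shows "norm (mean f - c) \<le> e"
proof (rule field_le_epsilon)
  fix d :: real assume "d > 0"
  then obtain bs where "bs \<noteq> []" "\<And>x. norm (avg bs f x - mean f) \<le> d"
    using mean_approx[OF assms(1)] by metis
  from avg_near_unique[OF this assms(2,3)] show "norm (mean f - c) \<le> e + d" by simp
qed

lemma mean_eqI: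
  assumes "C f" "\<And>e. e > 0 \<Longrightarrow> \<exists>as. as \<noteq> [] \<and> (\<forall>x. norm (avg as f x - c) \<le> e)"
  shows "mean f = c"
proof -
  have "norm (mean f - c) \<le> 0"
  proof (rule field_le_epsilon)
    fix e :: real assume "e > 0"
    then obtain as where "as \<noteq> []" "\<forall>x. norm (avg as f x - c) \<le> e" using assms(2) by blast
    then show "norm (mean f - c) \<le> 0 + e" using mean_near[OF assms(1), of as c e] by simp
  qed
  then show ?thesis by simp
qed

lemma mean_const [simp]: "mean (\<lambda>_. c) = c"
proof -
  have "norm (mean (\<lambda>_. c) - c) \<le> 0" by (rule mean_near[of _ "[0]"]) (auto simp: avg_const)
  then show ?thesis by simp
qed

lemma mean_near_const: "C f \<Longrightarrow> (\<And>x. norm (f x - c) \<le> e) \<Longrightarrow> norm (mean f - c) \<le> e"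
  by (rule mean_near[of f "[0]"]) (auto simp: avg_single)

lemma common_approx:
  assumes "finite S" "\<And>f. f \<in> S \<Longrightarrow> C f" "e > 0"
  shows "\<exists>as. as \<noteq> [] \<and> (\<forall>f\<in>S. \<forall>x. norm (avg as f x - mean f) \<le> e)"
  using assms(1,2)
proof (induction S rule: finite_induct)
  case empty
  then show ?case by (intro exI[of _ "[0]"]) simp
next
  case (insert g S)
  then obtain as where as: "as \<noteq> []" "\<forall>f\<in>S. \<forall>x. norm (avg as f x - mean f) \<le> e" by auto
  obtain bs where bs: "bs \<noteq> []" "\<And>x. norm (avg bs g x - mean g) \<le> e"
    using mean_approx[OF insert.prems[OF insertI1] assms(3)] by metis
  have "norm (avg (add_lists as bs) f x - mean f) \<le> e" if "f \<in> insert g S" for f x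
  proof (cases "f = g")
    case True
    have "norm (avg as (avg bs g) x - mean g) \<le> e" by (rule avg_near[OF as(1) bs(2)])
    then show ?thesis using True by (simp add: avg_avg)
  next
    case False
    then have "\<And>x. norm (avg as f x - mean f) \<le> e" using as(2) that by blast
    then have "norm (avg bs (avg as f) x - mean f) \<le> e" by (rule avg_near[OF bs(1)])
    then show ?thesis by (simp add: avg_commute[of bs] flip: avg_avg)
  qed
  then show ?case using add_lists_ne[OF as(1) bs(1)] by blast
qed

lemma mean_add:
  assumes "C f" "C g"
  shows "mean (\<lambda>x. f x + g x) = mean f + mean g"
proof (rule mean_eqI)
  show "C (\<lambda>x. f x + g x)" using assms by (intro continuous_intros)
  fix e :: real assume "e > 0"
  then obtain as where as: "as \<noteq> []" "\<forall>h\<in>{f, g}. \<forall>x. norm (avg as h x - mean h) \<le> e / 2"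
    using common_approx[of "{f, g}" "e / 2"] assms by auto
  have "norm (avg as (\<lambda>x. f x + g x) x - (mean f + mean g)) \<le> e" for x
  proof -
    have "norm ((avg as f x - mean f) + (avg as g x - mean g)) \<le> e / 2 + e / 2"
      using as(2) by (intro norm_triangle_le add_mono) auto
    then show ?thesis by (simp add: avg_add algebra_simps)
  qed
  then show "\<exists>as. as \<noteq> [] \<and> (\<forall>x. norm (avg as (\<lambda>x. f x + g x) x - (mean f + mean g)) \<le> e)"
    using as(1) by blast
qed

lemma mean_cmult:
  assumes "C f"
  shows "mean (\<lambda>x. c * f x) = c * mean f"
proof (cases "c = 0")
  case False
  show ?thesis
  proof (rule mean_eqI)
    show "C (\<lambda>x. c * f x)" using assms by (intro continuous_intros)
    fix e :: real assume "e > 0"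
    then obtain as where as: "as \<noteq> []" "\<And>x. norm (avg as f x - mean f) \<le> e / norm c"
      using mean_approx[OF assms, of "e / norm c"] False by auto
    have "norm (avg as (\<lambda>x. c * f x) x - c * mean f) \<le> e" for x
    proof -
      have eq: "avg as (\<lambda>x. c * f x) x - c * mean f = c * (avg as f x - mean f)"
        by (simp add: avg_linear[OF bounded_linear_mult_right] algebra_simps)
      have "norm c * norm (avg as f x - mean f) \<le> e" using as(2)[of x] False by (simp add: field_simps)
      then show ?thesis by (simp only: eq norm_mult)
    qed
    then show "\<exists>as. as \<noteq> [] \<and> (\<forall>x. norm (avg as (\<lambda>x. c * f x) x - c * mean f) \<le> e)"
      using as(1) by blast
  qed
qed simp

lemma mean_diff:
  assumes "C f" "C g"
  shows "mean (\<lambda>x. f x - g x) = mean f - mean g"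
  using mean_add[OF assms(1), of "\<lambda>x. (-1) * g x"] mean_cmult[OF assms(2), of "-1"] assms(2)
  by (simp add: continuous_on_minus)

lemma mean_cnj:
  assumes "C f"
  shows "mean (\<lambda>x. cnj (f x)) = cnj (mean f)"
proof (rule mean_eqI)
  show "C (\<lambda>x. cnj (f x))" using assms by (intro continuous_intros)
  fix e :: real assume "e > 0"
  then obtain as where as: "as \<noteq> []" "\<And>x. norm (avg as f x - mean f) \<le> e"
    using mean_approx[OF assms] by metis
  have "norm (avg as (\<lambda>x. cnj (f x)) x - cnj (mean f)) \<le> e" for x
    using as(2)[of x] unfolding avg_linear[OF bounded_linear_cnj] complex_cnj_diff[symmetric] complex_mod_cnj .
  then show "\<exists>as. as \<noteq> [] \<and> (\<forall>x. norm (avg as (\<lambda>x. cnj (f x)) x - cnj (mean f)) \<le> e)"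
    using as(1) by blast
qed

lemma mean_shift:
  assumes "C f"
  shows "mean (\<lambda>x. f (x + a)) = mean f"
proof (rule mean_eqI[OF C_shift(1)[OF assms]])
  fix e :: real assume "e > 0"
  then obtain as where as: "as \<noteq> []" "\<And>x. norm (avg as f x - mean f) \<le> e"
    using mean_approx[OF assms] by metis
  have "avg as (\<lambda>x. f (x + a)) x = avg as f (x + a)" for x by (simp add: avg_def add_ac)
  then show "\<exists>as. as \<noteq> [] \<and> (\<forall>x. norm (avg as (\<lambda>x. f (x + a)) x - mean f) \<le> e)"
    using as by auto
qed

lemma mean_reflect:
  assumes "C f"
  shows "mean (\<lambda>x. f (- x)) = mean f"
proof (rule mean_eqI[OF C_shift(5)[OF assms]])
  fix e :: real assume "e > 0"
  then obtain as where as: "as \<noteq> []" "\<And>x. norm (avg as f x - mean f) \<le> e"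
    using mean_approx[OF assms] by metis
  have "avg (map uminus as) (\<lambda>x. f (- x)) x = avg as f (- x)" for x by (simp add: avg_def o_def)
  then show "\<exists>as. as \<noteq> [] \<and> (\<forall>x. norm (avg as (\<lambda>x. f (- x)) x - mean f) \<le> e)"
    using as by (intro exI[of _ "map uminus as"]) simp
qed

lemma mean_reflect_shift:
  assumes "C f"
  shows "mean (\<lambda>x. f (a - x)) = mean f"
  using mean_reflect[OF C_shift(2)[OF assms, of a]] mean_shift[OF assms, of a] by (simp add: add.commute)

lemma mean_avg:
  assumes "C f" "as \<noteq> []"
  shows "mean (avg as f) = mean f"
proof (rule mean_eqI[OF continuous_on_avg[OF assms(1)]])
  fix e :: real assume "e > 0"
  then obtain bs where bs: "bs \<noteq> []" "\<And>x. norm (avg bs f x - mean f) \<le> e"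
    using mean_approx[OF assms(1)] by metis
  have "norm (avg as (avg bs f) x - mean f) \<le> e" for x by (rule avg_near[OF assms(2) bs(2)])
  then have "norm (avg bs (avg as f) x - mean f) \<le> e" for x by (simp add: avg_commute[of bs])
  then show "\<exists>bs. bs \<noteq> [] \<and> (\<forall>x. norm (avg bs (avg as f) x - mean f) \<le> e)" using bs(1) by blast
qed

lemma mean_sum_list:
  assumes "\<And>a. a \<in> set as \<Longrightarrow> C (f a)"
  shows "mean (\<lambda>x. \<Sum>a\<leftarrow>as. f a x) = (\<Sum>a\<leftarrow>as. mean (f a)) \<and> C (\<lambda>x. \<Sum>a\<leftarrow>as. f a x)"
  using assms by (induction as) (auto simp: mean_add intro!: continuous_intros)

lemma Re_mean_ge:
  assumes "C f" "\<And>x. c \<le> Re (f x)"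
  shows "c \<le> Re (mean f)"
proof (rule field_le_epsilon)
  fix e :: real assume "e > 0"
  then obtain as where as: "as \<noteq> []" "\<And>x. norm (avg as f x - mean f) \<le> e"
    using mean_approx[OF assms(1)] by metis
  have "c \<le> avg as (\<lambda>x. Re (f x)) 0" by (rule avg_ge[OF as(1) assms(2)])
  also have "\<dots> = Re (avg as f 0)" by (rule avg_linear[OF bounded_linear_Re])
  also have "\<dots> \<le> Re (mean f) + e"
    using as(2)[of 0] abs_Re_le_cmod[of "avg as f 0 - mean f"] by simp
  finally show "c \<le> Re (mean f) + e" .
qed

text \<open>Every average over the list has a sample near z and is therefore bounded below by a
  fixed positive amount. This faithfulness makes the inner product definite.\<close>

lemma Re_mean_pos:
  assumes "C f" "\<And>x. 0 \<le> Re (f x)" "Re (f z) > 0"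
  shows "Re (mean f) > 0"
proof -
  let ?d = "Re (f z) / 2"
  obtain U where U: "open U" "0 \<in> U" "\<forall>x y. x - y \<in> U \<longrightarrow> dist (f x) (f y) < ?d"
    using uniform_continuity[OF assms(1), of ?d] assms(3) by auto
  obtain as where as: "as \<noteq> []" "\<And>x z. \<exists>a\<in>set as. x + a - z \<in> U"
    using finite_cover[OF U(1,2)] by metis
  let ?N = "real (length as)"
  have "?d / ?N \<le> Re (avg as f x)" for x
  proof -
    obtain a where a: "a \<in> set as" "x + a - z \<in> U" using as(2) by blast
    have "?d \<le> Re (f (x + a))"
      using U(3)[rule_format, OF a(2)] abs_Re_le_cmod[of "f (x + a) - f z"] by (simp add: dist_norm)
    also have "\<dots> \<le> (\<Sum>b\<leftarrow>as. Re (f (x + b)))"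
      unfolding sum_list_map_remove1[OF a(1)] using assms(2) by (auto intro!: sum_list_nonneg)
    finally have "?d / ?N \<le> avg as (\<lambda>x. Re (f x)) x"
      using as(1) by (simp add: avg_def field_simps)
    then show ?thesis by (simp only: avg_linear[OF bounded_linear_Re])
  qed
  then have "?d / ?N \<le> Re (mean f)"
    using Re_mean_ge[OF continuous_on_avg[OF assms(1)]] mean_avg[OF assms(1) as(1)] by metis
  moreover have "?d / ?N > 0" using assms(3) as(1) by simp
  ultimately show ?thesis by linarith
qed

lemma C_section:
  assumes "continuous_on UNIV (\<lambda>p. F (fst p) (snd p))"
  shows "C (F x)" "C (\<lambda>x. F x y)"
proof -
  have "continuous_on UNIV (\<lambda>y. (x, y))" "continuous_on UNIV (\<lambda>x. (x, y))"
    by (intro continuous_on_Pair continuous_on_const continuous_on_id)+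
  from this[THEN continuous_on_compose2[OF assms]] show "C (F x)" "C (\<lambda>x. F x y)" by simp_all
qed

lemma C_mean:
  assumes F: "continuous_on UNIV (\<lambda>p. F (fst p) (snd p))"
  shows "C (\<lambda>x. mean (F x))"
  unfolding continuous_on_def
proof (intro ballI tendstoI)
  fix x and e :: real assume e: "e > 0"
  obtain U where U: "open U" "x \<in> U" "\<forall>x'\<in>U. \<forall>y. dist (F x' y) (F x y) < e / 2"
    using joint_continuity[OF F, of "e / 2" x] e by auto
  have "dist (mean (F x')) (mean (F x)) < e" if that: "x' \<in> U" for x'
  proof -
    have "norm (mean (\<lambda>y. F x' y - F x y) - 0) \<le> e / 2"
    proof (intro mean_near_const continuous_intros C_section(1)[OF F])
      fix y
      show "norm (F x' y - F x y - 0) \<le> e / 2"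
        using less_imp_le[OF U(3)[rule_format, OF that, of y]] by (simp only: dist_norm diff_zero)
    qed
    then show ?thesis using e by (simp add: mean_diff C_section[OF F] dist_norm)
  qed
  then show "\<forall>\<^sub>F x' in at x within UNIV. dist (mean (F x')) (mean (F x)) < e"
    unfolding eventually_at_topological using U(1,2) by blast
qed

text \<open>By compactness finitely many sections approximate all sections within e/3, so one list
  averages every \<open>F x\<close> in y up to e. Inside that list the exchange is only that of a
  finite sum with a mean.\<close>

lemma mean_Fubini:
  assumes F: "continuous_on UNIV (\<lambda>p. F (fst p) (snd p))"
  shows "mean (\<lambda>x. mean (F x)) = mean (\<lambda>y. mean (\<lambda>x. F x y))"
proof -
  have F': "continuous_on UNIV (\<lambda>p. F (snd p) (fst p))"
    using continuous_on_compose2[OF F, of UNIV prod.swap] continuous_on_swap by (auto simp: prod.swap_def)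
  note CM = C_mean[OF F] and CN = C_mean[of "\<lambda>y x. F x y", OF F']
  have le: "norm (mean (\<lambda>y. mean (\<lambda>x. F x y)) - mean (\<lambda>x. mean (F x))) \<le> 0 + e" if e: "e > 0" for e
  proof -
    let ?d = "e / 3"
    have "\<forall>x. \<exists>U. open U \<and> x \<in> U \<and> (\<forall>x'\<in>U. \<forall>y. dist (F x' y) (F x y) < ?d)"
      using joint_continuity[OF F, of ?d] e by simp
    then obtain U where U: "\<And>x. open (U x)" "\<And>x. x \<in> U x"
      "\<And>x x' y. x' \<in> U x \<Longrightarrow> dist (F x' y) (F x y) < ?d" by metis
    have "UNIV \<subseteq> (\<Union>x\<in>UNIV. U x)" using U(2) by blast
    then obtain S where S: "finite S" "UNIV \<subseteq> (\<Union>x\<in>S. U x)"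
      using compactE_image[OF compact_univ, of UNIV U] U(1) by metis
    obtain as where as: "as \<noteq> []" "\<forall>f\<in>F ` S. \<forall>x. norm (avg as f x - mean f) \<le> ?d"
      using common_approx[of "F ` S" ?d] S(1) e C_section(1)[OF F] by auto
    have near: "norm (avg as (F x) y - mean (F x)) \<le> e" for x y
    proof -
      obtain s where s: "s \<in> S" "x \<in> U s" using S(2) by blast
      have d: "norm (F x y - F s y) \<le> ?d" for y using U(3)[OF s(2), of y] by (simp add: dist_norm)
      have "norm (avg as (\<lambda>y. F x y - F s y) y) \<le> ?d" by (rule norm_avg_le[OF as(1) d])
      moreover have "norm (mean (\<lambda>y. F x y - F s y) - 0) \<le> ?d"
        using d C_section(1)[OF F] by (intro mean_near_const continuous_intros) auto
      moreover have "norm (avg as (F s) y - mean (F s)) \<le> ?d" using as(2) s(1) by blast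
      ultimately have "norm (avg as (F x) y - avg as (F s) y) \<le> ?d" "norm (mean (F x) - mean (F s)) \<le> ?d"
        "norm (avg as (F s) y - mean (F s)) \<le> ?d"
        by (simp_all add: avg_diff mean_diff C_section[OF F])
      then show ?thesis
        using norm_triangle_ineq[of "avg as (F x) y - avg as (F s) y" "avg as (F s) y - mean (F s)"]
          norm_triangle_ineq4[of "avg as (F x) y - mean (F s)" "mean (F x) - mean (F s)"] by simp
    qed
    have "norm (avg as (\<lambda>y. mean (\<lambda>x. F x y)) y - mean (\<lambda>x. mean (F x))) \<le> e" for y
    proof -
      have *: "mean (\<lambda>x. \<Sum>a\<leftarrow>as. F x (y + a)) = (\<Sum>a\<leftarrow>as. mean (\<lambda>x. F x (y + a)))"
        "C (\<lambda>x. \<Sum>a\<leftarrow>as. F x (y + a))"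
        using mean_sum_list[of as "\<lambda>a x. F x (y + a)"] C_section(2)[OF F] by auto
      have "(\<lambda>x. avg as (F x) y) = (\<lambda>x. complex_of_real (inverse (real (length as))) * (\<Sum>a\<leftarrow>as. F x (y + a)))"
        by (simp add: avg_def scaleR_conv_of_real)
      then have eq: "mean (\<lambda>x. avg as (F x) y) = avg as (\<lambda>y. mean (\<lambda>x. F x y)) y"
        and c: "C (\<lambda>x. avg as (F x) y)"
        using * mean_cmult[OF *(2)] by (auto simp: avg_def scaleR_conv_of_real intro!: continuous_intros)
      have "norm (mean (\<lambda>x. avg as (F x) y - mean (F x)) - 0) \<le> e"
        using near c CM by (intro mean_near_const continuous_intros) auto
      then show ?thesis by (simp add: mean_diff[OF c CM] eq)
    qed
    then show ?thesis unfolding add_0 by (rule mean_near[OF CN as(1)])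
  qed
  have "norm (mean (\<lambda>y. mean (\<lambda>x. F x y)) - mean (\<lambda>x. mean (F x))) \<le> 0"
    by (rule field_le_epsilon) (rule le)
  then show ?thesis by simp
qed

end

section \<open>Characters of a compact abelian group\<close>

text \<open>
  The limit of \<open>s n / l ^ Suc n\<close> cannot vanish: log-convexity makes consecutive ratios of this sequence
  tend to 1, and submultiplicativity then forces each of its terms to be at least 1.
\<close>

lemma log_convex_limit:
  fixes s :: "nat \<Rightarrow> real"
  assumes pos: "\<And>n. s n > 0" and lc: "\<And>n. (s (Suc n))\<^sup>2 \<le> s n * s (Suc (Suc n))"
    and sm: "\<And>m n. s (Suc (m + n)) \<le> s m * s n"
  shows "\<exists>l>0. \<exists>u\<ge>1. (\<lambda>n. s n / l ^ Suc n) \<longlonglongrightarrow> u"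
proof -
  define r where "r n = s (Suc n) / s n" for n
  have "r n \<le> r (Suc n)" for n
    using lc[of n] pos[of n] pos[of "Suc n"] by (simp add: r_def field_simps power2_eq_square)
  then have inc: "incseq r" by (rule incseq_SucI)
  have "r n \<le> s 0" for n
    using sm[of n 0] pos[of n] by (simp add: r_def field_simps)
  then obtain l where l: "r \<longlonglongrightarrow> l" "\<And>n. r n \<le> l"
    using incseq_convergent[OF inc, of "s 0"] by metis
  have "r 0 > 0" using pos[of 0] pos[of 1] by (simp add: r_def)
  then have l0: "l > 0" using l(2)[of 0] by linarith
  define u where "u n = s n / l ^ Suc n" for n
  have upos: "u n > 0" for n using pos l0 by (simp add: u_def)
  have uSuc: "u (Suc n) = u n * (r n / l)" for n
    using pos[of n] l0 by (simp add: u_def r_def field_simps)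
  have "u (Suc n) \<le> u n" for n
    unfolding uSuc using upos[of n] l(2)[of n] l0 by (intro mult_left_le) auto
  then have dec: "decseq u" by (rule decseq_SucI)
  have ratio: "(\<lambda>n. u (n + j) / u n) \<longlonglongrightarrow> 1" for j
  proof (induction j)
    case 0
    have "u n / u n = 1" for n using upos[of n] by simp
    then show ?case by simp
  next
    case (Suc j)
    have "(\<lambda>n. u (n + j) / u n * (r (n + j) / l)) \<longlonglongrightarrow> 1 * (l / l)"
      using l0 by (intro tendsto_intros Suc LIMSEQ_ignore_initial_segment[OF l(1)]) auto
    then show ?case using l0 by (simp add: uSuc mult.commute)
  qed
  have u1: "1 \<le> u m" for m
  proof (rule LIMSEQ_le_const2[OF ratio[of "Suc m"]])
    have "u (n + Suc m) / u n \<le> u m" for n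
    proof -
      have "s (n + Suc m) \<le> s m * s n" using sm[of n m] by (simp add: mult.commute)
      then have "s (n + Suc m) / l ^ (Suc n + Suc m) \<le> s m * s n / (l ^ Suc n * l ^ Suc m)"
        using l0 by (simp only: power_add) (intro divide_right_mono, simp_all)
      then have "u (n + Suc m) \<le> u m * u n"
        by (simp add: u_def mult.commute)
      then show ?thesis using upos[of n] by (simp add: field_simps)
    qed
    then show "\<exists>N. \<forall>n\<ge>N. u (n + Suc m) / u n \<le> u m" by blast
  qed
  obtain v where v: "u \<longlonglongrightarrow> v" using decseq_convergent[OF dec, of 1] u1 by metis
  have "v \<ge> 1" by (rule LIMSEQ_le_const[OF v]) (use u1 in blast)
  with v[unfolded u_def[abs_def]] l0 show ?thesis by blast
qed

section \<open>Convolution and the inner product\<close>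

context compact_abelian_group
begin

definition conv :: "('a \<Rightarrow> complex) \<Rightarrow> ('a \<Rightarrow> complex) \<Rightarrow> 'a \<Rightarrow> complex" where
  "conv f g x = mean (\<lambda>y. f y * g (x - y))"

definition adj :: "('a \<Rightarrow> complex) \<Rightarrow> 'a \<Rightarrow> complex" where
  "adj f x = cnj (f (- x))"

definition inn :: "('a \<Rightarrow> complex) \<Rightarrow> ('a \<Rightarrow> complex) \<Rightarrow> complex" where
  "inn f g = mean (\<lambda>y. f y * cnj (g y))"

text \<open>The square of the L2-norm.\<close>

definition N2 :: "('a \<Rightarrow> complex) \<Rightarrow> real" where
  "N2 f = Re (inn f f)"

lemma C_compose2:
  assumes "C f" "continuous_on UNIV h"
  shows "continuous_on UNIV (\<lambda>p. f (h p))"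
  by (rule continuous_on_compose2[OF assms]) simp

lemma C_conv:
  assumes "C f" "C g"
  shows "C (conv f g)"
  unfolding conv_def[abs_def]
  by (rule C_mean[where F = "\<lambda>x y. f y * g (x - y)"])
    (intro continuous_on_mult assms[THEN C_compose2] continuous_on_diff continuous_on_fst
      continuous_on_snd continuous_on_id)

lemma C_integrand: "C f \<Longrightarrow> C g \<Longrightarrow> C (\<lambda>y. f y * g (x - y))"
  by (intro continuous_intros C_shift)

lemma C_adj: "C f \<Longrightarrow> C (adj f)"
  unfolding adj_def[abs_def] by (intro continuous_intros C_shift)

lemma adj_adj [simp]: "adj (adj f) = f"
  by (simp add: adj_def fun_eq_iff)

lemma conv_commute:
  assumes "C f" "C g"
  shows "conv f g = conv g f"
proof
  fix x
  show "conv f g x = conv g f x"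
    using mean_reflect_shift[OF C_integrand[OF assms, of x], of x]
    by (simp add: conv_def mult.commute)
qed

lemma conv_assoc:
  assumes f: "C f" and g: "C g" and h: "C h"
  shows "conv (conv f g) h = conv f (conv g h)"
proof
  fix x
  let ?F = "\<lambda>z y. f y * g (z - y) * h (x - z)"
  have "continuous_on UNIV (\<lambda>p. ?F (fst p) (snd p))"
    by (intro continuous_intros C_compose2[OF f] C_compose2[OF g] C_compose2[OF h])
  then have "mean (\<lambda>z. mean (?F z)) = mean (\<lambda>y. mean (\<lambda>z. ?F z y))" by (rule mean_Fubini)
  moreover have "mean (?F z) = conv f g z * h (x - z)" for z
    using mean_cmult[OF C_integrand[OF f g, of z], of "h (x - z)"] by (simp add: conv_def mult.commute)
  moreover have "mean (\<lambda>z. ?F z y) = f y * conv g h (x - y)" for y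
  proof -
    have c: "C (\<lambda>z. g (z - y) * h (x - z))" by (intro continuous_intros C_shift g h)
    have "mean (\<lambda>z. ?F z y) = f y * mean (\<lambda>z. g (z - y) * h (x - z))"
      using mean_cmult[OF c, of "f y"] by (simp add: mult.assoc)
    also have "mean (\<lambda>z. g (z - y) * h (x - z)) = conv g h (x - y)"
      using mean_shift[OF C_integrand[OF g h, of "x - y"], of "- y"] by (simp add: conv_def)
    finally show ?thesis .
  qed
  ultimately show "conv (conv f g) h x = conv f (conv g h) x" by (simp add: conv_def[of "conv f g"] conv_def[of f "conv g h"])
qed

lemma conv_add:
  assumes "C f" "C g" "C h"
  shows "conv (\<lambda>x. f x + g x) h = (\<lambda>x. conv f h x + conv g h x)"
  using mean_add[OF C_integrand[OF assms(1,3)] C_integrand[OF assms(2,3)]]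
  by (simp add: conv_def fun_eq_iff distrib_right)

lemma conv_diff:
  assumes "C f" "C g" "C h"
  shows "conv (\<lambda>x. f x - g x) h = (\<lambda>x. conv f h x - conv g h x)"
  using mean_diff[OF C_integrand[OF assms(1,3)] C_integrand[OF assms(2,3)]]
  by (simp add: conv_def fun_eq_iff left_diff_distrib)

lemma conv_cmult:
  assumes "C f" "C h"
  shows "conv (\<lambda>x. c * f x) h = (\<lambda>x. c * conv f h x)"
  using mean_cmult[OF C_integrand[OF assms], of c]
  by (simp add: conv_def fun_eq_iff mult.assoc)

lemma conv_shift:
  assumes "C f" "C g"
  shows "conv (\<lambda>x. f (x + a)) g = (\<lambda>x. conv f g (x + a))"
proof
  fix x
  show "conv (\<lambda>x. f (x + a)) g x = conv f g (x + a)"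
    using mean_shift[OF C_integrand[OF assms, of "x + a"], of a] by (simp add: conv_def algebra_simps)
qed

lemma adj_conv:
  assumes "C f" "C g"
  shows "adj (conv f g) = conv (adj f) (adj g)"
proof
  fix x
  have c: "C (\<lambda>y. cnj (f y) * cnj (g (- x - y)))"
    using assms by (intro continuous_intros C_shift)
  have "adj (conv f g) x = mean (\<lambda>y. cnj (f y) * cnj (g (- x - y)))"
    using mean_cnj[OF C_integrand[OF assms, of "- x"]] by (simp add: adj_def conv_def)
  also have "\<dots> = conv (adj f) (adj g) x"
    using mean_reflect[OF c] by (simp add: conv_def adj_def)
  finally show "adj (conv f g) x = conv (adj f) (adj g) x" .
qed

lemma C_inn: "C f \<Longrightarrow> C g \<Longrightarrow> C (\<lambda>y. f y * cnj (g y))"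
  by (intro continuous_intros)

lemma inn_diff_left: "C f \<Longrightarrow> C g \<Longrightarrow> C h \<Longrightarrow> inn (\<lambda>x. f x - g x) h = inn f h - inn g h"
  using mean_diff[OF C_inn C_inn, of f h g h] by (simp add: inn_def left_diff_distrib)

lemma inn_commute: "C f \<Longrightarrow> C g \<Longrightarrow> inn g f = cnj (inn f g)"
  using mean_cnj[OF C_inn, of f g] by (simp add: inn_def mult.commute)

lemma inn_diff_right: "C f \<Longrightarrow> C g \<Longrightarrow> C h \<Longrightarrow> inn h (\<lambda>x. f x - g x) = inn h f - inn h g"
  using mean_diff[OF C_inn C_inn, of h f h g] by (simp add: inn_def right_diff_distrib)

lemma inn_cmult_left: "C f \<Longrightarrow> C h \<Longrightarrow> inn (\<lambda>x. c * f x) h = c * inn f h"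
  using mean_cmult[OF C_inn, of f h c] by (simp add: inn_def mult.assoc)

lemma inn_cmult_right: "C f \<Longrightarrow> C h \<Longrightarrow> inn h (\<lambda>x. c * f x) = cnj c * inn h f"
  using mean_cmult[OF C_inn, of h f "cnj c"] by (simp add: inn_def mult_ac)

lemma inn_self: "C f \<Longrightarrow> inn f f = complex_of_real (N2 f)"
  using inn_commute[of f f] unfolding N2_def by (metis Reals_cnj_iff of_real_Re)

lemma Re_mult_cnj: "Re (z * cnj z) = (norm z)\<^sup>2"
  by (metis Re_complex_of_real complex_norm_square)

lemma N2_nonneg: "C f \<Longrightarrow> N2 f \<ge> 0"
  unfolding N2_def inn_def by (rule Re_mean_ge[OF C_inn]) (simp_all only: Re_mult_cnj zero_le_power2)

lemma N2_pos: "C f \<Longrightarrow> f z \<noteq> 0 \<Longrightarrow> N2 f > 0"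
  unfolding N2_def inn_def
  by (rule Re_mean_pos[OF C_inn, of _ _ z]) (simp_all only: Re_mult_cnj zero_le_power2 zero_less_power2 norm_eq_zero not_False_eq_True)

lemma N2_diff:
  assumes "C f" "C g"
  shows "N2 (\<lambda>x. f x - g x) = N2 f - 2 * Re (inn f g) + N2 g"
proof -
  have c: "C (\<lambda>x. f x - g x)" using assms by (intro continuous_intros)
  have "inn (\<lambda>x. f x - g x) (\<lambda>x. f x - g x) = inn f f - inn f g - (inn g f - inn g g)"
    by (simp add: inn_diff_left[OF assms c] inn_diff_right[OF assms] assms)
  then show ?thesis using inn_commute[OF assms] by (simp add: N2_def)
qed

lemma Cauchy_Schwarz:
  assumes f: "C f" and g: "C g"
  shows "norm (inn f g) \<le> sqrt (N2 f) * sqrt (N2 g)"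
proof (cases "\<exists>z. g z \<noteq> 0")
  case False
  then show ?thesis by (simp add: inn_def N2_nonneg f g)
next
  case True
  then have n: "N2 g > 0" using N2_pos[OF g] by blast
  define c where "c = inn f g / complex_of_real (N2 g)"
  have cg: "C (\<lambda>x. c * g x)" using g by (intro continuous_intros)
  have "0 \<le> N2 (\<lambda>x. f x - c * g x)"
    by (intro N2_nonneg continuous_on_diff f cg)
  also have "\<dots> = N2 f - 2 * Re (cnj c * inn f g) + Re (c * (cnj c * complex_of_real (N2 g)))"
    unfolding N2_diff[OF f cg] N2_def[of "\<lambda>x. c * g x"] inn_cmult_left[OF g cg] inn_cmult_right[OF g g]
      inn_cmult_right[OF g f] inn_self[OF g] ..
  also have "c * (cnj c * complex_of_real (N2 g)) = cnj c * inn f g"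
    using n by (simp add: c_def)
  also have "cnj c * inn f g = complex_of_real ((norm (inn f g))\<^sup>2 / N2 g)"
    using complex_norm_square[of "inn f g"] by (simp add: c_def mult.commute)
  finally have "(norm (inn f g))\<^sup>2 \<le> N2 f * N2 g" using n by (simp add: field_simps)
  then show ?thesis by (simp add: real_le_rsqrt flip: real_sqrt_mult)
qed

text \<open>Cauchy-Schwarz against the reflected translate of \<open>g\<close>, which has the same
  L2-norm. This is the passage from mean-square to uniform estimates.\<close>

lemma norm_conv_le:
  assumes f: "C f" and g: "C g"
  shows "norm (conv f g x) \<le> sqrt (N2 f) * sqrt (N2 g)"
proof -
  let ?h = "\<lambda>y. cnj (g (x - y))"
  have h: "C ?h" using g by (intro continuous_intros C_shift)
  have "conv f g x = inn f ?h" by (simp add: conv_def inn_def)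
  moreover have "inn ?h ?h = inn g g"
    using mean_reflect_shift[OF C_inn[OF g g], of x] by (simp add: inn_def mult.commute)
  then have "N2 ?h = N2 g" by (simp add: N2_def)
  ultimately show ?thesis using Cauchy_Schwarz[OF f h] by simp
qed

lemma conv_0_eq_inn: "adj g = g \<Longrightarrow> conv f g 0 = inn f g"
proof -
  assume "adj g = g"
  then have "g (- y) = cnj (g y)" for y by (metis adj_def add.inverse_inverse)
  then show ?thesis by (simp add: conv_def inn_def)
qed

lemma norm_inn_le:
  assumes "C f" "C g" "\<And>x. norm (f x) \<le> A" "\<And>x. norm (g x) \<le> B"
  shows "norm (inn f g) \<le> A * B"
proof -
  have "0 \<le> A" using assms(3)[of 0] norm_ge_zero order_trans by blast
  then have "norm (f x * cnj (g x) - 0) \<le> A * B" for x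
    using assms(3,4) by (simp add: norm_mult mult_mono)
  from mean_near_const[OF C_inn[OF assms(1,2)] this] show ?thesis by (simp add: inn_def)
qed

lemma conv_uniform_limit:
  assumes f: "C f" and p: "\<And>n. C (p n)" and lim: "uniform_limit UNIV p e sequentially" and e: "C e"
  shows "(\<lambda>n. conv f (p n) x) \<longlonglongrightarrow> conv f e x"
proof (rule LIMSEQ_I)
  fix d :: real assume d: "d > 0"
  have "bounded (range f)" using compact_continuous_image[OF f compact_univ] by (rule compact_imp_bounded)
  then obtain B where B: "B > 0" "\<And>x. norm (f x) \<le> B" unfolding bounded_pos by auto
  obtain N where N: "\<forall>n\<ge>N. \<forall>x\<in>UNIV. dist (p n x) (e x) < d / (2 * B)"
    using uniform_limitD[OF lim, of "d / (2 * B)"] d B(1) unfolding eventually_sequentially by auto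
  have "norm (conv f (p n) x - conv f e x) < d" if "n \<ge> N" for n
  proof -
    have "norm (f y * p n (x - y) - f y * e (x - y) - 0) \<le> d / 2" for y
    proof -
      have "norm (f y) * norm (p n (x - y) - e (x - y)) \<le> B * (d / (2 * B))"
        using N[rule_format, OF that, of "x - y"] B by (intro mult_mono) (auto simp: dist_norm)
      then show ?thesis using B(1) by (simp add: norm_mult flip: right_diff_distrib)
    qed
    then have "norm (mean (\<lambda>y. f y * p n (x - y) - f y * e (x - y)) - 0) \<le> d / 2"
      by (intro mean_near_const continuous_on_diff C_integrand f p e)
    then show ?thesis using d by (simp add: conv_def mean_diff C_integrand f p e)
  qed
  then show "\<exists>N. \<forall>n\<ge>N. norm (conv f (p n) x - conv f e x) < d" by blast
qed

end

lemma Hausdorff_space_euclidean_t2: "Hausdorff_space (euclidean :: 'b::t2_space topology)"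
  using hausdorff by (fastforce simp: Hausdorff_space_def disjnt_def)

section \<open>Hermitian idempotents and the characters they carry\<close>

context compact_abelian_group
begin

text \<open>In terms of Fourier analysis \<open>e\<close> is a non-empty finite sum of distinct
  characters, and \<open>N2 e\<close> is their number.\<close>

definition herm_idem :: "('a \<Rightarrow> complex) \<Rightarrow> bool" where
  "herm_idem e \<longleftrightarrow> C e \<and> adj e = e \<and> conv e e = e \<and> (\<exists>z. e z \<noteq> 0)"

lemma norm_conv_herm_le:
  assumes "C f"
  shows "norm (conv f f x) \<le> N2 f"
  using norm_conv_le[OF assms assms, of x] N2_nonneg[OF assms] by simp

text \<open>
  Here \<open>q n\<close> is the power \<open>k\<^sup>n\<^sup>+\<^sup>1\<close>, and \<open>q (2 n + 1)\<close>, rescaled to \<open>p n\<close>, converges in mean square. Convolving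
  once more with \<open>k * k\<close> turns this into uniform convergence.
\<close>

lemma power_iteration:
  assumes k: "C k" "adj k = k" and z: "k z \<noteq> 0"
  shows "\<exists>e l. herm_idem e \<and> l > 0 \<and> conv (conv k k) e = (\<lambda>x. complex_of_real l * e x) \<and>
    (\<forall>f. C f \<longrightarrow> conv k f = k \<longrightarrow> conv e f = e)"
proof -
  define q where "q n = (conv k ^^ n) k" for n
  have q0: "q 0 = k" and qS: "q (Suc n) = conv k (q n)" for n by (simp_all add: q_def)
  have Cq: "C (q n)" for n by (induction n) (simp_all add: q0 qS k C_conv)
  have adjq: "adj (q n) = q n" for n by (induction n) (simp_all add: q0 qS k adj_conv Cq)
  have convq: "conv (q m) (q n) = q (Suc (m + n))" for m n
    by (induction m) (simp_all add: q0 qS conv_assoc k Cq)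
  define s where "s n = N2 (q n)" for n
  have q_at_0: "q (Suc (m + n)) 0 = inn (q m) (q n)" for m n
    using conv_0_eq_inn[OF adjq[of n], of "q m"] by (simp add: convq)
  have qs: "q (Suc (n + n)) 0 = complex_of_real (s n)" for n
    by (simp add: q_at_0 inn_self Cq s_def)
  have sup: "norm (q (Suc (n + n)) x) \<le> s n" for n x
    using norm_conv_herm_le[OF Cq[of n], of x] by (simp add: convq s_def)
  have s_nonneg: "s n \<ge> 0" for n unfolding s_def by (rule N2_nonneg[OF Cq])
  \<comment> \<open>Cauchy-Schwarz for s (n + 1) = <q n, q (n + 2)>: both sides are the value of the
    same power of \<open>k\<close> at 0.\<close>
  have lc: "(s (Suc n))\<^sup>2 \<le> s n * s (Suc (Suc n))" for n
  proof -
    have "complex_of_real (s (Suc n)) = inn (q n) (q (Suc (Suc n)))"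
      using qs[of "Suc n"] q_at_0[of n "Suc (Suc n)"] by simp
    then have "s (Suc n) \<le> sqrt (s n) * sqrt (s (Suc (Suc n)))"
      using Cauchy_Schwarz[OF Cq[of n] Cq[of "Suc (Suc n)"]] s_nonneg[of "Suc n"]
      by (simp add: s_def[symmetric]) (metis abs_of_nonneg norm_of_real)
    then have "(s (Suc n))\<^sup>2 \<le> (sqrt (s n) * sqrt (s (Suc (Suc n))))\<^sup>2"
      using s_nonneg by (intro power_mono) auto
    then show ?thesis using s_nonneg by (simp add: power_mult_distrib)
  qed
  \<comment> \<open>s (m + n + 1) is the inner product of the powers with indices 2 m + 1 and 2 n +
    1, whose sup norms are at most s m and s n.\<close>
  have sm: "s (Suc (m + n)) \<le> s m * s n" for m n
  proof -
    have "Suc (Suc (m + n) + Suc (m + n)) = Suc (Suc (m + m) + Suc (n + n))" by simp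
    then have "complex_of_real (s (Suc (m + n))) = inn (q (Suc (m + m))) (q (Suc (n + n)))"
      by (metis qs q_at_0)
    moreover have "norm (inn (q (Suc (m + m))) (q (Suc (n + n)))) \<le> s m * s n"
      by (rule norm_inn_le[OF Cq Cq sup sup])
    ultimately show ?thesis by (metis abs_le_D1 norm_of_real)
  qed
  have pos: "s n > 0 \<and> s (Suc n) > 0" for n
  proof (induction n)
    case 0
    have s0: "s 0 > 0" unfolding s_def q0 by (rule N2_pos[OF k(1) z])
    then have "q (Suc 0) 0 \<noteq> 0" using qs[of 0] by simp
    then have "s (Suc 0) > 0" unfolding s_def by (rule N2_pos[OF Cq])
    then show ?case using s0 by simp
  next
    case (Suc n)
    then have "0 < s n * s (Suc (Suc n))" using lc[of n] by (meson less_le_trans zero_less_power)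
    then show ?case using Suc by (simp add: zero_less_mult_iff)
  qed
  obtain l u where l: "l > 0" and u: "u \<ge> 1" "(\<lambda>n. s n / l ^ Suc n) \<longlonglongrightarrow> u"
    using log_convex_limit[of s] pos lc sm by blast
  define v where "v n = s n / l ^ Suc n" for n
  have v: "v \<longlonglongrightarrow> u" using u(2) by (simp add: v_def[abs_def])
  define c where "c n = complex_of_real (inverse (l ^ Suc n))" for n
  define p where "p n = (\<lambda>x. c n * q (Suc (n + n)) x)" for n
  have Cp: "C (p n)" for n unfolding p_def by (intro continuous_intros Cq)
  have convp: "conv (p m) (p n) = p (Suc (m + n))" for m n
  proof -
    have "conv (p m) (p n) = (\<lambda>x. c m * conv (q (Suc (m + m))) (p n) x)"
      unfolding p_def[of m] by (rule conv_cmult[OF Cq Cp])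
    also have "conv (q (Suc (m + m))) (p n) = conv (p n) (q (Suc (m + m)))"
      by (rule conv_commute[OF Cq Cp])
    also have "\<dots> = (\<lambda>x. c n * conv (q (Suc (n + n))) (q (Suc (m + m))) x)"
      unfolding p_def[of n] by (rule conv_cmult[OF Cq Cq])
    also have "conv (q (Suc (n + n))) (q (Suc (m + m))) = q (Suc (Suc (m + n) + Suc (m + n)))"
      unfolding convq by (rule arg_cong[of _ _ q]) simp
    finally show ?thesis
      by (simp add: p_def c_def fun_eq_iff power_add)
  qed
  have adjp: "adj (p n) = p n" for n
    using adjq[of "Suc (n + n)"] by (simp add: p_def c_def adj_def fun_eq_iff)
  have p0: "p n 0 = complex_of_real (v n)" for n
    by (simp add: p_def c_def qs v_def field_simps)
  have innp: "inn (p m) (p n) = complex_of_real (v (Suc (m + n)))" for m n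
    using conv_0_eq_inn[OF adjp[of n], of "p m"] by (simp add: convp p0)
  have N2p: "N2 (\<lambda>x. p m x - p n x) = v (Suc (m + m)) - 2 * v (Suc (m + n)) + v (Suc (n + n))" for m n
    by (simp add: N2_diff Cp innp N2_def[of "p _"])
  let ?K = "conv k k"
  have K: "?K = q 1" by (simp add: q0 qS)
  have CK: "C ?K" unfolding K by (rule Cq)
  have convK: "conv ?K (p n) = (\<lambda>x. complex_of_real l * p (Suc n) x)" for n
  proof -
    have "conv ?K (p n) = conv (p n) ?K" by (rule conv_commute[OF CK Cp])
    also have "\<dots> = (\<lambda>x. c n * conv (q (Suc (n + n))) ?K x)"
      unfolding p_def[of n] by (rule conv_cmult[OF Cq CK])
    also have "conv (q (Suc (n + n))) ?K = q (Suc (Suc n + Suc n))"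
      unfolding K convq by (rule arg_cong[of _ _ q]) simp
    finally show ?thesis using l by (simp add: p_def c_def fun_eq_iff)
  qed
  define B where "B = sqrt (N2 ?K) / l"
  have step: "norm (p (Suc m) x - p (Suc n) x) \<le> B * sqrt (N2 (\<lambda>x. p m x - p n x))" for m n x
  proof -
    have Cd: "C (\<lambda>x. p m x - p n x)" by (intro continuous_on_diff Cp)
    have "conv ?K (\<lambda>x. p m x - p n x) x = conv (\<lambda>x. p m x - p n x) ?K x"
      by (simp only: conv_commute[OF CK Cd])
    also have "\<dots> = conv ?K (p m) x - conv ?K (p n) x"
      by (simp only: conv_diff[OF Cp Cp CK] conv_commute[OF CK Cp])
    also have "\<dots> = complex_of_real l * (p (Suc m) x - p (Suc n) x)"
      by (simp add: convK algebra_simps)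
    finally have "l * norm (p (Suc m) x - p (Suc n) x) \<le> sqrt (N2 ?K) * sqrt (N2 (\<lambda>x. p m x - p n x))"
      using norm_conv_le[OF CK Cd, of x] l by (simp add: norm_mult)
    then show ?thesis using l by (simp add: B_def field_simps)
  qed
  have B0: "B \<ge> 0" using l N2_nonneg[OF CK] by (simp add: B_def)
  have "uniformly_Cauchy_on UNIV p"
    unfolding uniformly_Cauchy_on_def
  proof (intro allI impI)
    fix d :: real assume d: "d > 0"
    \<comment> \<open>The formula \<open>N2p\<close> has coefficients 1, -2, 1, so three values
      within h of their limit give less than 4 h. The denominator is B + 1 because B may be
      0.\<close>
    let ?h = "(d / (B + 1))\<^sup>2 / 4"
    have h: "?h > 0" using d B0 by simp
    obtain N where N: "\<forall>n\<ge>N. norm (v n - u) < ?h" using LIMSEQ_D[OF v h] by blast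
    have "dist (p m x) (p n x) < d" if mn: "m \<ge> Suc N" "n \<ge> Suc N" for m n x
    proof -
      obtain m' n' where m': "m = Suc m'" "n = Suc n'" "m' \<ge> N" "n' \<ge> N"
        using mn by (metis Suc_le_D Suc_le_mono)
      have "\<bar>v (Suc (m' + m')) - u\<bar> < ?h" "\<bar>v (Suc (m' + n')) - u\<bar> < ?h" "\<bar>v (Suc (n' + n')) - u\<bar> < ?h"
        using N m'(3,4) by simp_all
      then have "N2 (\<lambda>x. p m' x - p n' x) < (d / (B + 1))\<^sup>2"
        unfolding N2p by linarith
      then have "sqrt (N2 (\<lambda>x. p m' x - p n' x)) < d / (B + 1)"
        using d B0 by (intro real_less_lsqrt) (auto intro!: N2_nonneg continuous_on_diff Cp)
      then have "B * sqrt (N2 (\<lambda>x. p m' x - p n' x)) \<le> B * (d / (B + 1))"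
        using B0 by (intro mult_left_mono) auto
      also have "\<dots> < d" using B0 d by (simp add: field_simps)
      finally show ?thesis using step[of m' x n'] m'(1,2) by (simp add: dist_norm)
    qed
    then show "\<exists>M. \<forall>x\<in>UNIV. \<forall>m\<ge>M. \<forall>n\<ge>M. dist (p m x) (p n x) < d" by blast
  qed
  then obtain e where lim: "uniform_limit UNIV p e sequentially"
    using Cauchy_uniformly_convergent uniformly_convergent_on_def by blast
  have Ce: "C e"
    by (rule uniform_limit_theorem[OF _ lim]) (simp_all add: Cp)
  have pt: "(\<lambda>n. p n x) \<longlonglongrightarrow> e x" for x by (rule tendsto_uniform_limitI[OF lim]) simp
  note cl = conv_uniform_limit[OF _ Cp lim Ce]
  have adje: "adj e = e"
  proof
    fix x
    have "(\<lambda>n. adj (p n) x) \<longlonglongrightarrow> adj e x" unfolding adj_def by (intro tendsto_intros pt)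
    then show "adj e x = e x" using pt[of x] by (simp add: adjp LIMSEQ_unique)
  qed
  have pe: "conv (p n) e = e" for n
  proof
    fix x
    have "(\<lambda>m. p (m + Suc n) x) \<longlonglongrightarrow> conv (p n) e x"
      using cl[OF Cp[of n], of x] by (simp add: convp add.commute)
    then show "conv (p n) e x = e x" using LIMSEQ_ignore_initial_segment[OF pt] LIMSEQ_unique by blast
  qed
  have ee: "conv e e = e"
  proof
    fix x
    have "(\<lambda>n. e x) \<longlonglongrightarrow> conv e e x"
      using cl[OF Ce, of x] by (simp add: conv_commute[OF Ce Cp] pe)
    then show "conv e e x = e x" by (simp add: LIMSEQ_const_iff)
  qed
  \<comment> \<open>Since u is at least 1, the limit is not the zero function.\<close>
  have e0: "e 0 = complex_of_real u"
    using pt[of 0] tendsto_of_real[OF v, where 'a = complex] by (simp add: p0 LIMSEQ_unique)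
  have Ke: "conv ?K e = (\<lambda>x. complex_of_real l * e x)"
  proof
    fix x
    have "(\<lambda>n. complex_of_real l * p (Suc n) x) \<longlonglongrightarrow> conv ?K e x"
      using cl[OF CK, of x] by (simp add: convK)
    moreover have "(\<lambda>n. complex_of_real l * p (Suc n) x) \<longlonglongrightarrow> complex_of_real l * e x"
      by (intro tendsto_intros LIMSEQ_Suc pt)
    ultimately show "conv ?K e x = complex_of_real l * e x" by (rule LIMSEQ_unique)
  qed
  have ef: "conv e f = e" if f: "C f" "conv k f = k" for f
  proof
    fix x
    have "conv (q n) f = q n" for n
      by (induction n) (simp_all add: q0 qS f conv_assoc k Cq)
    then have "conv (p n) f = p n" for n
      unfolding p_def by (simp add: conv_cmult[OF Cq f(1)])
    then have "(\<lambda>n. p n x) \<longlonglongrightarrow> conv e f x"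
      using cl[OF f(1), of x] by (simp add: conv_commute[OF f(1) Cp] conv_commute[OF f(1) Ce])
    then show "conv e f x = e x" using pt LIMSEQ_unique by blast
  qed
  have "herm_idem e"
    unfolding herm_idem_def using Ce adje ee e0 u(1) by (intro conjI exI[of _ 0]) auto
  then show ?thesis using l Ke ef by blast
qed

text \<open>From e = e * e the sup norm of \<open>e\<close> is at most \<open>N2 e\<close>, hence N2
  e \<le> (N2 e)^2; as \<open>N2 e\<close> is positive, it cannot be below 1.\<close>

lemma herm_idem_0:
  assumes "herm_idem e"
  shows "e 0 = complex_of_real (N2 e)" "N2 e \<ge> 1"
proof -
  have e: "C e" "adj e = e" "conv e e = e" and "\<exists>z. e z \<noteq> 0" using assms by (auto simp: herm_idem_def)
  then obtain z where "e z \<noteq> 0" by blast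
  then have pos: "N2 e > 0" by (rule N2_pos[OF e(1)])
  show "e 0 = complex_of_real (N2 e)"
    using conv_0_eq_inn[OF e(2), of e] by (simp add: e(3) inn_self[OF e(1)])
  have le: "norm (e x) \<le> N2 e" for x using norm_conv_herm_le[OF e(1), of x] by (simp add: e(3))
  have "norm (inn e e) \<le> N2 e * N2 e" by (rule norm_inn_le[OF e(1) e(1) le le])
  then show "N2 e \<ge> 1" using pos by (simp add: inn_self[OF e(1)])
qed

text \<open>For a strictly smaller e' the difference e - e' is again an idempotent, so
  \<open>N2\<close> drops by at least 1; an \<open>e\<close> within 1 of the infimum is therefore
  minimal. The equation with \<open>K\<close> passes down to e' and later ensures that the character
  found is not annihilated by \<open>K\<close>.\<close>

lemma minimal_herm_idem:
  assumes e: "herm_idem e" and K: "C K" "conv K e = (\<lambda>x. l * e x)"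
  shows "\<exists>e. herm_idem e \<and> conv K e = (\<lambda>x. l * e x) \<and> (\<forall>e'. herm_idem e' \<longrightarrow> conv e' e = e' \<longrightarrow> e' = e)"
proof -
  let ?E = "{e. herm_idem e \<and> conv K e = (\<lambda>x. l * e x)}"
  have bdd: "bdd_below (N2 ` ?E)" by (rule bdd_belowI[of _ 1]) (use herm_idem_0(2) in auto)
  have ne: "N2 ` ?E \<noteq> {}" using e K(2) by blast
  obtain e where e: "herm_idem e" "conv K e = (\<lambda>x. l * e x)" "N2 e < Inf (N2 ` ?E) + 1"
    using cInf_lessD[OF ne, of "Inf (N2 ` ?E) + 1"] by auto
  have Ce: "C e" and ae: "adj e = e" and ie: "conv e e = e" using e(1) by (auto simp: herm_idem_def)
  have "e' = e" if e': "herm_idem e'" "conv e' e = e'" for e'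
  proof (rule ccontr)
    assume "e' \<noteq> e"
    then obtain z where z: "e z - e' z \<noteq> 0" by (metis right_minus_eq ext)
    have Ce': "C e'" and ae': "adj e' = e'" and ie': "conv e' e' = e'" using e'(1) by (auto simp: herm_idem_def)
    let ?d = "\<lambda>x. e x - e' x"
    have Cd: "C ?d" by (intro continuous_on_diff Ce Ce')
    have de: "conv ?d e = ?d" by (simp add: conv_diff Ce Ce' ie e'(2))
    have de': "conv ?d e' = (\<lambda>x. 0)"
      by (simp add: conv_diff Ce Ce' ie' conv_commute[OF Ce Ce'] e'(2))
    have "conv ?d ?d = (\<lambda>x. conv e ?d x - conv e' ?d x)" by (rule conv_diff[OF Ce Ce' Cd])
    also have "\<dots> = ?d" by (simp add: conv_commute[OF _ Cd] Ce Ce' de de')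
    finally have "conv ?d ?d = ?d" .
    moreover have "adj ?d = ?d"
      using ae ae' by (simp add: adj_def fun_eq_iff)
    ultimately have d: "herm_idem ?d" using Cd z by (auto simp: herm_idem_def)
    have "complex_of_real (N2 ?d) = complex_of_real (N2 e - N2 e')"
      using herm_idem_0(1)[OF d] herm_idem_0(1)[OF e(1)] herm_idem_0(1)[OF e'(1)] by simp
    then have "N2 ?d = N2 e - N2 e'" by (simp only: of_real_eq_iff)
    then have "N2 e' \<le> N2 e - 1" using herm_idem_0(2)[OF d] by simp
    moreover have "conv K e' = (\<lambda>x. l * e' x)"
    proof -
      have "conv K e' = conv K (conv e e')" by (simp add: conv_commute[OF Ce Ce'] e'(2))
      also have "\<dots> = conv (conv K e) e'" by (rule conv_assoc[OF K(1) Ce Ce', symmetric])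
      also have "\<dots> = (\<lambda>x. l * conv e e' x)" unfolding e(2) by (rule conv_cmult[OF Ce Ce'])
      also have "\<dots> = (\<lambda>x. l * e' x)" by (simp add: conv_commute[OF Ce Ce'] e'(2))
      finally show ?thesis .
    qed
    then have "Inf (N2 ` ?E) \<le> N2 e'" using e'(1) by (intro cInf_lower bdd) auto
    ultimately show False using e(3) by linarith
  qed
  then show ?thesis using e(1,2) by blast
qed

text \<open>
  Power iteration on \<open>k\<close> and minimality show that \<open>k * k\<close> is a positive multiple of \<open>e\<close>. After rescaling,
  \<open>(e + k) / 2\<close> is an idempotent below \<open>e\<close>, hence equal to \<open>e\<close> or 0.
\<close>

lemma minimal_scalar:
  assumes e: "herm_idem e" and min: "\<And>e'. herm_idem e' \<Longrightarrow> conv e' e = e' \<Longrightarrow> e' = e"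
    and k: "C k" "adj k = k" "conv k e = k"
  shows "\<exists>r::real. k = (\<lambda>x. complex_of_real r * e x)"
proof (cases "\<exists>z. k z \<noteq> 0")
  case False
  then show ?thesis by (intro exI[of _ 0]) auto
next
  case True
  have Ce: "C e" and ae: "adj e = e" and ie: "conv e e = e" using e by (auto simp: herm_idem_def)
  obtain e' l where e': "herm_idem e'" "l > 0" "conv (conv k k) e' = (\<lambda>x. complex_of_real l * e' x)"
    "\<forall>f. C f \<longrightarrow> conv k f = k \<longrightarrow> conv e' f = e'"
    using power_iteration[OF k(1,2)] True by blast
  have "e' = e" using e'(4) k(3) Ce by (intro min e'(1)) blast
  then have kk: "conv k k = (\<lambda>x. complex_of_real l * e x)"
    using e'(3) by (simp add: conv_assoc k Ce)
  \<comment> \<open>Scaled so that b = c k satisfies b * b = e, a square root of the unit in the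
    algebra of kernels fixed by \<open>e\<close>; then (e + b) / 2 is an idempotent.\<close>
  define c where "c = complex_of_real (inverse (sqrt l))"
  have "inverse (sqrt l) * inverse (sqrt l) * l = 1"
    using e'(2) by (simp add: field_simps)
  then have c2: "c * c * complex_of_real l = 1"
    unfolding c_def by (metis of_real_mult of_real_1)
  let ?b = "\<lambda>x. c * k x"
  have Cb: "C ?b" by (intro continuous_intros k)
  have bb: "conv ?b ?b = e"
  proof -
    have "conv ?b ?b = (\<lambda>x. c * conv k ?b x)" by (rule conv_cmult[OF k(1) Cb])
    also have "\<dots> = (\<lambda>x. c * (c * conv k k x))"
      by (simp only: conv_commute[OF k(1) Cb] conv_cmult[OF k(1) k(1)])
    also have "\<dots> = (\<lambda>x. c * c * complex_of_real l * e x)" by (simp add: kk mult.assoc)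
    finally show ?thesis unfolding c2 by simp
  qed
  have be: "conv ?b e = ?b" by (simp add: conv_cmult[OF k(1) Ce] k(3))
  let ?s = "\<lambda>x. e x + ?b x"
  let ?g = "\<lambda>x. 1 / 2 * ?s x"
  have Cs: "C ?s" by (intro continuous_on_add Ce Cb)
  have Cg: "C ?g" by (intro continuous_on_mult continuous_on_const Cs)
  have se: "conv ?s e = ?s" by (simp only: conv_add[OF Ce Cb Ce] ie be)
  have sb: "conv ?s ?b = ?s"
    unfolding conv_add[OF Ce Cb Cb] conv_commute[OF Ce Cb] be bb by (simp add: add.commute)
  have "conv ?s ?s = (\<lambda>x. conv e ?s x + conv ?b ?s x)" by (rule conv_add[OF Ce Cb Cs])
  also have "\<dots> = (\<lambda>x. 2 * ?s x)"
    unfolding conv_commute[OF Ce Cs] conv_commute[OF Cb Cs] se sb by (simp add: fun_eq_iff)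
  finally have ss: "conv ?s ?s = (\<lambda>x. 2 * ?s x)" .
  have "conv ?g ?g = (\<lambda>x. 1 / 2 * conv ?s ?g x)" by (rule conv_cmult[OF Cs Cg])
  also have "\<dots> = (\<lambda>x. 1 / 2 * (1 / 2 * conv ?s ?s x))"
    by (simp only: conv_commute[OF Cs Cg] conv_cmult[OF Cs Cs])
  also have "\<dots> = ?g" by (simp add: ss fun_eq_iff field_simps)
  finally have gg: "conv ?g ?g = ?g" .
  have ge: "conv ?g e = ?g" by (simp only: conv_cmult[OF Cs Ce] se)
  have "adj ?g = ?g"
    using ae k(2) by (simp add: adj_def fun_eq_iff c_def)
  then have g: "herm_idem ?g" if "?g z \<noteq> 0" for z
    unfolding herm_idem_def using Cg gg that by blast
  have sl: "c * complex_of_real (sqrt l) = 1" using e'(2) by (simp add: c_def)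
  show ?thesis
  proof (cases "\<exists>z. ?g z \<noteq> 0")
    case True
    then have "?g = e" using g ge min by blast
    then have "?b x = e x" for x by (auto simp: fun_eq_iff field_simps dest!: spec[of _ x])
    then have "k x = complex_of_real (sqrt l) * e x" for x
      using sl by (metis mult.assoc mult.commute mult_1)
    then show ?thesis by blast
  next
    case False
    then have "?b x = - e x" for x by (simp add: eq_neg_iff_add_eq_0 add.commute)
    then have "k x = complex_of_real (- sqrt l) * e x" for x
      using sl by (metis mult.assoc mult.commute mult_1 mult_minus_left mult_minus_right of_real_minus)
    then show ?thesis by blast
  qed
qed

text \<open>
  The kernels \<open>c * e (x + a) + cnj c * e (x - a)\<close> are hermitian and fixed by \<open>e\<close>, hence real multiples of \<open>e\<close>.
  Taking \<open>c = 1\<close> and \<open>c = \<i>\<close> shows that translation by \<open>a\<close> multiplies \<open>e\<close> by a scalar.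
\<close>

lemma character_of_minimal:
  assumes e: "herm_idem e" and min: "\<And>e'. herm_idem e' \<Longrightarrow> conv e' e = e' \<Longrightarrow> e' = e"
  shows "continuous_character (\<lambda>x. e x / e 0)"
proof -
  have Ce: "C e" and ae: "adj e = e" and ie: "conv e e = e" using e by (auto simp: herm_idem_def)
  have e0: "e 0 \<noteq> 0" "cnj (e 0) = e 0" using herm_idem_0[OF e] by auto
  have herm: "cnj (e x) = e (- x)" for x
    by (metis ae adj_def add.inverse_inverse complex_cnj_cnj)
  have translate: "\<exists>r::real. \<forall>x. c * e (x + a) + cnj c * e (x - a) = complex_of_real r * e x" for c a
  proof -
    let ?k = "\<lambda>x. c * e (x + a) + cnj c * e (x + - a)"
    have Ca: "C (\<lambda>x. e (x + b))" and Cc: "C (\<lambda>x. d * e (x + b))" for b d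
      by (intro continuous_intros C_shift Ce)+
    have Ck: "C ?k" by (intro continuous_on_add Cc)
    have ak: "adj ?k = ?k"
      by (simp add: adj_def fun_eq_iff herm add.commute)
    have sh: "conv (\<lambda>x. d * e (x + b)) e = (\<lambda>x. d * e (x + b))" for d b
      by (simp only: conv_cmult[OF Ca Ce] conv_shift[OF Ce Ce] ie)
    have "conv ?k e = ?k" by (simp only: conv_add[OF Cc Cc Ce] sh)
    from minimal_scalar[OF e min Ck ak this] obtain r :: real where "?k = (\<lambda>x. complex_of_real r * e x)" by blast
    then have "?k x = complex_of_real r * e x" for x by (rule fun_cong)
    then show ?thesis by auto
  qed
  have mu: "\<exists>\<mu>. \<forall>x. e (x + a) = \<mu> * e x" for a
  proof -
    obtain r1 r2 :: real where r: "\<And>x. 1 * e (x + a) + cnj 1 * e (x - a) = complex_of_real r1 * e x"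
      "\<And>x. \<i> * e (x + a) + cnj \<i> * e (x - a) = complex_of_real r2 * e x"
      using translate[of 1 a] translate[of \<i> a] by blast
    have "e (x + a) = (complex_of_real r1 - \<i> * complex_of_real r2) / 2 * e x" for x
    proof -
      have "- \<i> * (\<i> * e (x + a) + cnj \<i> * e (x - a)) = e (x + a) - e (x - a)"
        by (simp add: algebra_simps)
      then have "e (x + a) - e (x - a) = - \<i> * (complex_of_real r2 * e x)" by (simp only: r(2))
      moreover have "e (x + a) + e (x - a) = complex_of_real r1 * e x" using r(1)[of x] by simp
      ultimately have "2 * e (x + a) = complex_of_real r1 * e x - \<i> * (complex_of_real r2 * e x)" by algebra
      then show ?thesis by (simp add: algebra_simps)
    qed
    then show ?thesis by blast
  qed
  have mult: "e (x + y) / e 0 = e x / e 0 * (e y / e 0)" for x y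
  proof -
    obtain \<mu> where \<mu>: "\<And>x. e (x + y) = \<mu> * e x" using mu[of y] by blast
    show ?thesis using \<mu>[of x] \<mu>[of 0] e0(1) by simp
  qed
  have "norm (e x / e 0) = 1" for x
  proof -
    have "(e x / e 0) * cnj (e x / e 0) = (e x / e 0) * (e (- x) / e 0)" by (simp add: herm e0)
    also have "\<dots> = e (x + - x) / e 0" by (rule mult[symmetric])
    also have "\<dots> = 1" using e0(1) by simp
    finally have "complex_of_real ((norm (e x / e 0))\<^sup>2) = 1" by (simp only: complex_norm_square)
    then have "(norm (e x / e 0))\<^sup>2 = 1" by (simp only: of_real_eq_1_iff)
    then have "norm (e x / e 0) = 1 \<or> norm (e x / e 0) = - 1" by (simp only: power2_eq_1_iff)
    then show ?thesis using norm_ge_zero[of "e x / e 0"] by linarith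
  qed
  then show ?thesis
    unfolding continuous_character_def using mult Ce e0(1)
    by (auto intro!: continuous_intros)
qed

lemma completely_regular: "completely_regular_space (euclidean :: 'a topology)"
proof -
  have "compact_space (euclidean :: 'a topology)" using compact_univ by (simp add: compact_space_def)
  then show ?thesis
    by (intro normal_imp_completely_regular_space_A compact_Hausdorff_or_regular_imp_normal_space
        Hausdorff_imp_t1_space disjI1 Hausdorff_space_euclidean_t2)
qed

text \<open>An \<open>e\<close> invariant under translation by \<open>a\<close> satisfies h * e = 0
  for h = f - f(_ + a), because \<open>f\<close> and its translate have the same convolution with
  \<open>e\<close>. The kernel k = h * adj h is built so that the chosen \<open>e\<close> has (k *
  k) * e = l e with l > 0, which excludes this.\<close>

lemma characters_separate:
  assumes "a \<noteq> (0::'a)"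
  shows "\<exists>\<phi>. continuous_character \<phi> \<and> \<phi> a \<noteq> 1"
proof -
  obtain \<theta> :: "'a \<Rightarrow> real" where \<theta>: "continuous_on UNIV \<theta>" "\<theta> 0 \<noteq> \<theta> a"
  proof -
    have "closedin euclidean {a}" by simp
    then obtain \<theta> :: "'a \<Rightarrow> real" where
      "continuous_map euclidean (top_of_set {0..1}) \<theta>" "\<theta> 0 = 0" "\<theta> ` {a} \<subseteq> {1}"
      using assms completely_regular unfolding completely_regular_space_def by (metis DiffI UNIV_I singletonD topspace_euclidean)
    then show thesis using that[of \<theta>] by (simp add: continuous_map_in_subtopology)
  qed
  define f where "f x = complex_of_real (\<theta> x)" for x
  have Cf: "C f" unfolding f_def by (intro continuous_intros \<theta>)
  define h where "h x = f x - f (x + a)" for x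
  have Ch: "C h" unfolding h_def by (intro continuous_intros C_shift Cf)
  have h0: "h 0 \<noteq> 0" using \<theta>(2) by (simp add: h_def f_def)
  define k where "k = conv h (adj h)"
  have Ck: "C k" unfolding k_def by (intro C_conv C_adj Ch)
  have ak: "adj k = k" unfolding k_def by (simp add: adj_conv C_adj Ch conv_commute[OF Ch C_adj[OF Ch]])
  have k0: "k 0 \<noteq> 0"
  proof -
    have "k 0 = inn h h" by (simp add: k_def conv_def inn_def adj_def)
    then show ?thesis using N2_pos[OF Ch h0] inn_self[OF Ch] by simp
  qed
  let ?K = "conv k k"
  have CK: "C ?K" by (intro C_conv Ck)
  obtain e0 l where e0: "herm_idem e0" "l > 0" "conv ?K e0 = (\<lambda>x. complex_of_real l * e0 x)"
    using power_iteration[OF Ck ak k0] by blast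
  obtain e where e: "herm_idem e" "conv ?K e = (\<lambda>x. complex_of_real l * e x)"
    "\<And>e'. herm_idem e' \<Longrightarrow> conv e' e = e' \<Longrightarrow> e' = e"
    using minimal_herm_idem[OF e0(1) CK e0(3)] by blast
  have Ce: "C e" using e(1) by (simp add: herm_idem_def)
  have ne: "e 0 \<noteq> 0" using herm_idem_0[OF e(1)] by auto
  let ?\<phi> = "\<lambda>x. e x / e 0"
  have \<phi>: "continuous_character ?\<phi>" by (rule character_of_minimal[OF e(1,3)])
  have "?\<phi> a \<noteq> 1"
  proof
    assume "?\<phi> a = 1"
    then have inv: "e (x + a) = e x" for x
      using \<phi> ne unfolding continuous_character_def by (metis divide_cancel_right mult.right_neutral)
    have fe: "conv (\<lambda>x. f (x + a)) e = conv f e"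
    proof -
      have "conv (\<lambda>x. f (x + a)) e = (\<lambda>x. conv f e (x + a))" by (rule conv_shift[OF Cf Ce])
      also have "\<dots> = conv (\<lambda>x. e (x + a)) f" by (simp only: conv_commute[OF Cf Ce] conv_shift[OF Ce Cf])
      also have "\<dots> = conv f e" by (simp only: inv conv_commute[OF Ce Cf])
      finally show ?thesis .
    qed
    have "conv h e = (\<lambda>x. conv f e x - conv (\<lambda>x. f (x + a)) e x)"
      unfolding h_def[abs_def] by (rule conv_diff[OF Cf C_shift(1)[OF Cf] Ce])
    then have he: "conv h e = (\<lambda>x. 0)" by (simp add: fe)
    have "conv k e = conv (conv (adj h) h) e" by (simp only: k_def conv_commute[OF Ch C_adj[OF Ch]])
    also have "\<dots> = conv (adj h) (conv h e)" by (rule conv_assoc[OF C_adj[OF Ch] Ch Ce])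
    also have "\<dots> = (\<lambda>x. 0)" unfolding he by (simp add: conv_def fun_eq_iff)
    finally have "conv k e = (\<lambda>x. 0)" .
    then have "conv ?K e = (\<lambda>x. 0)" by (simp add: conv_assoc Ck Ce) (simp add: conv_def fun_eq_iff)
    then have "complex_of_real l * e 0 = 0" using fun_cong[OF e(2), of 0] by simp
    then show False using ne e0(2) by simp
  qed
  then show ?thesis using \<phi> by blast
qed

end

section \<open>The compact case\<close>

context compact_abelian_group
begin

lemma bohr_eq_euclidean: "(bohr_topology :: 'a topology) = euclidean"
proof -
  have cont: "continuous_map euclidean (bohr_topology :: 'a topology) id"
    unfolding continuous_map_def
  proof (intro conjI allI impI)
    fix W assume "openin (bohr_topology :: 'a topology) W"
    then have "openin euclidean W"
      by (rule bohr_topology_weakest[rotated 2]) (simp_all add: continuous_character_def)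
    then show "openin euclidean {x \<in> topspace euclidean. id x \<in> W}" by simp
  qed simp
  have haus: "Hausdorff_space (bohr_topology :: 'a topology)"
    unfolding Hausdorff_space_def
  proof (intro allI impI)
    fix x y :: 'a assume "x \<in> topspace bohr_topology \<and> y \<in> topspace bohr_topology \<and> x \<noteq> y"
    then obtain \<phi> where \<phi>: "continuous_character \<phi>" "\<phi> (x - y) \<noteq> 1"
      using characters_separate[of "x - y"] by auto
    have "\<phi> x = \<phi> (x - y) * \<phi> y" using continuous_character_mult[OF \<phi>(1), of "x - y" y] by simp
    then have "\<phi> x \<noteq> \<phi> y" using \<phi>(2) continuous_character_norm[OF \<phi>(1), of y] by auto
    then obtain U V where "open U" "open V" "\<phi> x \<in> U" "\<phi> y \<in> V" "U \<inter> V = {}"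
      using hausdorff by metis
    then show "\<exists>U V. openin bohr_topology U \<and> openin bohr_topology V \<and> x \<in> U \<and> y \<in> V \<and> disjnt U V"
      using openin_bohr_topology_vimage[OF \<phi>(1)]
      by (intro exI[of _ "\<phi> -` U"] exI[of _ "\<phi> -` V"]) (auto simp: disjnt_def)
  qed
  have "homeomorphic_map euclidean (bohr_topology :: 'a topology) id"
    using compact_univ by (intro continuous_imp_homeomorphic_map[OF cont _ haus]) (auto simp: compact_space_def)
  then show ?thesis by (simp add: homeomorphic_map_id)
qed

end

lemma equicontinuous_if_convergent:
  fixes s :: "nat \<Rightarrow> 'a \<Rightarrow> real"
  assumes X: "compact_space X" and s: "range s \<subseteq> cont_functions X"
    and lim: "limitin (compact_open_topology X) s f sequentially"
  shows "equicontinuous_family X (range s)"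
  unfolding equicontinuous_family_def
proof (intro ballI allI impI)
  fix x and e :: real assume x: "x \<in> topspace X" and e: "e > 0"
  have f: "f \<in> cont_functions X" using limitin_topspace[OF lim] by simp
  then have cf: "continuous_map X euclideanreal f" by (simp add: cont_functions_def)
  have cs: "continuous_map X euclideanreal (s n)" for n using s by (auto simp: cont_functions_def)
  \<comment> \<open>The closed ball makes this set closed, hence compact, and it contains a
    neighbourhood of x. So one subbasic neighbourhood of \<open>f\<close> keeps the tail of the
    sequence within e/2 of \<open>f x\<close> at x and at all nearby points.\<close>
  let ?K = "{t \<in> topspace X. f t \<in> cball (f x) (e / 4)}"
  let ?W = "{g \<in> cont_functions X. g ` ?K \<subseteq> ball (f x) (e / 2)}"
  have "closedin X ?K" by (rule closedin_continuous_map_preimage[OF cf]) simp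
  then have "compactin X ?K" by (rule closedin_compact_space[OF X])
  then have W: "openin (compact_open_topology X) ?W"
    unfolding compact_open_topology_def by (intro topology_generated_by_Basis) blast
  have "f \<in> ?W" using f e by auto
  then have "\<forall>\<^sub>F n in sequentially. s n \<in> ?W" by (rule limitinD[OF lim W])
  then obtain M where M: "\<forall>n\<ge>M. s n \<in> ?W" unfolding eventually_sequentially by (elim exE)
  \<comment> \<open>The finitely many terms before the tail are controlled by their own
    continuity.\<close>
  let ?N = "\<Inter>(insert {t \<in> topspace X. f t \<in> ball (f x) (e / 4)} ((\<lambda>n. {t \<in> topspace X. s n t \<in> ball (s n x) e}) ` {..<M}))"
  have "openin X {t \<in> topspace X. g t \<in> ball c d}" if "continuous_map X euclideanreal g" for g c d
    by (rule openin_continuous_map_preimage[OF that]) simp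
  then have "openin X ?N"
    using cf cs by (intro openin_Inter) (auto simp del: mem_ball)
  moreover have "x \<in> ?N" using x e by auto
  moreover have "\<bar>s n t - s n x\<bar> < e" if t: "t \<in> ?N" for n t
  proof (cases "n < M")
    case True
    then show ?thesis using t by (auto simp: dist_real_def abs_minus_commute)
  next
    case False
    then have "s n \<in> ?W" using M by simp
    then have "s n ` ?K \<subseteq> ball (f x) (e / 2)" by simp
    moreover have "t \<in> ?K" "x \<in> ?K" using t x e by auto
    ultimately have "s n t \<in> ball (f x) (e / 2)" "s n x \<in> ball (f x) (e / 2)" by blast+
    then show ?thesis using dist_triangle_half_r[of "f x" "s n t" e "s n x"] by (simp add: dist_real_def)
  qed
  ultimately show "\<exists>N. openin X N \<and> x \<in> N \<and> (\<forall>t\<in>N. \<forall>f\<in>range s. \<bar>f t - f x\<bar> < e)"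
    by (intro exI[of _ ?N]) auto
qed

lemma (in compact_abelian_group) sequentially_Ascoli_bohr: "sequentially_Ascoli (bohr_topology :: 'a topology)"
proof -
  have cpt: "compact_space (euclidean :: 'a topology)" using compact_univ by (simp add: compact_space_def)
  have tych: "Tychonoff_space (euclidean :: 'a topology)"
    unfolding Tychonoff_space_def using completely_regular by (simp add: Hausdorff_space_euclidean_t2)
  show ?thesis
    unfolding sequentially_Ascoli_def bohr_eq_euclidean topspace_compact_open_topology
  proof (intro conjI allI impI tych)
    fix s :: "nat \<Rightarrow> 'a \<Rightarrow> real" and f
    assume "range s \<subseteq> cont_functions euclidean \<and> limitin (compact_open_topology euclidean) s f sequentially"
    then show "equicontinuous_family euclidean (range s)"
      by (elim conjE) (rule equicontinuous_if_convergent[OF cpt])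
  qed
qed

theorem theorem3p1:
  assumes "locally_compact_space (euclidean :: 'a::{topological_ab_group_add, t2_space} topology)"
  shows "sequentially_Ascoli (bohr_topology :: 'a topology) \<longleftrightarrow> compact (UNIV :: 'a set)"
proof
  assume "compact (UNIV :: 'a set)"
  then interpret compact_abelian_group "TYPE('a)" by unfold_locales
  show "sequentially_Ascoli (bohr_topology :: 'a topology)" by (rule sequentially_Ascoli_bohr)
next
  assume asc: "sequentially_Ascoli (bohr_topology :: 'a topology)"
  show "compact (UNIV :: 'a set)"
  proof (rule ccontr)
    assume "\<not> compact (UNIV :: 'a set)"
    then obtain \<psi> :: "nat \<Rightarrow> 'a \<Rightarrow> complex" where "slow_characters \<psi>"
      using exists_slow_characters[OF assms] by blast
    then show False using asc slow_characters.not_sequentially_Ascoli by blast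
  qed
qed

end
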